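(* Let $\mathrm{Coup}(E)$ be a connected coupling graph on $[n]$ that is not the 4-cycle $C_4$ and not the complete graph $K_n$, let $\Gamma=(Q,C)$ be a quantum circuit with $n$ qubits and $m\ge 1$ gates, and let $X$ be the associated directed graph. Then the full automorphism group of $X$ is $$\mathrm{Aut}(X)=G_X:=\{(\mathrm{id}_{\{s\}},\rho,\dots,\rho,\mathrm{id}_{\{t\}}) : \rho\in G_{\mathrm{sub}}\},\qquad G_{\mathrm{sub}}:=\bigcap_{k=1}^m \mathrm{Aut}(\mathrm{Cay}(\mathbb{S}_n,T),F^k),$$ where $(\mathrm{id}_{\{s\}},\rho,\dots,\rho,\mathrm{id}_{\{t\}})$ denotes the permutation of the vertices of $X$ fixing $s$ and $t$ and mapping $\tau^k$ to $\rho(\tau)^k$ for all $\tau\in\mathbb{S}_n$, $k\in[m]$. Moreover, $G_X\cong \mathbb{S}_n(\mathcal{F})\times\mathrm{Aut}(\mathrm{Coup}(E))$.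
   Context: Notation: $[n]=\{1,\dots,n\}$; $\mathbb{S}_n$ is the symmetric group on $[n]$; products are compositions $\tau\sigma=\tau\circ\sigma$; $\tau^{-1}(S)=\{\tau^{-1}(s):s\in S\}$. Coupling graph: a simple undirected graph $\mathrm{Coup}(E)=([n],E)$, with $T=\{(i~j)\in\mathbb{S}_n:\{i,j\}\in E\}$. Qubits $Q=\{q_1,\dots,q_n\}$ are identified with $[n]$; a qubit order is an element $\tau\in\mathbb{S}_n$ (a bijection from locations $[n]$ to $Q$); a gate is a two-element subset of $Q$; a quantum circuit is $\Gamma=(Q,C)$ with $C=(g^1,\dots,g^m)$ a sequence of gates. $\mathrm{Cay}(\mathbb{S}_n,T)$ is the directed graph with vertex set $\mathbb{S}_n$ and arcs $(\tau,\tau\sigma)$, $\tau\in\mathbb{S}_n,\sigma\in T$. An automorphism of a directed graph is a permutation $\rho$ of its vertices such that $(u,v)$ is an arc iff $(\rho(u),\rho(v))$ is an arc. For $k\in[m]$, $F^k=\{\tau\in\mathbb{S}_n:\tau^{-1}(g^k)\in E\}$ and $\mathrm{Aut}(\mathrm{Cay}(\mathbb{S}_n,T),F^k)=\{\rho\in\mathrm{Aut}(\mathrm{Cay}(\mathbb{S}_n,T)):\rho(F^k)=F^k\}$. The graph $X=(V,A)$: its vertices are $s$, $t$ and the disjoint copies $V^k=\{\tau^k:\tau\in\mathbb{S}_n\}$, $k\in[m]$, of $\mathbb{S}_n$. Its arcs are $A^1\cup\dots\cup A^m\cup D^0\cup\dots\cup D^m$ with $A^k=\{(\tau^k,(\tau\sigma)^k):\tau\in\mathbb{S}_n,\sigma\in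 T\}$, $D^0=\{(s,\tau^1):\tau\in\mathbb{S}_n\}$, $D^k=\{(\tau^k,\tau^{k+1}):\tau\in F^k\}$ for $1\le k\le m-1$, and $D^m=\{(\tau^m,t):\tau\in F^m\}$. Fixing pattern: the gate graph $(Q,U)$ has vertex set $Q$ and edge set $U=\{g: g\in C\}$. The fixing pattern $\mathcal{F}=\{S_1,\dots,S_l\}$ is the partition of $Q$ whose parts are: each singleton consisting of a qubit lying in a connected component of $(Q,U)$ of size at least 3; each pair of qubits forming a connected component of size 2; and the set of all isolated vertices of $(Q,U)$ (if nonempty). $\mathbb{S}_n(\mathcal{F})=\{a\in\mathbb{S}_n: a(S_i)=S_i\ \forall i\in[l]\}$. *)

theory Defs
  imports
    "Graph_Theory.Graph_Theory"
    "HOL-Combinatorics.Permutations"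
    "HOL-Library.Ramsey"
    "HOL-Algebra.Group"
begin

section \<open>Automorphism groups of directed graphs\<close>

text \<open>Permutations of a set \<open>V\<close> are functions that are the identity outside \<open>V\<close> (\<open>permutes\<close>),
  so every automorphism is represented by exactly one function.\<close>

definition digraph_auts :: "'a pair_pre_digraph \<Rightarrow> ('a \<Rightarrow> 'a) set" where
  "digraph_auts G = {\<rho>. \<rho> permutes pverts G \<and>
     (\<forall>u\<in>pverts G. \<forall>v\<in>pverts G. (u, v) \<in> parcs G \<longleftrightarrow> (\<rho> u, \<rho> v) \<in> parcs G)}"

definition perm_group :: "('a \<Rightarrow> 'a) set \<Rightarrow> ('a \<Rightarrow> 'a) monoid" where
  "perm_group H = \<lparr>carrier = H, mult = (\<circ>), one = id\<rparr>"

abbreviation symm :: "nat \<Rightarrow> (nat \<Rightarrow> nat) set" where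
  "symm n \<equiv> {\<tau>. \<tau> permutes {1..n}}"


section \<open>Undirected graphs on \<open>{1..n}\<close>\<close>

text \<open>An edge set is a set \<open>E\<close> of two-element subsets of \<open>{1..n}\<close>, i.e. \<open>E \<subseteq> nsets {1..n} 2\<close>.
  The graph \<open>({1..n}, E)\<close> is turned into a symmetric digraph, so that connectivity,
  connected components and automorphisms are those of that digraph.\<close>

definition ugraph :: "nat \<Rightarrow> nat set set \<Rightarrow> nat pair_pre_digraph" where
  "ugraph n E = \<lparr>pverts = {1..n}, parcs = {(i, j). i \<in> {1..n} \<and> j \<in> {1..n} \<and> {i, j} \<in> E}\<rparr>"

definition is_C4 :: "nat \<Rightarrow> nat set set \<Rightarrow> bool" where
  "is_C4 n E \<longleftrightarrow> (\<exists>f. bij_betw f {1..4::nat} {1..n} \<and>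
     E = {{f 1, f 2}, {f 2, f 3}, {f 3, f 4}, {f 4, f 1}})"

definition is_complete :: "nat \<Rightarrow> nat set set \<Rightarrow> bool" where
  "is_complete n E \<longleftrightarrow> E = nsets {1..n} 2"

definition transpositions :: "nat \<Rightarrow> nat set set \<Rightarrow> (nat \<Rightarrow> nat) set" where
  "transpositions n E = {transpose i j | i j. i \<in> {1..n} \<and> j \<in> {1..n} \<and> {i, j} \<in> E}"

definition cay :: "nat \<Rightarrow> (nat \<Rightarrow> nat) set \<Rightarrow> (nat \<Rightarrow> nat) pair_pre_digraph" where
  "cay n T = \<lparr>pverts = symm n, parcs = {(\<tau>, \<tau> \<circ> \<sigma>) | \<tau> \<sigma>. \<tau> \<in> symm n \<and> \<sigma> \<in> T}\<rparr>"


section \<open>The digraph of a quantum circuit\<close>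

text \<open>Qubits are identified with \<open>{1..n}\<close>. A circuit is the list \<open>C\<close> of its gates
  (two-element subsets of \<open>{1..n}\<close>); lists are indexed from 0, so the \<open>k\<close>-th gate is \<open>C ! (k - 1)\<close>.\<close>

definition feasible :: "nat \<Rightarrow> nat set set \<Rightarrow> nat set list \<Rightarrow> nat \<Rightarrow> (nat \<Rightarrow> nat) set" where
  "feasible n E C k = {\<tau> \<in> symm n. inv_into UNIV \<tau> ` (C ! (k - 1)) \<in> E}"

datatype 'a layered = Src | Snk | Copy nat 'a

definition circuit_digraph ::
    "nat \<Rightarrow> nat set set \<Rightarrow> nat set list \<Rightarrow> (nat \<Rightarrow> nat) layered pair_pre_digraph" where
  "circuit_digraph n E C = (let m = length C in
     \<lparr>pverts = {Src, Snk} \<union> {Copy k \<tau> | k \<tau>. k \<in> {1..m} \<and> \<tau> \<in> symm n},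
      parcs =
          {(Copy k \<tau>, Copy k (\<tau> \<circ> \<sigma>)) | k \<tau> \<sigma>.
             k \<in> {1..m} \<and> \<tau> \<in> symm n \<and> \<sigma> \<in> transpositions n E}
        \<union> {(Src, Copy 1 \<tau>) | \<tau>. \<tau> \<in> symm n}
        \<union> {(Copy k \<tau>, Copy (k + 1) \<tau>) | k \<tau>. 1 \<le> k \<and> k + 1 \<le> m \<and> \<tau> \<in> feasible n E C k}
        \<union> {(Copy m \<tau>, Snk) | \<tau>. \<tau> \<in> feasible n E C m}\<rparr>)"

text \<open>The permutation \<open>(id, \<rho>, \<dots>, \<rho>, id)\<close> with \<open>m\<close> entries \<open>\<rho>\<close>; copies with an index outside
  \<open>{1..m}\<close> are not vertices and are therefore left fixed.\<close>

fun layerwise :: "nat \<Rightarrow> ('a \<Rightarrow> 'a) \<Rightarrow> 'a layered \<Rightarrow> 'a layered" where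
  "layerwise m \<rho> Src = Src"
| "layerwise m \<rho> Snk = Snk"
| "layerwise m \<rho> (Copy k \<tau>) = (if k \<in> {1..m} then Copy k (\<rho> \<tau>) else Copy k \<tau>)"

definition cay_auts_fixing ::
    "nat \<Rightarrow> (nat \<Rightarrow> nat) set \<Rightarrow> (nat \<Rightarrow> nat) set \<Rightarrow> ((nat \<Rightarrow> nat) \<Rightarrow> (nat \<Rightarrow> nat)) set" where
  "cay_auts_fixing n T F = {\<rho> \<in> digraph_auts (cay n T). \<rho> ` F = F}"

definition G_sub ::
    "nat \<Rightarrow> nat set set \<Rightarrow> nat set list \<Rightarrow> ((nat \<Rightarrow> nat) \<Rightarrow> (nat \<Rightarrow> nat)) set" where
  "G_sub n E C =
     (\<Inter>k\<in>{1..length C}. cay_auts_fixing n (transpositions n E) (feasible n E C k))"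

definition G_X ::
    "nat \<Rightarrow> nat set set \<Rightarrow> nat set list \<Rightarrow> ((nat \<Rightarrow> nat) layered \<Rightarrow> (nat \<Rightarrow> nat) layered) set" where
  "G_X n E C = {layerwise (length C) \<rho> | \<rho>. \<rho> \<in> G_sub n E C}"


section \<open>The fixing pattern\<close>

text \<open>For the symmetric digraph \<open>ugraph n U\<close> the strongly connected components are the connected
  components of the gate graph.\<close>

definition gate_components :: "nat \<Rightarrow> nat set list \<Rightarrow> nat set set" where
  "gate_components n C = pre_digraph.sccs_verts (with_proj (ugraph n (set C)))"

definition isolated_qubits :: "nat \<Rightarrow> nat set list \<Rightarrow> nat set" where
  "isolated_qubits n C = {q \<in> {1..n}. \<forall>g\<in>set C. q \<notin> g}"

definition fixing_pattern :: "nat \<Rightarrow> nat set list \<Rightarrow> nat set set" where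
  "fixing_pattern n C =
       {{q} | q K. K \<in> gate_components n C \<and> q \<in> K \<and> card K \<ge> 3}
     \<union> {K \<in> gate_components n C. card K = 2}
     \<union> ({isolated_qubits n C} - {{}})"

definition pattern_perms :: "nat \<Rightarrow> nat set set \<Rightarrow> (nat \<Rightarrow> nat) set" where
  "pattern_perms n \<F> = {a \<in> symm n. \<forall>S\<in>\<F>. a ` S = S}"

end

theory Submission
  imports Defs
begin

text \<open>The heart of the matter is that, for a connected graph other than \<open>C\<^sub>4\<close> and \<open>K\<^sub>n\<close>, every
  automorphism \<open>\<rho>\<close> of the Cayley graph has the form \<open>\<tau> \<mapsto> a \<tau> b\<inverse>\<close> with \<open>a\<close> a permutation and \<open>b\<close> an
  automorphism of the coupling graph (\<open>cay_aut_two_sided\<close>).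

  To see this, let \<open>label \<tau> t\<close> be the transposition by which \<open>\<rho> (\<tau> t)\<close> differs from \<open>\<rho> \<tau>\<close>. Each
  \<open>label \<tau>\<close> permutes \<open>T\<close>, and it suffices that it does not depend on \<open>\<tau>\<close>: then \<open>\<rho>\<close> is, up to a left
  translation, a group homomorphism that permutes transpositions, hence conjugation by some \<open>b\<close>
  (\<open>inner\<close>). Short cycles of the Cayley graph control the labels. A product of two distinct
  transpositions \<open>s\<close>, \<open>t\<close> has only the factorizations with factors among \<open>s\<close>, \<open>t\<close>, \<open>sts\<close>
  (\<open>factors_of_product\<close>); so labels respect commutation and triangles of the graph, and moving from
  \<open>\<tau>\<close> to \<open>\<tau>e\<close> can change the label of \<open>f\<close> only by reflecting it in the label \<open>{x, y}\<close> of \<open>e\<close>. When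
  \<open>e\<close> and \<open>f\<close> meet outside a triangle, the relation \<open>efe = fef\<close> gives the same conclusion, with
  reflection across an induced 4-cycle through \<open>{x, y}\<close> (\<open>hexagon_deviation\<close>). If such a change
  happens at all, every edge meeting \<open>{x, y}\<close> is reflected, and a neighbour of only one end of
  \<open>{x, y}\<close> has degree 2 and lies on a 4-cycle with \<open>{x, y}\<close> (\<open>swappable_if_moved\<close>). If \<open>{x, y}\<close> lies
  in a triangle, the change spreads to the other edges of the triangle and the graph is
  complete. Otherwise the graph consists of 4-cycles glued along \<open>{x, y}\<close>; it is \<open>K\<^sub>2\<close>, or \<open>C\<^sub>4\<close>, or there
  are at least two of these and the degrees prevent any change along the other edges, which makes the
  hexagon rigid (\<open>no_swaps\<close>).

  For the circuit digraph, \<open>Src\<close> is the only source, \<open>Snk\<close> the only sink, and pairs of opposite arcs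
  occur only inside layers; hence an automorphism preserves the layers. The permutations it induces
  on consecutive layers agree on a feasible set, and a map \<open>\<tau> \<mapsto> a \<tau> b\<inverse>\<close> is determined by its values
  there (\<open>two_sided_determined\<close>), so all layers carry the same \<open>\<rho>\<close>. Finally \<open>\<tau> \<mapsto> a \<tau> b\<inverse>\<close> maps the
  feasible set of \<open>g\<close> onto that of \<open>a g\<close>, and distinct gates have distinct feasible sets
  (\<open>feas_inj\<close>); thus \<open>b\<close> is arbitrary and \<open>a\<close> has to stabilize every gate, which is what the fixing
  pattern expresses (\<open>pattern_perms_eq\<close>).\<close>

section \<open>Products of few transpositions\<close>

definition is_transp :: "('a \<Rightarrow> 'a) \<Rightarrow> bool" where
  "is_transp t \<longleftrightarrow> (\<exists>i j. i \<noteq> j \<and> t = transpose i j)"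

lemma transpose_eq_transpose_iff:
  assumes "a \<noteq> b"
  shows "transpose a b = transpose c d \<longleftrightarrow> (a = c \<and> b = d) \<or> (a = d \<and> b = c)"
  using assms by (metis transpose_apply_first transpose_apply_second transpose_apply_other transpose_commute)

lemma transpose_comp_commute_iff:
  assumes "a \<noteq> b" "c \<noteq> d"
  shows "transpose a b \<circ> transpose c d = transpose c d \<circ> transpose a b \<longleftrightarrow>
    {a, b} = {c, d} \<or> {a, b} \<inter> {c, d} = {}"
proof
  assume "transpose a b \<circ> transpose c d = transpose c d \<circ> transpose a b"
  then have "\<And>v. transpose a b (transpose c d v) = transpose c d (transpose a b v)" by (metis comp_apply)
  from this[of a] this[of b] this[of c] this[of d]
  show "{a, b} = {c, d} \<or> {a, b} \<inter> {c, d} = {}"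
    using assms by (auto simp: transpose_def split: if_splits)
next
  assume "{a, b} = {c, d} \<or> {a, b} \<inter> {c, d} = {}"
  then show "transpose a b \<circ> transpose c d = transpose c d \<circ> transpose a b"
    by (auto simp: fun_eq_iff transpose_def doubleton_eq_iff)
qed

lemma transp_invol [simp]: "is_transp t \<Longrightarrow> t \<circ> t = id"
  by (auto simp: is_transp_def)


lemma transp_invol_left [simp]: "is_transp t \<Longrightarrow> t \<circ> (t \<circ> h) = h"
  by (simp add: comp_assoc[symmetric])

lemma factors_of_3_cycle:
  assumes eq: "transpose x y \<circ> transpose z w = transpose a b \<circ> transpose b c"
    and "x \<noteq> y" "z \<noteq> w" "a \<noteq> b" "b \<noteq> c" "a \<noteq> c"
  shows "{x, y} \<in> {{a, b}, {b, c}, {a, c}} \<and> {z, w} \<in> {{a, b}, {b, c}, {a, c}}"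
proof -
  have "\<And>v. transpose x y (transpose z w v) = transpose a b (transpose b c v)" using eq by (metis comp_apply)
  from this[of a] this[of b] this[of c] this[of x] this[of y] this[of z] this[of w]
  show ?thesis using assms(2-)
    unfolding transpose_def doubleton_eq_iff insert_iff by (smt (verit))
qed

lemma factors_of_disjoint_product:
  assumes eq: "transpose x y \<circ> transpose z w = transpose a b \<circ> transpose c d"
    and "x \<noteq> y" "z \<noteq> w" "a \<noteq> b" "c \<noteq> d" "{a, b} \<inter> {c, d} = {}"
  shows "{x, y} \<in> {{a, b}, {c, d}} \<and> {z, w} \<in> {{a, b}, {c, d}}"
proof -
  have d: "a \<noteq> c" "a \<noteq> d" "b \<noteq> c" "b \<noteq> d" using assms by auto
  have "\<And>v. transpose x y (transpose z w v) = transpose a b (transpose c d v)" using eq by (metis comp_apply)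
  from this[of a] this[of b] this[of c] this[of d] this[of x] this[of y] this[of z] this[of w]
  show ?thesis using assms(2-5) d
    unfolding transpose_def doubleton_eq_iff insert_iff by (smt (verit))
qed

lemma transpose_cong: "{a, b} = {c, d} \<Longrightarrow> transpose a b = transpose c d"
  by (auto simp: doubleton_eq_iff transpose_commute)

lemma transp_pair_cases:
  assumes "is_transp s" "is_transp t"
  obtains "s = t" 
  | a b c where "a \<noteq> b" "b \<noteq> c" "a \<noteq> c" "s = transpose a b" "t = transpose b c"
  | a b c d where "a \<noteq> b" "c \<noteq> d" "{a, b} \<inter> {c, d} = {}" "s = transpose a b" "t = transpose c d"
proof -
  obtain a b c d where *: "a \<noteq> b" "c \<noteq> d" "s = transpose a b" "t = transpose c d"
    using assms by (auto simp: is_transp_def)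
  consider "{a, b} = {c, d}" | "b = c" "a \<noteq> d" | "b = d" "a \<noteq> c" | "a = c" "b \<noteq> d" | "a = d" "b \<noteq> c"
    | "{a, b} \<inter> {c, d} = {}" by auto
  then show thesis
  proof cases
    case 1 then show thesis using that(1) * by (auto intro: transpose_cong)
  next
    case 2 then show thesis using that(2)[of a b d] * by auto
  next
    case 3 then show thesis using that(2)[of a b c] * by (auto simp: transpose_commute)
  next
    case 4 then show thesis using that(2)[of b a d] * by (auto simp: transpose_commute)
  next
    case 5 then show thesis using that(2)[of b a c] * by (auto simp: transpose_commute)
  next
    case 6 then show thesis using that(3)[of a b c d] * by auto
  qed
qed

text \<open>In geometric terms: a vertex at distance 2 of the Cayley graph has exactly two common
  neighbours with the origin if the two transpositions commute, and one or three otherwise, according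
  to whether the third transposition \<open>sts\<close> is available.\<close>
lemma factors_of_product:
  assumes "is_transp p" "is_transp q" "is_transp s" "is_transp t" "p \<circ> q = s \<circ> t" "s \<noteq> t"
  shows "p \<in> {s, t, s \<circ> t \<circ> s} \<and> q \<in> {s, t, s \<circ> t \<circ> s}"
proof -
  obtain x y z w where pq: "x \<noteq> y" "z \<noteq> w" "p = transpose x y" "q = transpose z w"
    using assms by (auto simp: is_transp_def)
  from assms(3,4) show ?thesis
  proof (cases rule: transp_pair_cases)
    case 1 then show ?thesis using assms by simp
  next
    case (2 a b c)
    have "s \<circ> t \<circ> s = transpose a c" using 2 by (simp add: transpose_comp_triple)
    then show ?thesis using factors_of_3_cycle[of x y z w a b c] 2 pq assms(5)
      by (auto simp: doubleton_eq_iff transpose_commute)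
  next
    case (3 a b c d)
    then show ?thesis using factors_of_disjoint_product[of x y z w a b c d] 3 pq assms(5)
      by (auto simp: doubleton_eq_iff transpose_commute)
  qed
qed

lemma braid:
  assumes "is_transp s" "is_transp t" "s \<circ> t \<noteq> t \<circ> s"
  shows "s \<circ> t \<circ> s = t \<circ> s \<circ> t"
  using assms(1,2)
proof (cases rule: transp_pair_cases)
  case 1 then show ?thesis using assms by simp
next
  case (2 a b c)
  then show ?thesis using transpose_comp_triple[of a c b] transpose_comp_triple[of c a b]
    by (simp add: transpose_commute)
next
  case (3 a b c d)
  then show ?thesis using assms by (simp add: transpose_comp_commute_iff)
qed

lemma noncommuting_cases:
  assumes "x \<noteq> y" "is_transp t" "transpose x y \<circ> t \<noteq> t \<circ> transpose x y"
  obtains w where "w \<noteq> x" "w \<noteq> y" "t = transpose x w \<or> t = transpose y w"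
proof -
  obtain i j where ij: "i \<noteq> j" "t = transpose i j" using assms(2) by (auto simp: is_transp_def)
  have ne: "{x, y} \<noteq> {i, j}" "{x, y} \<inter> {i, j} \<noteq> {}"
    using assms(1,3) ij transpose_comp_commute_iff[of x y i j] by auto
  then consider "i = x" "j \<noteq> y" | "i = y" "j \<noteq> x" | "j = x" "i \<noteq> y" | "j = y" "i \<noteq> x" by auto
  then show thesis using that[of i] that[of j] ij by cases (auto simp: transpose_commute)
qed

text \<open>The premises say that the image of the hexagon \<open>efe = fef\<close> starts with the same two edges
  \<open>e = {x, y}\<close>, \<open>f = {y, z}\<close> and that consecutive edges of it again meet outside triangles. The
  transpositions \<open>f'\<close>, \<open>e\<close>, \<open>f\<close>, \<open>g'\<close> move at most four points, since \<open>f' e f g'\<close> must be a product of two transpositions;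
  going through the possible shapes leaves the original hexagon and those coming from an induced
  4-cycle \<open>x y z w\<close>. In such a 4-cycle the second possibility does occur.\<close>
lemma hexagon_deviation:
  assumes d: "x \<noteq> y" "y \<noteq> z" "x \<noteq> z"
    and tr: "is_transp f'" "is_transp g'" "is_transp u" "is_transp v"
    and T: "f' \<in> T" "g' \<in> T" "u \<in> T" "v \<in> T" 
    and eT: "transpose x y \<in> T" and fT: "transpose y z \<in> T" and nT: "transpose x z \<notin> T"
    and f': "transpose x y \<circ> f' \<noteq> f' \<circ> transpose x y" "transpose x y \<circ> f' \<circ> transpose x y \<notin> T"
    and g': "transpose y z \<circ> g' \<noteq> g' \<circ> transpose y z" "transpose y z \<circ> g' \<circ> transpose y z \<notin> T"
    and eq: "transpose x y \<circ> f' \<circ> u = transpose y z \<circ> g' \<circ> v"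
  shows "f' = transpose y z \<or> (\<exists>w. w \<notin> {x, y, z} \<and> f' = transpose x w \<and> transpose z w \<in> T \<and> transpose y w \<notin> T)"
proof (rule ccontr)
  assume neg: "\<not> ?thesis"
  have pi: "u \<circ> v = f' \<circ> transpose x y \<circ> transpose y z \<circ> g'"
  proof -
    have "u = f' \<circ> transpose x y \<circ> (transpose x y \<circ> f' \<circ> u)" 
      by (simp add: comp_assoc[symmetric]) (simp add: comp_assoc tr)
    also have "\<dots> = f' \<circ> transpose x y \<circ> transpose y z \<circ> g' \<circ> v" unfolding eq by (simp add: comp_assoc)
    finally show ?thesis using tr by (simp add: comp_assoc)
  qed
  obtain w where w: "w \<notin> {x, y, z}" and fw: "f' = transpose x w \<and> transpose y w \<notin> T \<or> f' = transpose y w \<and> transpose x w \<notin> T"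
  proof -
    obtain w where w: "w \<noteq> x" "w \<noteq> y" "f' = transpose x w \<or> f' = transpose y w"
      using noncommuting_cases[OF d(1) tr(1) f'(1)] .
    from w(3) show thesis
    proof
      assume a: "f' = transpose x w"
      have "transpose y x \<circ> transpose x w \<circ> transpose y x = transpose y w"
        using w d by (intro transpose_comp_triple) auto
      then have "transpose y w \<notin> T" using f'(2) a by (simp add: transpose_commute)
      moreover have "w \<noteq> z" using a nT T(1) by auto
      ultimately show thesis using that[of w] w a by auto
    next
      assume a: "f' = transpose y w"
      have "transpose x y \<circ> transpose y w \<circ> transpose x y = transpose x w"
        using w d by (intro transpose_comp_triple) auto
      then have "transpose x w \<notin> T" using f'(2) a by simp
      moreover have "w \<noteq> z" using a neg by auto
      ultimately show thesis using that[of w] w a by auto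
    qed
  qed
  \<comment> \<open>the two shapes of \<open>g'\<close>; the endpoint \<open>k = x\<close> is possible and means \<open>g' = {x, y}\<close>\<close>
  obtain k where k: "k \<notin> {y, z}" and gw: "g' = transpose y k \<and> transpose z k \<notin> T \<or> g' = transpose z k \<and> transpose y k \<notin> T"
  proof -
    obtain w where w: "w \<noteq> y" "w \<noteq> z" "g' = transpose y w \<or> g' = transpose z w"
      using noncommuting_cases[OF d(2) tr(2) g'(1)] .
    from w(3) show thesis
    proof
      assume a: "g' = transpose y w"
      have "transpose z y \<circ> transpose y w \<circ> transpose z y = transpose z w"
        using w d by (intro transpose_comp_triple) auto
      then show thesis using g'(2) that[of w] w a by (simp add: transpose_commute)
    next
      assume a: "g' = transpose z w"
      have "transpose y z \<circ> transpose z w \<circ> transpose y z = transpose y w"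
        using w d by (intro transpose_comp_triple) auto
      then show thesis using g'(2) that[of w] w a by simp
    qed
  qed
  have pi': "\<And>i. u (v i) = f' (transpose x y (transpose y z (g' i)))"
    using pi by (metis comp_apply)
  \<comment> \<open>otherwise \<open>u v\<close> would be a 5-cycle, but it moves at most four points\<close>
  have kx: "k = x \<or> k = w"
  proof (rule ccontr)
    assume n: "\<not> (k = x \<or> k = w)"
    obtain u1 u2 v1 v2 where uv: "u = transpose u1 u2" "v = transpose v1 v2" 
      using tr(3,4) by (auto simp: is_transp_def)
    have sub: "{x, y, z, w, k} \<subseteq> {u1, u2, v1, v2}"
    proof
      fix i assume i: "i \<in> {x, y, z, w, k}"
      have "f' (transpose x y (transpose y z (g' i))) \<noteq> i"
        using fw gw i d w k n by (elim disjE conjE) (auto simp: transpose_def)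
      then have "u (v i) \<noteq> i" using pi' by simp
      then show "i \<in> {u1, u2, v1, v2}" unfolding uv by (auto simp: transpose_def split: if_splits)
    qed
    have "card {x, y, z, w, k} = 5" using d w k n by auto
    moreover have "card {u1, u2, v1, v2} \<le> 4" by (simp add: card_insert_le_m1)
    moreover have "card {x, y, z, w, k} \<le> card {u1, u2, v1, v2}" using sub by (intro card_mono) auto
    ultimately show False by linarith
  qed
  obtain u1 u2 v1 v2 where uv: "u1 \<noteq> u2" "u = transpose u1 u2" "v1 \<noteq> v2" "v = transpose v1 v2" 
    using tr(3,4) by (auto simp: is_transp_def)
  have pinid: "u \<circ> v \<noteq> id" if "u \<circ> v = transpose a b \<circ> transpose c e" "a \<noteq> b" "{a, b} \<noteq> {c, e}" for a b c e
  proof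
    assume uv: "u \<circ> v = id"
    have "transpose a b \<circ> (u \<circ> v) = transpose c e"
      unfolding that(1) by (simp add: comp_assoc[symmetric])
    then have "transpose a b = transpose c e" unfolding uv by simp
    then show False using that(2,3) transpose_eq_transpose_iff[OF that(2), of c e] by auto
  qed
  have uvne: "u \<noteq> v" if "u \<circ> v \<noteq> id" using that tr by auto
  have conj_xz: "transpose x y \<circ> (transpose y z \<circ> transpose x y) = transpose x z"
    using transpose_comp_triple[of x z y] d by (simp add: comp_assoc)
  have pair: "u = transpose a b \<or> u = transpose b c \<or> u = transpose a c" 
    "v = transpose a b \<or> v = transpose b c \<or> v = transpose a c"
    if "u \<circ> v = transpose a b \<circ> transpose b c" "a \<noteq> b" "b \<noteq> c" "a \<noteq> c" for a b c
    using factors_of_3_cycle[of u1 u2 v1 v2 a b c] that uv unfolding insert_iff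
    by (metis transpose_cong empty_iff)+
  show False using fw
  proof
    assume A: "f' = transpose x w \<and> transpose y w \<notin> T"
    have zw: "transpose w z \<notin> T" using neg A w by (auto simp: transpose_commute)
    have "k = x" using kx gw A zw T(2) by (auto simp: transpose_commute)
    then have g: "g' = transpose x y" using gw nT T(2) by (auto simp: transpose_commute)
    have uv_eq: "u \<circ> v = transpose w x \<circ> transpose x z"
      unfolding pi using A g conj_xz by (simp add: comp_assoc transpose_commute)
    have ne: "u \<circ> v \<noteq> id" using uv_eq by (rule pinid) (use d w in auto)
    have "u = transpose w x" "v = transpose w x" 
      using pair[OF uv_eq] d w T(3,4) zw nT by auto
    then show False using ne tr by simp
  next
    assume B: "f' = transpose y w \<and> transpose x w \<notin> T"
    consider "g' = transpose x y" | "g' = transpose y w" "transpose w z \<notin> T"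
      using kx gw nT T(1,2) B by (auto simp: transpose_commute)
    then show False
    proof cases
      case 1
      have uv_eq: "u \<circ> v = transpose y w \<circ> transpose x z"
        unfolding pi using B 1 conj_xz by (simp add: comp_assoc)
      have ne: "u \<circ> v \<noteq> id" using uv_eq by (rule pinid) (use d w in auto)
      have "{u1, u2} \<in> {{y, w}, {x, z}} \<and> {v1, v2} \<in> {{y, w}, {x, z}}"
        by (rule factors_of_disjoint_product) (use uv uv_eq d w in auto)
      then have "(u = transpose y w \<or> u = transpose x z) \<and> (v = transpose y w \<or> v = transpose x z)"
        unfolding insert_iff uv by (metis transpose_cong empty_iff)
      then have "u = transpose y w" "v = transpose y w" using T(3,4) nT by auto
      then show False using ne tr by simp
    next
      case 2
      have c1: "transpose w y \<circ> transpose y x \<circ> transpose w y = transpose w x"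
        "transpose w y \<circ> transpose y z \<circ> transpose w y = transpose w z"
        using d w by (auto intro!: transpose_comp_triple)
      have uv_eq: "u \<circ> v = transpose x w \<circ> transpose w z"
      proof -
        have "u \<circ> v = transpose w y \<circ> transpose y x \<circ> (transpose y z \<circ> transpose w y)"
          unfolding pi using B 2 by (simp add: comp_assoc transpose_commute)
        also have "\<dots> = transpose w y \<circ> transpose y x \<circ> (transpose w y \<circ> transpose w y) \<circ> (transpose y z \<circ> transpose w y)"
          by simp
        also have "\<dots> = (transpose w y \<circ> transpose y x \<circ> transpose w y) \<circ> (transpose w y \<circ> transpose y z \<circ> transpose w y)"
          by (simp only: comp_assoc)
        finally show ?thesis unfolding c1 by (simp add: transpose_commute)
      qed
      show False using pair(1)[OF uv_eq] d w T(3) 2 B nT by auto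
    qed
  qed
qed


section \<open>Edge labels of a Cayley automorphism\<close>

text \<open>If three of the six edges of the hexagon are known to be \<open>e\<close>, the ambiguity left by the induced
  4-cycles disappears.\<close>
lemma hexagon_rigid:
  assumes tr: "is_transp e" "is_transp f" "is_transp f'" "is_transp v"
    and T: "f' \<in> T" "v \<in> T" and ef: "e \<circ> f \<noteq> f \<circ> e" "e \<circ> f \<circ> e \<notin> T"
    and eq: "e \<circ> f' \<circ> e = f \<circ> e \<circ> v"
  shows "f' = f"
proof -
  define g where "g = e \<circ> f \<circ> e"
  have g: "g = f \<circ> e \<circ> f" unfolding g_def using braid[OF tr(1,2) ef(1)] .
  have g_tr: "is_transp g"
    using tr(1,2)
  proof (cases rule: transp_pair_cases)
    case 1
    then show ?thesis using ef(1) by simp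
  next
    case (2 a b c)
    then have "g = transpose a c" unfolding g_def by (simp add: transpose_comp_triple)
    then show ?thesis using 2(3) unfolding is_transp_def by blast
  next
    case (3 a b c d)
    then show ?thesis using ef(1) transpose_comp_commute_iff[of a b c d] by simp
  qed
  have ge: "g \<circ> f' = v \<circ> e"
  proof -
    have "g \<circ> f' = e \<circ> f \<circ> (e \<circ> f' \<circ> e) \<circ> e" unfolding g_def using tr by (simp add: comp_assoc)
    also have "\<dots> = e \<circ> (f \<circ> f) \<circ> e \<circ> v \<circ> e" unfolding eq by (simp only: comp_assoc)
    also have "\<dots> = (e \<circ> e) \<circ> v \<circ> e" by (simp add: tr(2))
    finally show ?thesis by (simp add: tr(1))
  qed
  have "g \<noteq> f'" using T ef g_def by auto
  then consider "e = g" | "e = f'" | "e = g \<circ> f' \<circ> g" using factors_of_product[OF tr(4,1) g_tr tr(3) ge[symmetric]] by auto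
  then show ?thesis
  proof cases
    case 1
    have "e \<circ> (e \<circ> f \<circ> e) \<circ> e = e \<circ> e \<circ> e" by (simp only: 1[unfolded g_def, symmetric])
    moreover have "e \<circ> (e \<circ> f \<circ> e) \<circ> e = f" by (simp add: comp_assoc tr)
    ultimately have "f = e" by (simp add: comp_assoc tr)
    then show ?thesis using ef by simp
  next
    case 2
    then have "e \<circ> f \<circ> e = e \<circ> f \<circ> (e \<circ> f' \<circ> e)" by (simp add: comp_assoc tr)
    also have "\<dots> = v" unfolding eq by (simp add: comp_assoc tr)
    finally show ?thesis using ef T by simp
  next
    case 3
    then have "f' = g \<circ> e \<circ> g" by (simp add: comp_assoc g_tr)
    also have "\<dots> = e \<circ> (f \<circ> e \<circ> f) \<circ> e" unfolding g_def by (simp add: comp_assoc tr)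
    also have "\<dots> = e \<circ> (e \<circ> f \<circ> e) \<circ> e" by (simp only: braid[OF tr(1,2) ef(1)])
    also have "\<dots> = f" by (simp add: comp_assoc tr)
    finally show ?thesis .
  qed
qed


lemma permutes_comp_cancel: "s permutes V \<Longrightarrow> (s \<circ> f = s \<circ> g) = (f = g)"
  by (metis comp_assoc id_comp permutes_inv_o(2))

lemma inv_comp_permutes: "s permutes V \<Longrightarrow> inv_into UNIV s \<circ> (s \<circ> f) = f"
  by (simp add: comp_assoc[symmetric] permutes_inv_o(2))

locale cayley_aut =
  fixes V :: "'a set" and T :: "('a \<Rightarrow> 'a) set" and \<rho> :: "('a \<Rightarrow> 'a) \<Rightarrow> ('a \<Rightarrow> 'a)"
  assumes finite_V: "finite V"
    and transp: "t \<in> T \<Longrightarrow> is_transp t"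
    and perm: "t \<in> T \<Longrightarrow> t permutes V"
    and bij: "bij_betw \<rho> {\<tau>. \<tau> permutes V} {\<tau>. \<tau> permutes V}"
    and arcs: "\<sigma> permutes V \<Longrightarrow> \<tau> permutes V \<Longrightarrow>
      (\<exists>t\<in>T. \<tau> = \<sigma> \<circ> t) \<longleftrightarrow> (\<exists>t\<in>T. \<rho> \<tau> = \<rho> \<sigma> \<circ> t)"
begin

definition label :: "('a \<Rightarrow> 'a) \<Rightarrow> ('a \<Rightarrow> 'a) \<Rightarrow> ('a \<Rightarrow> 'a)" where
  "label \<tau> t = inv_into UNIV (\<rho> \<tau>) \<circ> \<rho> (\<tau> \<circ> t)"

lemma finite_T: "finite T"
  using finite_permutations[OF finite_V] perm by (metis (mono_tags) finite_subset mem_Collect_eq subsetI)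

lemma img_perm: "\<tau> permutes V \<Longrightarrow> \<rho> \<tau> permutes V"
  using bij by (auto simp: bij_betw_def)

lemma img_inj: "\<sigma> permutes V \<Longrightarrow> \<tau> permutes V \<Longrightarrow> \<rho> \<sigma> = \<rho> \<tau> \<Longrightarrow> \<sigma> = \<tau>"
  using bij by (auto simp: bij_betw_def inj_on_def)

lemma comp_perm [simp]: "\<tau> permutes V \<Longrightarrow> t \<in> T \<Longrightarrow> \<tau> \<circ> t permutes V"
  by (simp add: perm permutes_compose)

lemma label_eqI: "\<tau> permutes V \<Longrightarrow> \<rho> (\<tau> \<circ> t) = \<rho> \<tau> \<circ> s \<Longrightarrow> label \<tau> t = s"
  unfolding label_def by (simp add: inv_comp_permutes[OF img_perm])

lemma label_mem_step:
  assumes "\<tau> permutes V" "t \<in> T"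
  shows "label \<tau> t \<in> T \<and> \<rho> (\<tau> \<circ> t) = \<rho> \<tau> \<circ> label \<tau> t"
proof -
  obtain s where s: "s \<in> T" "\<rho> (\<tau> \<circ> t) = \<rho> \<tau> \<circ> s"
    using arcs[OF assms(1) comp_perm[OF assms]] assms(2) by blast
  then show ?thesis using label_eqI[OF assms(1) s(2)] by simp
qed

lemmas label_T [simp] = label_mem_step[THEN conjunct1]
lemmas img_step = label_mem_step[THEN conjunct2]

lemma label_inj: "\<tau> permutes V \<Longrightarrow> inj_on (label \<tau>) T"
  by (rule inj_onI) (metis img_step img_inj comp_perm permutes_comp_cancel)

lemma label_surj: "\<tau> permutes V \<Longrightarrow> label \<tau> ` T = T"
  by (intro endo_inj_surj finite_T label_inj) auto

lemma label_back: "\<tau> permutes V \<Longrightarrow> t \<in> T \<Longrightarrow> label (\<tau> \<circ> t) t = label \<tau> t"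
  by (rule label_eqI) (simp_all add: img_step comp_assoc transp)

lemma label_parallelogram:
  assumes "\<tau> permutes V" "e \<in> T" "f \<in> T" "h \<in> T" "k \<in> T" "e \<circ> h = f \<circ> k"
  shows "label \<tau> e \<circ> label (\<tau> \<circ> e) h = label \<tau> f \<circ> label (\<tau> \<circ> f) k"
proof -
  have "\<rho> \<tau> \<circ> (label \<tau> e \<circ> label (\<tau> \<circ> e) h) = \<rho> ((\<tau> \<circ> e) \<circ> h)"
    by (simp only: img_step comp_perm assms) (simp only: comp_assoc)
  also have "\<dots> = \<rho> ((\<tau> \<circ> f) \<circ> k)" using assms(6) by (simp only: comp_assoc)
  also have "\<dots> = \<rho> \<tau> \<circ> (label \<tau> f \<circ> label (\<tau> \<circ> f) k)"
    by (simp only: img_step comp_perm assms) (simp only: comp_assoc)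
  finally show ?thesis unfolding permutes_comp_cancel[OF img_perm[OF assms(1)]] .
qed

lemma label_hexagon:
  assumes "\<tau> permutes V" "e \<in> T" "f \<in> T" "e \<circ> f \<circ> e = f \<circ> e \<circ> f"
  shows "label \<tau> e \<circ> label (\<tau> \<circ> e) f \<circ> label (\<tau> \<circ> e \<circ> f) e =
    label \<tau> f \<circ> label (\<tau> \<circ> f) e \<circ> label (\<tau> \<circ> f \<circ> e) f"
proof -
  have "\<rho> \<tau> \<circ> (label \<tau> e \<circ> label (\<tau> \<circ> e) f \<circ> label (\<tau> \<circ> e \<circ> f) e) = \<rho> (\<tau> \<circ> e \<circ> f \<circ> e)"
    by (simp only: img_step comp_perm assms) (simp only: comp_assoc)
  also have "\<dots> = \<rho> (\<tau> \<circ> f \<circ> e \<circ> f)" using assms(4) by (simp only: comp_assoc)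
  also have "\<dots> = \<rho> \<tau> \<circ> (label \<tau> f \<circ> label (\<tau> \<circ> f) e \<circ> label (\<tau> \<circ> f \<circ> e) f)"
    by (simp only: img_step comp_perm assms) (simp only: comp_assoc)
  finally show ?thesis unfolding permutes_comp_cancel[OF img_perm[OF assms(1)]] .
qed

text \<open>The path \<open>\<tau>, \<tau>e, \<tau>eh\<close> is one side of a 4-cycle; its image is one, too, so that
  \<open>factors_of_product\<close> leaves two possibilities for the last edge. The second claim transports the
  property \<open>fef \<in> T\<close>, which says that \<open>e\<close> and \<open>f\<close> commute or lie in a triangle.\<close>
lemma label_square:
  assumes \<tau>: "\<tau> permutes V" and T: "e \<in> T" "f \<in> T" "h \<in> T" "k \<in> T" 
    and eq: "e \<circ> h = f \<circ> k" and ne: "e \<noteq> f" "h \<noteq> e"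
  shows "label (\<tau> \<circ> e) h \<in> {label \<tau> f, label \<tau> f \<circ> label \<tau> e \<circ> label \<tau> f}"
    and "label \<tau> f \<circ> label \<tau> e \<circ> label \<tau> f \<in> T"
proof -
  let ?e = "label \<tau> e" and ?f = "label \<tau> f" and ?h = "label (\<tau> \<circ> e) h" and ?k = "label (\<tau> \<circ> f) k"
  have inT: "?e \<in> T" "?f \<in> T" "?h \<in> T" "?k \<in> T" using \<tau> T by simp_all
  have eq1: "?e \<circ> ?h = ?f \<circ> ?k" using label_parallelogram[OF \<tau> T eq] .
  have k: "?k = ?f \<circ> ?e \<circ> ?h" by (simp add: comp_assoc eq1 inT transp)
  then have kh: "?k \<circ> ?h = ?f \<circ> ?e" by (simp add: comp_assoc inT transp)
  have "?f \<noteq> ?e" using label_inj[OF \<tau>] T ne by (auto dest: inj_onD)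
  then have "?h \<in> {?f, ?e, ?f \<circ> ?e \<circ> ?f}"
    using factors_of_product[OF _ _ _ _ kh] inT transp by blast
  moreover have "?h \<noteq> ?e"
    using label_inj[of "\<tau> \<circ> e"] label_back[OF \<tau> T(1)] \<tau> T ne by (metis comp_perm inj_onD)
  ultimately show h: "?h \<in> {?f, ?f \<circ> ?e \<circ> ?f}" by auto
  show "?f \<circ> ?e \<circ> ?f \<in> T"
  proof (cases "?h = ?f")
    case True then show ?thesis using k inT by simp
  next
    case False then show ?thesis using h inT by auto
  qed
qed

text \<open>In a triangle two different edges \<open>f\<close> and \<open>fef\<close> continue from \<open>\<tau>e\<close> to common neighbours of \<open>\<tau>e\<close> and
  \<open>\<tau>f\<close>, while for commuting labels there is room for only one.\<close>
lemma label_triangle: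
  assumes \<tau>: "\<tau> permutes V" and T: "e \<in> T" "f \<in> T" "f \<circ> e \<circ> f \<in> T" and nc: "e \<circ> f \<noteq> f \<circ> e"
  shows "label \<tau> e \<circ> label \<tau> f \<noteq> label \<tau> f \<circ> label \<tau> e"
proof
  let ?e = "label \<tau> e" and ?f = "label \<tau> f"
  assume c: "?e \<circ> ?f = ?f \<circ> ?e"
  have fT: "is_transp ?f" using transp \<tau> T by simp
  have ce: "?f \<circ> ?e \<circ> ?f = ?e" using c fT by (metis comp_assoc transp_invol comp_id)
  have ne: "e \<noteq> f" using nc by auto
  have tr: "is_transp e" "is_transp f" using T transp by auto
  have br: "f \<circ> e \<circ> f = e \<circ> f \<circ> e" using braid[OF tr nc] by simp
  have one: "label (\<tau> \<circ> e) h = ?f" if h: "h \<in> T" "h \<noteq> e" "k \<in> T" "e \<circ> h = f \<circ> k" for h k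
  proof -
    have "label (\<tau> \<circ> e) h \<in> {?f, ?e}" 
      using label_square(1)[OF \<tau> T(1,2) h(1,3,4) ne h(2)] ce by simp
    moreover have "label (\<tau> \<circ> e) h \<noteq> ?e"
      using label_inj[of "\<tau> \<circ> e"] label_back[OF \<tau> T(1)] \<tau> T h by (metis comp_perm inj_onD)
    ultimately show ?thesis by auto
  qed
  have "label (\<tau> \<circ> e) f = ?f"
    by (rule one[OF T(2) _ T(3)]) (use ne tr in \<open>auto simp: comp_assoc\<close>)
  moreover have "label (\<tau> \<circ> e) (f \<circ> e \<circ> f) = ?f"
  proof (rule one[OF T(3) _ T(1)])
    show "f \<circ> e \<circ> f \<noteq> e"
      using nc tr by (metis comp_assoc transp_invol id_comp)
    show "e \<circ> (f \<circ> e \<circ> f) = f \<circ> e" unfolding br by (simp add: comp_assoc tr)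
  qed
  ultimately have "f \<circ> e \<circ> f = f"
    using label_inj[of "\<tau> \<circ> e"] \<tau> T by (metis comp_perm inj_onD)
  then have "f \<circ> (f \<circ> e \<circ> f) \<circ> f = f \<circ> f \<circ> f" by (simp only:)
  then have "e = f" using tr by (simp add: comp_assoc)
  then show False using ne by simp
qed

lemma inverse_aut: "cayley_aut V T (inv_into {\<tau>. \<tau> permutes V} \<rho>)"
proof -
  let ?S = "{\<tau>. \<tau> permutes V}" and ?r = "inv_into {\<tau>. \<tau> permutes V} \<rho>"
  have b: "bij_betw ?r ?S ?S" by (rule bij_betw_inv_into[OF bij])
  have r: "\<rho> (?r \<tau>) = \<tau>" if "\<tau> permutes V" for \<tau>
    using bij that by (simp add: bij_betw_inv_into_right)
  have p: "?r \<tau> permutes V" if "\<tau> permutes V" for \<tau> using b that by (auto simp: bij_betw_def)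
  show ?thesis
  proof
    show "(\<exists>t\<in>T. \<tau> = \<sigma> \<circ> t) \<longleftrightarrow> (\<exists>t\<in>T. ?r \<tau> = ?r \<sigma> \<circ> t)"
      if "\<sigma> permutes V" "\<tau> permutes V" for \<sigma> \<tau>
      using arcs[of "?r \<sigma>" "?r \<tau>"] r p that by simp
  qed (use finite_V transp perm b in auto)
qed

text \<open>Labels of the inverse automorphism undo the labels, so each implication between a configuration
  and its image is an equivalence.\<close>
lemma inverse_label:
  assumes "\<tau> permutes V" "t \<in> T"
  shows "cayley_aut.label (inv_into {\<tau>. \<tau> permutes V} \<rho>) (\<rho> \<tau>) (label \<tau> t) = t"
proof -
  interpret I: cayley_aut V T "inv_into {\<tau>. \<tau> permutes V} \<rho>" by (rule inverse_aut)
  have l: "inv_into {\<tau>. \<tau> permutes V} \<rho> (\<rho> \<sigma>) = \<sigma>" if "\<sigma> permutes V" for \<sigma>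
    using bij that by (simp add: bij_betw_inv_into_left)
  show ?thesis
    by (rule I.label_eqI) (use assms l in \<open>simp_all add: img_perm img_step[symmetric]\<close>)
qed

lemma label_conj_T_iff:
  assumes \<tau>: "\<tau> permutes V" and T: "e \<in> T" "f \<in> T"
  shows "label \<tau> f \<circ> label \<tau> e \<circ> label \<tau> f \<in> T \<longleftrightarrow> f \<circ> e \<circ> f \<in> T" (is "?L \<longleftrightarrow> ?R")
proof (cases "e = f")
  case True then show ?thesis using assms transp by (simp add: comp_assoc)
next
  case False
  have imp: "cayley_aut.label r \<sigma> f \<circ> cayley_aut.label r \<sigma> e \<circ> cayley_aut.label r \<sigma> f \<in> T"
    if "cayley_aut V T r" "\<sigma> permutes V" "e \<in> T" "f \<in> T" "e \<noteq> f" "f \<circ> e \<circ> f \<in> T" for r \<sigma> e f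
  proof -
    interpret r: cayley_aut V T r by fact
    show ?thesis using r.label_square(2)[OF that(2,3,4,4,6) _ that(5)] that r.transp by (simp add: comp_assoc)
  qed
  show ?thesis
  proof
    assume ?R then show ?L using imp[OF cayley_aut_axioms \<tau>] T False by simp
  next
    assume L: ?L
    have "label \<tau> e \<noteq> label \<tau> f" using label_inj[OF \<tau>] False T by (auto dest: inj_onD)
    then show ?R using imp[OF inverse_aut img_perm[OF \<tau>] _ _ _ L] assms by (simp add: inverse_label)
  qed
qed

lemma label_commute_iff:
  assumes \<tau>: "\<tau> permutes V" and T: "e \<in> T" "f \<in> T"
  shows "label \<tau> e \<circ> label \<tau> f = label \<tau> f \<circ> label \<tau> e \<longleftrightarrow> e \<circ> f = f \<circ> e"
proof -
  have imp: "e \<circ> f = f \<circ> e"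
    if r: "cayley_aut V T r" and \<sigma>: "\<sigma> permutes V" and T: "e \<in> T" "f \<in> T"
      and c: "cayley_aut.label r \<sigma> e \<circ> cayley_aut.label r \<sigma> f = cayley_aut.label r \<sigma> f \<circ> cayley_aut.label r \<sigma> e"
    for r \<sigma> e f
  proof -
    interpret r: cayley_aut V T r by fact
    have "r.label \<sigma> f \<circ> r.label \<sigma> e \<circ> r.label \<sigma> f = r.label \<sigma> e"
      using c r.transp \<sigma> T by (metis comp_assoc transp_invol comp_id r.label_T)
    then have "f \<circ> e \<circ> f \<in> T" using r.label_conj_T_iff[OF \<sigma> T] \<sigma> T by simp
    then show ?thesis using r.label_triangle[OF \<sigma> T] c by blast
  qed
  show ?thesis
  proof
    assume "e \<circ> f = f \<circ> e"
    then show "label \<tau> e \<circ> label \<tau> f = label \<tau> f \<circ> label \<tau> e"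
      using imp[OF inverse_aut img_perm[OF \<tau>], of "label \<tau> e" "label \<tau> f"] assms by (simp add: inverse_label)
  qed (use imp[OF cayley_aut_axioms \<tau> T] in simp)
qed

end


section \<open>Turning around an edge\<close>

text \<open>The local structure forced on the graph by a change of labels along the edge \<open>{x, y}\<close>: every
  neighbour \<open>z\<close> of exactly one endpoint \<open>b\<close> has exactly two neighbours, \<open>b\<close> and a vertex \<open>w\<close> adjacent
  to the other endpoint. The pair \<open>(a, b)\<close> ranges over both orders of the endpoints.\<close>
definition swappable :: "('a \<Rightarrow> 'a) set \<Rightarrow> 'a \<Rightarrow> 'a \<Rightarrow> bool" where
  "swappable T x y \<longleftrightarrow> (\<forall>a b z. {a, b} = {x, y} \<longrightarrow> z \<notin> {x, y} \<longrightarrow> transpose b z \<in> T \<longrightarrow> transpose a z \<notin> T \<longrightarrow>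
     (\<exists>w. w \<notin> {x, y, z} \<and> transpose a w \<in> T \<and> transpose z w \<in> T \<and> transpose b w \<notin> T \<and>
        (\<forall>u. transpose z u \<in> T \<longrightarrow> u = b \<or> u = w)))"

lemma swappable_ex:
  assumes "swappable T x y" "{a, b} = {x, y}" "z \<noteq> x" "z \<noteq> y" "transpose b z \<in> T" "transpose a z \<notin> T"
  shows "\<exists>w. w \<notin> {x, y, z} \<and> transpose a w \<in> T \<and> transpose z w \<in> T \<and> transpose b w \<notin> T \<and>
    (\<forall>u. transpose z u \<in> T \<longrightarrow> u = b \<or> u = w)"
  using assms(1)[unfolded swappable_def, rule_format, OF assms(2) _ assms(5,6)] assms(3,4) by simp

text \<open>The change of labels \<open>D = label (\<tau>e) \<circ> (label \<tau>)\<inverse>\<close> along an edge with label \<open>{x, y}\<close>, reduced to the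
  properties that the graph-theoretic argument uses. The last two assumptions are stated for both
  orders of \<open>x\<close> and \<open>y\<close>.\<close>
locale turn =
  fixes T :: "('a \<Rightarrow> 'a) set" and x y :: 'a and D :: "('a \<Rightarrow> 'a) \<Rightarrow> ('a \<Rightarrow> 'a)"
  assumes transp: "t \<in> T \<Longrightarrow> is_transp t"
    and xy: "x \<noteq> y" "transpose x y \<in> T"
    and D_T: "t \<in> T \<Longrightarrow> D t \<in> T"
    and D_inj: "inj_on D T"
    and D_comm: "s \<in> T \<Longrightarrow> t \<in> T \<Longrightarrow> D s \<circ> D t = D t \<circ> D s \<longleftrightarrow> s \<circ> t = t \<circ> s"
    and D_fix: "t \<in> T \<Longrightarrow> t \<circ> transpose x y = transpose x y \<circ> t \<Longrightarrow> D t = t"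
    and D_tri: "{a, b} = {x, y} \<Longrightarrow> z \<notin> {x, y} \<Longrightarrow> transpose b z \<in> T \<Longrightarrow> transpose a z \<in> T \<Longrightarrow>
      D (transpose b z) \<in> {transpose b z, transpose a z}"
    and D_hex: "{a, b} = {x, y} \<Longrightarrow> z \<notin> {x, y} \<Longrightarrow> transpose b z \<in> T \<Longrightarrow> transpose a z \<notin> T \<Longrightarrow>
      D (transpose b z) = transpose b z \<or>
      (\<exists>w. w \<notin> {x, y, z} \<and> D (transpose b z) = transpose a w \<and> transpose z w \<in> T \<and> transpose b w \<notin> T)"
begin

lemma T_ne: "transpose a b \<in> T \<Longrightarrow> a \<noteq> b"
  using transp[of "transpose a b"] unfolding is_transp_def by (metis transpose_eq_id_iff)

lemma moved_cases:
  assumes "{a, b} = {x, y}" "z \<notin> {x, y}" "transpose b z \<in> T" "D (transpose b z) \<noteq> transpose b z"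
  obtains "transpose a z \<in> T" "D (transpose b z) = transpose a z"
  | w where "w \<notin> {x, y, z}" "D (transpose b z) = transpose a w" "transpose a z \<notin> T" "transpose z w \<in> T"
      "transpose b w \<notin> T" "transpose a w \<in> T"
proof (cases "transpose a z \<in> T")
  case True
  then show thesis using D_tri[OF assms(1-3)] assms(4) that(1) by blast
next
  case False
  then show thesis using D_hex[OF assms(1-3)] assms(4) that(2) D_T[OF assms(3)] by metis
qed

lemma noncommuting_shape:
  assumes "t \<in> T" "t \<circ> transpose x y \<noteq> transpose x y \<circ> t"
  obtains a b z where "{a, b} = {x, y}" "z \<notin> {x, y}" "t = transpose b z"
proof -
  obtain w where w: "w \<noteq> x" "w \<noteq> y" "t = transpose x w \<or> t = transpose y w"
    using noncommuting_cases[OF xy(1) transp[OF assms(1)] assms(2)[symmetric]] .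
  then show thesis using that[of y x w] that[of x y w] by auto
qed

text \<open>A moved edge now hangs on the other endpoint of \<open>{x, y}\<close>. A fixed edge at \<open>{x, y}\<close> would therefore
  meet it when it should not, or fail to meet it when it should.\<close>
lemma all_moved:
  assumes t0: "t0 \<in> T" "D t0 \<noteq> t0"
    and t: "t \<in> T" "t \<circ> transpose x y \<noteq> transpose x y \<circ> t"
  shows "D t \<noteq> t"
proof
  assume fixed: "D t = t"
  have "t0 \<circ> transpose x y \<noteq> transpose x y \<circ> t0" using t0 D_fix[of t0] by blast
  with t0(1) obtain a b z where ab: "{a, b} = {x, y}" and z: "z \<notin> {x, y}" and t0_eq: "t0 = transpose b z"
    by (rule noncommuting_shape)
  have abne: "a \<noteq> b" "z \<noteq> a" "z \<noteq> b" using ab xy(1) z by (auto simp: doubleton_eq_iff)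
  obtain w where w: "w \<notin> {a, b}" "D t0 = transpose a w" "w = z \<and> transpose a z \<in> T \<or> transpose b w \<notin> T \<and> transpose a z \<notin> T"
  proof -
    have bz: "transpose b z \<in> T" "D (transpose b z) \<noteq> transpose b z" using t0 t0_eq by auto
    have zab: "z \<notin> {a, b}" using abne by simp
    show thesis
    proof (rule moved_cases[OF ab z bz])
      assume "transpose a z \<in> T" "D (transpose b z) = transpose a z"
      then show thesis using that[of z] zab t0_eq by simp
    next
      fix w assume "w \<notin> {x, y, z}" "D (transpose b z) = transpose a w" "transpose a z \<notin> T" "transpose b w \<notin> T"
      then show thesis using that[of w] ab t0_eq by auto
    qed
  qed
  obtain a' b' v where a'b': "{a', b'} = {x, y}" and v: "v \<notin> {x, y}" and t_eq: "t = transpose b' v"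
    using noncommuting_shape[OF t] .
  then have b': "b' \<in> {a, b}" and v: "v \<notin> {a, b}" using ab a'b' by (auto simp: doubleton_eq_iff)
  have comm: "D t0 \<circ> t = t \<circ> D t0 \<longleftrightarrow> t0 \<circ> t = t \<circ> t0" using D_comm[OF t0(1) t(1)] fixed by simp
  have ne: "t0 \<noteq> t" using fixed t0 by auto
  have Dne: "D t0 \<noteq> t" using D_inj t0 t ne fixed by (metis inj_onD)
  show False
  proof (cases "b' = b")
    case True
    have "v \<noteq> z" using ne t0_eq t_eq True by auto
    then have "t0 \<circ> t \<noteq> t \<circ> t0" unfolding t0_eq t_eq True
      using abne v by (subst transpose_comp_commute_iff) (auto simp: doubleton_eq_iff)
    then have "transpose a w \<circ> transpose b v \<noteq> transpose b v \<circ> transpose a w" using comm w(2) t_eq True by simp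
    then have "w = v" using abne v w(1) by (subst (asm) transpose_comp_commute_iff) auto
    then show False using w(3) t(1) t_eq True \<open>v \<noteq> z\<close> by auto
  next
    case False
    then have b'a: "b' = a" using b' by auto
    have "v \<noteq> w" using Dne w(2) t_eq b'a by auto
    then have "D t0 \<circ> t \<noteq> t \<circ> D t0" unfolding w(2) t_eq b'a
      using abne v w(1) by (subst transpose_comp_commute_iff) (auto simp: doubleton_eq_iff)
    then have "transpose b z \<circ> transpose a v \<noteq> transpose a v \<circ> transpose b z" using comm t0_eq t_eq b'a by simp
    then have "z = v" using abne v by (subst (asm) transpose_comp_commute_iff) auto
    then show False using w t t_eq b'a \<open>v \<noteq> w\<close> by auto
  qed
qed

text \<open>Edges disjoint from \<open>{x, y}\<close> are fixed by \<open>D\<close>. If one of them meets the moved edge \<open>{b, z}\<close> at \<open>z\<close>, it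
  also meets the image \<open>{a, w}\<close>, so it is \<open>{z, w}\<close>.\<close>
lemma swappable_if_moved:
  assumes t0: "t0 \<in> T" "D t0 \<noteq> t0"
  shows "swappable T x y"
  unfolding swappable_def
proof (intro allI impI)
  fix a b z
  assume ab: "{a, b} = {x, y}" and z: "z \<notin> {x, y}" and bz: "transpose b z \<in> T" and az: "transpose a z \<notin> T"
  have abne: "a \<noteq> b" "z \<noteq> a" "z \<noteq> b" using ab xy(1) z by (auto simp: doubleton_eq_iff)
  have "transpose b z \<circ> transpose x y \<noteq> transpose x y \<circ> transpose b z"
    using abne xy z ab by (subst transpose_comp_commute_iff) (auto simp: doubleton_eq_iff)
  then have mv: "D (transpose b z) \<noteq> transpose b z" by (rule all_moved[OF t0 bz])
  then obtain w where w: "w \<notin> {x, y, z}" "D (transpose b z) = transpose a w" "transpose z w \<in> T"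
      "transpose b w \<notin> T" "transpose a w \<in> T"
    using moved_cases[OF ab z bz] az by metis
  have "u = b \<or> u = w" if u: "transpose z u \<in> T" for u
  proof (rule ccontr)
    assume n: "\<not> (u = b \<or> u = w)"
    have ua: "u \<noteq> a" using u az by (auto simp: transpose_commute)
    have uz: "z \<noteq> u" using T_ne u by auto
    have "transpose z u \<circ> transpose x y = transpose x y \<circ> transpose z u"
      using n ua ab z xy uz by (subst transpose_comp_commute_iff) auto
    then have "D (transpose z u) = transpose z u" using D_fix u by auto
    moreover have "transpose z u \<circ> transpose b z \<noteq> transpose b z \<circ> transpose z u"
      using n uz abne by (subst transpose_comp_commute_iff) (auto simp: doubleton_eq_iff)
    ultimately have "transpose z u \<circ> transpose a w \<noteq> transpose a w \<circ> transpose z u"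
      using D_comm[OF u bz] w(2) by simp
    then show False
      using n ua uz abne w(1) ab by (subst (asm) transpose_comp_commute_iff) auto
  qed
  then show "\<exists>w. w \<notin> {x, y, z} \<and> transpose a w \<in> T \<and> transpose z w \<in> T \<and> transpose b w \<notin> T \<and>
        (\<forall>u. transpose z u \<in> T \<longrightarrow> u = b \<or> u = w)" using w by blast
qed

end


context cayley_aut
begin

definition swaps :: "('a \<Rightarrow> 'a) \<Rightarrow> ('a \<Rightarrow> 'a) \<Rightarrow> bool" where
  "swaps \<tau> e \<longleftrightarrow> (\<exists>f\<in>T. label (\<tau> \<circ> e) f \<noteq> label \<tau> f)"

text \<open>The relation \<open>efe = fef\<close> is mapped to another closed hexagon, and consecutive labels on it keep the
  type of consecutive edges.\<close>
lemma label_step_nontriangle: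
  assumes \<tau>: "\<tau> permutes V" and T: "e \<in> T" "f \<in> T"
    and d: "x \<noteq> y" "y \<noteq> z" "x \<noteq> z"
    and e: "label \<tau> e = transpose x y" and f: "label \<tau> f = transpose y z" and xz: "transpose x z \<notin> T"
  shows "label (\<tau> \<circ> e) f = transpose y z \<or>
    (\<exists>w. w \<notin> {x, y, z} \<and> label (\<tau> \<circ> e) f = transpose x w \<and> transpose z w \<in> T \<and> transpose y w \<notin> T)"
proof -
  let ?f' = "label (\<tau> \<circ> e) f" and ?g' = "label (\<tau> \<circ> f) e"
    and ?u = "label (\<tau> \<circ> e \<circ> f) e" and ?v = "label (\<tau> \<circ> f \<circ> e) f"
  have mem: "?f' \<in> T" "?g' \<in> T" "?u \<in> T" "?v \<in> T" using \<tau> T by simp_all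
  have et: "transpose x y \<in> T" "transpose y z \<in> T" using label_T[OF \<tau>] T e f by metis+
  have "label \<tau> e \<circ> label \<tau> f \<noteq> label \<tau> f \<circ> label \<tau> e"
    unfolding e f using d by (subst transpose_comp_commute_iff) (auto simp: doubleton_eq_iff)
  then have nc: "e \<circ> f \<noteq> f \<circ> e" using label_commute_iff[OF \<tau> T] by simp
  have "label \<tau> e \<circ> label \<tau> f \<circ> label \<tau> e \<notin> T"
    unfolding e f using xz d by (simp add: transpose_comp_triple)
  then have nt: "e \<circ> f \<circ> e \<notin> T" using label_conj_T_iff[OF \<tau> T(2,1)] by simp
  have br: "e \<circ> f \<circ> e = f \<circ> e \<circ> f" using braid nc T transp by blast
  show ?thesis
  proof (rule hexagon_deviation[OF d mem(1-4)[THEN transp] mem et xz])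
    have \<tau>e: "\<tau> \<circ> e permutes V" and \<tau>f: "\<tau> \<circ> f permutes V" using \<tau> T by simp_all
    have le: "label (\<tau> \<circ> e) e = transpose x y" and lf: "label (\<tau> \<circ> f) f = transpose y z"
      using label_back[OF \<tau>] T e f by simp_all
    show "transpose x y \<circ> ?f' \<noteq> ?f' \<circ> transpose x y"
      using label_commute_iff[OF \<tau>e T] nc unfolding le by simp
    show "transpose y z \<circ> ?g' \<noteq> ?g' \<circ> transpose y z"
      using label_commute_iff[OF \<tau>f T(2,1)] nc unfolding lf by simp
    show "transpose x y \<circ> ?f' \<circ> transpose x y \<notin> T"
      using label_conj_T_iff[OF \<tau>e T(2,1)] nt unfolding le by simp
    show "transpose y z \<circ> ?g' \<circ> transpose y z \<notin> T"
      using label_conj_T_iff[OF \<tau>f T(1,2)] nt unfolding lf br by simp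
    show "transpose x y \<circ> ?f' \<circ> ?u = transpose y z \<circ> ?g' \<circ> ?v"
      using label_hexagon[OF \<tau> T br] unfolding e f .
  qed
qed

lemma label_turn:
  assumes \<tau>: "\<tau> permutes V" and T: "e \<in> T" and xy: "x \<noteq> y" and e: "label \<tau> e = transpose x y"
  shows "turn T x y (\<lambda>g. label (\<tau> \<circ> e) (inv_into T (label \<tau>) g))"
proof -
  let ?i = "inv_into T (label \<tau>)"
  have \<tau>e: "\<tau> \<circ> e permutes V" using \<tau> T by simp
  have i: "?i g \<in> T" "label \<tau> (?i g) = g" if "g \<in> T" for g
    using that label_surj[OF \<tau>] by (metis inv_into_into f_inv_into_f)+
  have eT: "transpose x y \<in> T" using label_T[OF \<tau> T] e by simp
  have sq: "label (\<tau> \<circ> e) f \<in> {label \<tau> f, label \<tau> f \<circ> transpose x y \<circ> label \<tau> f}"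
    if f: "f \<in> T" "f \<noteq> e" and R: "label \<tau> f \<circ> transpose x y \<circ> label \<tau> f \<in> T" for f
  proof -
    have fe: "f \<circ> e \<circ> f \<in> T" using label_conj_T_iff[OF \<tau> T f(1)] R e by simp
    have "e \<circ> f = f \<circ> (f \<circ> e \<circ> f)" using f transp by (simp add: comp_assoc)
    from label_square(1)[OF \<tau> T f(1) f(1) fe this f(2)[symmetric] f(2)] show ?thesis unfolding e .
  qed
  have fe: "label (\<tau> \<circ> e) e = transpose x y" using label_back[OF \<tau> T] e by simp
  show ?thesis
  proof
    show "inj_on (\<lambda>g. label (\<tau> \<circ> e) (?i g)) T"
      by (rule inj_onI) (metis i label_inj[OF \<tau>e] inj_onD)
  next
    fix s t assume st: "s \<in> T" "t \<in> T"
    show "(label (\<tau> \<circ> e) (?i s) \<circ> label (\<tau> \<circ> e) (?i t) = label (\<tau> \<circ> e) (?i t) \<circ> label (\<tau> \<circ> e) (?i s)) = (s \<circ> t = t \<circ> s)"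
      using label_commute_iff[OF \<tau>e, of "?i s" "?i t"] label_commute_iff[OF \<tau>, of "?i s" "?i t"] i st by simp
  next
    fix t assume t: "t \<in> T" and c: "t \<circ> transpose x y = transpose x y \<circ> t"
    have R: "t \<circ> transpose x y \<circ> t = transpose x y" using c transp[OF t] by (metis comp_assoc transp_invol comp_id)
    show "label (\<tau> \<circ> e) (?i t) = t"
    proof (cases "?i t = e")
      case True then show ?thesis using fe i(2)[OF t] e by simp
    next
      case False
      have "label (\<tau> \<circ> e) (?i t) \<in> {t, transpose x y}" using sq[of "?i t"] i[OF t] False R eT by simp
      moreover have "label (\<tau> \<circ> e) (?i t) \<noteq> transpose x y"
        using label_inj[OF \<tau>e] fe i[OF t] T False by (metis inj_onD)
      ultimately show ?thesis by simp
    qed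
  next
    fix a b z assume ab: "{a, b} = {x, y}" and z: "z \<notin> {x, y}" and bz: "transpose b z \<in> T" and az: "transpose a z \<in> T"
    have abne: "a \<noteq> b" "z \<noteq> a" "z \<noteq> b" using ab xy z by (auto simp: doubleton_eq_iff)
    have exy: "transpose x y = transpose b a" by (rule transpose_cong) (use ab in auto)
    have c: "transpose b z \<circ> transpose x y \<circ> transpose b z = transpose a z"
      unfolding exy using transpose_comp_triple[of z a b] abne by (simp add: transpose_commute)
    have "?i (transpose b z) \<noteq> e" 
      using i(2)[OF bz] e abne exy by (metis transpose_apply_first)
    then show "label (\<tau> \<circ> e) (?i (transpose b z)) \<in> {transpose b z, transpose a z}"
      using sq[of "?i (transpose b z)"] i[OF bz] c az by simp
  next
    fix a b z assume ab: "{a, b} = {x, y}" and z: "z \<notin> {x, y}" and bz: "transpose b z \<in> T" and az: "transpose a z \<notin> T"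
    have abne: "a \<noteq> b" "b \<noteq> z" "a \<noteq> z" using ab xy z by (auto simp: doubleton_eq_iff)
    have exy: "label \<tau> e = transpose a b" unfolding e by (rule transpose_cong) (simp add: ab)
    have "{a, b, z} = {x, y, z}" using ab by (auto simp: doubleton_eq_iff)
    then show "label (\<tau> \<circ> e) (?i (transpose b z)) = transpose b z \<or>
      (\<exists>w. w \<notin> {x, y, z} \<and> label (\<tau> \<circ> e) (?i (transpose b z)) = transpose a w \<and> transpose z w \<in> T \<and> transpose b w \<notin> T)"
      using label_step_nontriangle[OF \<tau> T i(1)[OF bz] abne exy i(2)[OF bz] az] by simp
  qed (use transp xy eT i \<tau>e in auto)
qed

lemma swaps_swappable:
  assumes \<tau>: "\<tau> permutes V" and T: "e \<in> T" and s: "swaps \<tau> e" and xy: "x \<noteq> y" and e: "label \<tau> e = transpose x y"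
  shows "swappable T x y"
    and "f \<in> T \<Longrightarrow> label \<tau> f \<circ> transpose x y \<noteq> transpose x y \<circ> label \<tau> f \<Longrightarrow> label (\<tau> \<circ> e) f \<noteq> label \<tau> f"
proof -
  let ?i = "inv_into T (label \<tau>)"
  interpret turn T x y "\<lambda>g. label (\<tau> \<circ> e) (?i g)" by (rule label_turn[OF \<tau> T xy e])
  have i: "?i (label \<tau> f) = f" if "f \<in> T" for f using label_inj[OF \<tau>] that by simp
  obtain f0 where f0: "f0 \<in> T" "label (\<tau> \<circ> e) f0 \<noteq> label \<tau> f0" using s unfolding swaps_def by auto
  then have m: "label \<tau> f0 \<in> T" "label (\<tau> \<circ> e) (?i (label \<tau> f0)) \<noteq> label \<tau> f0"
    using \<tau> by (simp_all add: i)
  show "swappable T x y" by (rule swappable_if_moved[OF m])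
  show "label (\<tau> \<circ> e) f \<noteq> label \<tau> f" 
    if f: "f \<in> T" "label \<tau> f \<circ> transpose x y \<noteq> transpose x y \<circ> label \<tau> f"
    using all_moved[OF m, of "label \<tau> f"] f \<tau> by (simp add: i)
qed

text \<open>In a triangle, \<open>ef\<close> and \<open>fe\<close> are the two common neighbours of its three edges other than the origin;
  exchanging them affects all three edges alike.\<close>
lemma swaps_triangle:
  assumes \<tau>: "\<tau> permutes V" and T: "e \<in> T" "f \<in> T" and s: "swaps \<tau> e"
    and d: "x \<noteq> y" "y \<noteq> z" "x \<noteq> z"
    and e: "label \<tau> e = transpose x y" and f: "label \<tau> f = transpose y z" and xz: "transpose x z \<in> T"
  shows "swaps \<tau> f"
proof -
  let ?e = "label \<tau> e" and ?f = "label \<tau> f"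
  have nc1: "?f \<circ> ?e \<noteq> ?e \<circ> ?f"
    unfolding e f using d by (subst transpose_comp_commute_iff) (auto simp: doubleton_eq_iff)
  then have nc: "e \<circ> f \<noteq> f \<circ> e" using label_commute_iff[OF \<tau> T] by auto
  have tri: "?f \<circ> ?e \<circ> ?f = transpose x z"
    unfolding e f using transpose_comp_triple[of z x y] d by (simp add: transpose_commute)
  then have g: "f \<circ> e \<circ> f \<in> T" using label_conj_T_iff[OF \<tau> T] xz by simp
  have tr: "is_transp e" "is_transp f" "is_transp ?e" "is_transp ?f" using T transp \<tau> by auto
  have eq: "e \<circ> f = f \<circ> (f \<circ> e \<circ> f)" using tr by (simp add: comp_assoc)
  have ne: "e \<noteq> f" using nc by auto
  have "label (\<tau> \<circ> e) f \<in> {?f, ?f \<circ> ?e \<circ> ?f}"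
    using label_square(1)[OF \<tau> T T(2) g eq ne ne[symmetric]] .
  moreover have "label (\<tau> \<circ> e) f \<noteq> ?f"
    using swaps_swappable(2)[OF \<tau> T(1) s d(1) e T(2)] nc1 e by simp
  ultimately have f': "label (\<tau> \<circ> e) f = ?f \<circ> ?e \<circ> ?f" by simp
  have "?e \<circ> (?f \<circ> ?e \<circ> ?f) = ?f \<circ> label (\<tau> \<circ> f) (f \<circ> e \<circ> f)"
    using label_parallelogram[OF \<tau> T T(2) g eq] f' by simp
  moreover have "?e \<circ> (?f \<circ> ?e \<circ> ?f) = ?f \<circ> ?e"
    using braid[OF tr(4,3) nc1] tr by (simp add: comp_assoc)
  ultimately have "?f \<circ> (?f \<circ> label (\<tau> \<circ> f) (f \<circ> e \<circ> f)) = ?f \<circ> (?f \<circ> ?e)" by simp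
  then have "label (\<tau> \<circ> f) (f \<circ> e \<circ> f) = ?e" using tr by simp
  moreover have "f \<circ> e \<circ> f \<noteq> e"
    using nc tr by (metis comp_assoc transp_invol id_comp)
  then have "label \<tau> (f \<circ> e \<circ> f) \<noteq> ?e" using label_inj[OF \<tau>] g T by (metis inj_onD)
  ultimately show ?thesis unfolding swaps_def using g by auto
qed

end


section \<open>Labels do not turn\<close>

context cayley_aut
begin

lemma T_ne: "transpose a b \<in> T \<Longrightarrow> a \<noteq> b"
  using transp[of "transpose a b"] unfolding is_transp_def by (metis transpose_eq_id_iff)

lemma T_mem: "transpose a b \<in> T \<Longrightarrow> a \<in> V \<and> b \<in> V"
  using perm[of "transpose a b"] T_ne[of a b] permutes_not_in
  by (metis transpose_apply_first transpose_apply_second)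

lemma T_sym: "transpose a b \<in> T \<longleftrightarrow> transpose b a \<in> T"
  by (simp add: transpose_commute)

text \<open>The edge \<open>{a, b}\<close> lies in a triangle and the labels change along it at \<open>\<tau>\<close>.\<close>
definition tri_swap :: "('a \<Rightarrow> 'a) \<Rightarrow> 'a \<Rightarrow> 'a \<Rightarrow> bool" where
  "tri_swap \<tau> a b \<longleftrightarrow> (\<exists>f\<in>T. swaps \<tau> f \<and> label \<tau> f = transpose a b) \<and>
     (\<exists>m. transpose a m \<in> T \<and> transpose b m \<in> T)"

lemma tri_swap_sym: "tri_swap \<tau> a b \<longleftrightarrow> tri_swap \<tau> b a"
  unfolding tri_swap_def by (auto simp: transpose_commute)

lemma tri_swap_T: "\<tau> permutes V \<Longrightarrow> tri_swap \<tau> a b \<Longrightarrow> transpose a b \<in> T"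
  unfolding tri_swap_def by (metis label_T)

lemma tri_swap_spread:
  assumes \<tau>: "\<tau> permutes V" and s: "tri_swap \<tau> a b" and z: "transpose b z \<in> T" "transpose a z \<in> T"
  shows "tri_swap \<tau> b z"
proof -
  obtain e where e: "e \<in> T" "swaps \<tau> e" "label \<tau> e = transpose a b" using s unfolding tri_swap_def by auto
  obtain f where f: "f \<in> T" "label \<tau> f = transpose b z" using label_surj[OF \<tau>] z(1) by (metis imageE)
  have "transpose a b \<in> T" using tri_swap_T[OF \<tau> s] .
  then have d: "a \<noteq> b" "b \<noteq> z" "a \<noteq> z" using T_ne z by auto
  have "swaps \<tau> f" using swaps_triangle[OF \<tau> e(1) f(1) e(2) d e(3) f(2) z(2)] .
  then show ?thesis unfolding tri_swap_def using f z \<open>transpose a b \<in> T\<close> T_sym by metis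
qed

text \<open>A neighbour \<open>z\<close> of \<open>b\<close> that is not adjacent to \<open>a\<close> would have degree 2. Comparing \<open>swappable\<close> for
  \<open>{a, b}\<close> and for \<open>{b, m}\<close> in a triangle \<open>a b m\<close> shows that its neighbour \<open>w\<close> is adjacent to
  \<open>a\<close>, \<open>m\<close> and \<open>z\<close>, but \<open>w\<close> has degree 2 as well.\<close>
lemma tri_swap_nbr:
  assumes \<tau>: "\<tau> permutes V" and s: "tri_swap \<tau> a b" and z: "transpose b z \<in> T" "z \<noteq> a"
  shows "transpose a z \<in> T"
proof (rule ccontr)
  assume az: "transpose a z \<notin> T"
  have ab: "transpose a b \<in> T" "a \<noteq> b" using tri_swap_T[OF \<tau> s] T_ne by auto
  have sw: "swappable T p q" if pq: "tri_swap \<tau> p q" for p q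
  proof -
    have "p \<noteq> q" using tri_swap_T[OF \<tau> pq] T_ne by auto
    then show ?thesis using pq swaps_swappable(1)[OF \<tau>] unfolding tri_swap_def by metis
  qed
  obtain m where m: "transpose a m \<in> T" "transpose b m \<in> T" using s unfolding tri_swap_def by auto
  have bz: "b \<noteq> z" using T_ne z by auto
  have m_ne: "m \<noteq> a" "m \<noteq> b" using m T_ne by auto
  obtain w where w: "w \<notin> {a, b, z}" "transpose a w \<in> T" "transpose z w \<in> T" "transpose b w \<notin> T"
      "\<And>u. transpose z u \<in> T \<Longrightarrow> u = b \<or> u = w"
    using swappable_ex[OF sw[OF s] refl z(2) bz[symmetric] z(1) az] by blast
  have mz: "m \<noteq> z" using m az by auto
  have zm: "transpose m z \<notin> T" using w(4) w(5)[of m] m m_ne by (auto simp: transpose_commute)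
  obtain w2 where w2: "w2 \<notin> {b, m, z}" "transpose m w2 \<in> T" "transpose z w2 \<in> T"
    using swappable_ex[OF sw[OF tri_swap_spread[OF \<tau> s m(2,1)]] insert_commute bz[symmetric] mz[symmetric] z(1) zm]
    by blast
  then have mw: "transpose m w \<in> T" using w(5)[of w2] by auto
  obtain w3 where w3: "w3 \<notin> {a, b, w}" "\<And>u. transpose w u \<in> T \<Longrightarrow> u = a \<or> u = w3"
    using swappable_ex[OF sw[OF s] insert_commute _ _ w(2,4)] w(1) by blast
  have "z = w3" using w3(2)[of z] w z by (auto simp: transpose_commute)
  moreover have "m = w3" using w3(2)[of m] mw m_ne by (auto simp: transpose_commute)
  ultimately show False using mz by simp
qed

text \<open>By the two preceding lemmas all edges at \<open>y\<close> have the same property, and the neighbours of \<open>y\<close> are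
  closed under adjacency.\<close>
lemma tri_swap_complete:
  assumes \<tau>: "\<tau> permutes V" and s: "tri_swap \<tau> x y"
    and conn: "\<And>u v. u \<in> V \<Longrightarrow> v \<in> V \<Longrightarrow> (u, v) \<in> {(a, b). transpose a b \<in> T}\<^sup>*"
    and uv: "u \<in> V" "v \<in> V" "u \<noteq> v"
  shows "transpose u v \<in> T"
proof -
  have y: "y \<in> V" using T_mem tri_swap_T[OF \<tau> s] by blast
  have all: "v = y \<or> tri_swap \<tau> y v" if "v \<in> V" for v
  proof -
    have "(y, v) \<in> {(a, b). transpose a b \<in> T}\<^sup>*" using conn y that by blast
    then show ?thesis
    proof (induction rule: rtrancl_induct)
      case base then show ?case by simp
    next
      case (step v v')
      have vv': "transpose v v' \<in> T" using step by simp
      show ?case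
      proof (cases "v = y")
        case True
        show ?thesis
        proof (cases "v' = x")
          case True then show ?thesis using s tri_swap_sym by blast
        next
          case False
          then show ?thesis
            using tri_swap_spread[OF \<tau> s] tri_swap_nbr[OF \<tau> s] vv' \<open>v = y\<close> by blast
        qed
      next
        case False
        then have yv: "tri_swap \<tau> y v" using step by blast
        show ?thesis
        proof (cases "v' = y")
          case True then show ?thesis by simp
        next
          case False
          have yv': "transpose y v' \<in> T" using tri_swap_nbr[OF \<tau> yv vv' False] .
          have "tri_swap \<tau> v y" using yv tri_swap_sym by blast
          then show ?thesis using tri_swap_spread[OF \<tau> _ yv' vv'] by blast
        qed
      qed
    qed
  qed
  consider "u = y" "tri_swap \<tau> y v" | "v = y" "tri_swap \<tau> y u" | "tri_swap \<tau> y v" "tri_swap \<tau> y u"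
    using all uv by blast
  then show ?thesis
  proof cases
    case 1 then show ?thesis using tri_swap_T[OF \<tau>] by blast
  next
    case 2 then show ?thesis using tri_swap_T[OF \<tau>] T_sym by blast
  next
    case 3
    then show ?thesis using tri_swap_nbr[OF \<tau>, of u y v] tri_swap_T[OF \<tau>] tri_swap_sym uv(3) by blast
  qed
qed

text \<open>Triangles are excluded by completeness. Without them the graph is a book of 4-cycles with spine
  \<open>{x, y}\<close>. With one page it is \<open>C\<^sub>4\<close>; with two pages \<open>z w\<close> and \<open>z2 w2\<close> both ends of the spine have
  degree at least 3, so only the spine can be swappable. Hence the labels of \<open>e\<close> remain \<open>{x, y}\<close> along
  the \<open>f\<close>-edges of the hexagon, which then contradicts \<open>hexagon_rigid\<close>.\<close>
lemma no_swaps: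
  assumes \<tau>: "\<tau> permutes V" and e: "e \<in> T"
    and conn: "\<And>u v. u \<in> V \<Longrightarrow> v \<in> V \<Longrightarrow> (u, v) \<in> {(a, b). transpose a b \<in> T}\<^sup>*"
    and nK: "p \<in> V" "q \<in> V" "p \<noteq> q" "transpose p q \<notin> T"
    and nC4: "\<And>x y z w. distinct [x, y, z, w] \<Longrightarrow> V = {x, y, z, w} \<Longrightarrow>
      T = {transpose x y, transpose y z, transpose z w, transpose w x} \<Longrightarrow> False"
  shows "\<not> swaps \<tau> e"
proof
  assume s: "swaps \<tau> e"
  have "is_transp (label \<tau> e)" using \<tau> e transp by simp
  then obtain x y where xy: "x \<noteq> y" and le: "label \<tau> e = transpose x y" unfolding is_transp_def by auto
  have xyT: "transpose x y \<in> T" using label_T[OF \<tau> e] le by simp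
  have no_tri: "\<not> (transpose x m \<in> T \<and> transpose y m \<in> T)" for m
  proof
    assume "transpose x m \<in> T \<and> transpose y m \<in> T"
    then have "tri_swap \<tau> x y" unfolding tri_swap_def using e s le by blast
    then show False using tri_swap_complete[OF \<tau> _ conn nK(1-3)] nK(4) by blast
  qed
  have sw: "swappable T x y" using swaps_swappable(1)[OF \<tau> e s xy le] .
  have page: "\<exists>w. w \<notin> {x, y, z} \<and> transpose a w \<in> T \<and> transpose z w \<in> T \<and> (\<forall>u. transpose z u \<in> T \<longrightarrow> u = b \<or> u = w)"
    if ab: "{a, b} = {x, y}" and z: "z \<notin> {x, y}" "transpose b z \<in> T" for a b z
  proof -
    have "transpose a z \<notin> T" using no_tri[of z] ab z by (auto simp: doubleton_eq_iff)
    then show ?thesis using swappable_ex[OF sw ab _ _ z(2)] z(1) by blast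
  qed
  have V: "V \<subseteq> {x, y} \<union> {v. transpose x v \<in> T} \<union> {v. transpose y v \<in> T}"
  proof
    fix v assume v: "v \<in> V"
    have "(x, v) \<in> {(a, b). transpose a b \<in> T}\<^sup>*" using conn v T_mem[OF xyT] by blast
    then show "v \<in> {x, y} \<union> {v. transpose x v \<in> T} \<union> {v. transpose y v \<in> T}"
    proof (induction rule: rtrancl_induct)
      case base then show ?case by simp
    next
      case (step v v')
      have vv': "transpose v v' \<in> T" using step by simp
      consider "v \<in> {x, y}" | "v \<notin> {x, y}" "transpose x v \<in> T" | "v \<notin> {x, y}" "transpose y v \<in> T" using step by blast
      then show ?case
      proof cases
        case 1 then show ?thesis using vv' by auto
      next
        case 2 then show ?thesis using page[of y x v] vv' by blast
      next
        case 3 then show ?thesis using page[of x y v] vv' by blast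
      qed
    qed
  qed
  have "\<exists>z. z \<notin> {x, y} \<and> transpose y z \<in> T"
  proof (rule ccontr)
    assume n: "\<not> ?thesis"
    have "\<not> transpose x w \<in> T" if w: "w \<notin> {x, y}" for w
    proof
      assume xw: "transpose x w \<in> T"
      obtain z where "z \<notin> {x, y, w}" "transpose y z \<in> T"
        using page[OF insert_commute w xw] by blast
      then show False using n by blast
    qed
    then have "V \<subseteq> {x, y}" using V n by blast
    then have "{p, q} = {x, y}" using nK by auto
    then show False using nK(4) xyT transpose_cong by metis
  qed
  then obtain z where z: "z \<notin> {x, y}" "transpose y z \<in> T" by blast
  obtain w where w: "w \<notin> {x, y, z}" "transpose x w \<in> T" "transpose z w \<in> T"
    and z_nbr: "\<And>u. transpose z u \<in> T \<Longrightarrow> u = y \<or> u = w"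
    using page[OF refl z] by blast
  obtain z' where "z' \<notin> {x, y, w}" "transpose w z' \<in> T" and w_nbr': "\<And>u. transpose w u \<in> T \<Longrightarrow> u = x \<or> u = z'"
    using page[OF insert_commute _ w(2)] w(1) by blast
  then have w_nbr: "u = x \<or> u = z" if "transpose w u \<in> T" for u
    using w_nbr'[of z] w_nbr'[OF that] w(3) z(1) T_sym by blast
  have "\<exists>z2. z2 \<notin> {x, y, z} \<and> transpose y z2 \<in> T"
  proof (rule ccontr)
    assume n: "\<not> ?thesis"
    have y_nbr: "u = x \<or> u = z" if "transpose y u \<in> T" for u using n that T_ne by blast
    have x_nbr: "u = y \<or> u = w" if u: "transpose x u \<in> T" for u
    proof (cases "u = y")
      case False
      then have "u \<notin> {x, y}" using u T_ne by blast
      then obtain v where "v \<notin> {x, y, u}" "transpose y v \<in> T" "transpose u v \<in> T"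
        using page[OF insert_commute _ u] by blast
      then have "transpose z u \<in> T" using y_nbr T_sym by blast
      then show ?thesis using z_nbr by blast
    qed simp
    have dist: "distinct [x, y, z, w]" using xy z w by auto
    have "V = {x, y, z, w}"
      using V x_nbr y_nbr T_mem xyT z w by blast
    moreover have "T = {transpose x y, transpose y z, transpose z w, transpose w x}"
    proof (intro equalityI subsetI)
      fix t assume t: "t \<in> T"
      then obtain i j where ij: "t = transpose i j" using transp is_transp_def by metis
      have "i \<in> {x, y, z, w}" using T_mem t ij \<open>V = {x, y, z, w}\<close> by blast
      then show "t \<in> {transpose x y, transpose y z, transpose z w, transpose w x}"
        using t x_nbr[of j] y_nbr[of j] z_nbr[of j] w_nbr[of j] unfolding ij
        by (auto simp: transpose_commute)
    next
      fix t assume "t \<in> {transpose x y, transpose y z, transpose z w, transpose w x}"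
      then show "t \<in> T" using xyT z w T_sym by blast
    qed
    ultimately show False using nC4 dist by blast
  qed
  then obtain z2 where z2: "z2 \<notin> {x, y, z}" "transpose y z2 \<in> T" by blast
  obtain w2 where w2: "w2 \<notin> {x, y, z2}" "transpose x w2 \<in> T" "transpose z2 w2 \<in> T"
    using page[OF refl _ z2(2)] z2(1) by blast
  have w2w: "w2 \<noteq> w" using w_nbr[of z2] w2 z2 T_sym by blast
  obtain f where f: "f \<in> T" "label \<tau> f = transpose y z" using label_surj[OF \<tau>] z(2) by (metis imageE)
  have d: "x \<noteq> y" "y \<noteq> z" "x \<noteq> z" using xy z by auto
  have xz: "transpose x z \<notin> T" using no_tri z by blast
  have \<tau>e: "\<tau> \<circ> e permutes V" and \<tau>f: "\<tau> \<circ> f permutes V" using \<tau> e f by simp_all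
  have "\<not> swaps \<tau> f"
  proof
    assume "swaps \<tau> f"
    then have sw': "swappable T y z" using swaps_swappable(1)[OF \<tau> f(1) _ d(2) f(2)] by blast
    obtain w' where "\<And>u. transpose x u \<in> T \<Longrightarrow> u = y \<or> u = w'"
      using swappable_ex[OF sw' insert_commute d(1,3)] xyT xz T_sym by blast
    then show False using w w2 w2w by blast
  qed
  then have g': "label (\<tau> \<circ> f) e = transpose x y" using e le unfolding swaps_def by auto
  have nc: "transpose x y \<circ> transpose y z \<noteq> transpose y z \<circ> transpose x y"
    using d by (subst transpose_comp_commute_iff) (auto simp: doubleton_eq_iff)
  then have moved: "label (\<tau> \<circ> e) f \<noteq> transpose y z"
    using swaps_swappable(2)[OF \<tau> e s xy le f(1)] f(2) by simp
  then obtain w' where w': "w' \<notin> {x, y, z}" "label (\<tau> \<circ> e) f = transpose x w'" "transpose y w' \<notin> T"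
    using label_step_nontriangle[OF \<tau> e f(1) d le f(2) xz] by blast
  have "\<not> swaps (\<tau> \<circ> e) f"
  proof
    assume "swaps (\<tau> \<circ> e) f"
    then have sw': "swappable T x w'" using swaps_swappable(1)[OF \<tau>e f(1) _ _ w'(2)] w'(1) by blast
    obtain v where "\<And>u. transpose y u \<in> T \<Longrightarrow> u = x \<or> u = v"
      using swappable_ex[OF sw' insert_commute d(1)[symmetric]] xyT w' T_sym by blast
    then show False using z z2 by blast
  qed
  then have u: "label (\<tau> \<circ> e \<circ> f) e = transpose x y"
    using e label_back[OF \<tau> e] le unfolding swaps_def by auto
  have nc': "e \<circ> f \<noteq> f \<circ> e" using nc label_commute_iff[OF \<tau> e f(1)] le f(2) by simp
  have br: "e \<circ> f \<circ> e = f \<circ> e \<circ> f" using braid[OF _ _ nc'] transp e f by blast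
  have nt: "transpose x y \<circ> transpose y z \<circ> transpose x y \<notin> T"
    using xz d by (simp add: transpose_comp_triple)
  have hex: "transpose x y \<circ> label (\<tau> \<circ> e) f \<circ> transpose x y =
    transpose y z \<circ> transpose x y \<circ> label (\<tau> \<circ> f \<circ> e) f"
    using label_hexagon[OF \<tau> e f(1) br] unfolding le f(2) g' u .
  have mem: "label (\<tau> \<circ> e) f \<in> T" "label (\<tau> \<circ> f \<circ> e) f \<in> T" using e f \<tau> by simp_all
  have "label (\<tau> \<circ> e) f = transpose y z"
    by (rule hexagon_rigid[OF transp[OF xyT] transp[OF z(2)] transp[OF mem(1)] transp[OF mem(2)] mem nc nt hex])
  then show False using moved by simp
qed

end


section \<open>From constant labels to two-sided translations\<close>

lemma transp_moving_two:
  assumes "is_transp t" "t p \<noteq> p" "t q \<noteq> q" "p \<noteq> q"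
  shows "t = transpose p q"
proof -
  obtain i j where ij: "t = transpose i j" using assms(1) unfolding is_transp_def by auto
  have "p \<in> {i, j}" "q \<in> {i, j}" using assms(2,3) unfolding ij by (auto simp: transpose_def split: if_splits)
  then show ?thesis unfolding ij using assms(4) by (auto simp: transpose_commute)
qed

lemma noncommuting_transps:
  assumes "is_transp s" "is_transp t" "s \<circ> t \<noteq> t \<circ> s"
  obtains p q r where "p \<noteq> q" "p \<noteq> r" "q \<noteq> r" "s = transpose p q" "t = transpose p r"
  using assms(1,2)
proof (cases rule: transp_pair_cases)
  case 1 then show thesis using assms by simp
next
  case (2 a b c)
  then show thesis using that[of b a c] by (simp add: transpose_commute)
next
  case (3 a b c d)
  then show thesis using assms transpose_comp_commute_iff[of a b c d] by simp
qed

text \<open>The setting of the classical argument that an automorphism of a symmetric group is inner if it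
  preserves transpositions; the outer automorphisms of degree 6 do not preserve them.\<close>
locale transp_hom =
  fixes V :: "'a set" and \<psi> :: "('a \<Rightarrow> 'a) \<Rightarrow> ('a \<Rightarrow> 'a)"
  assumes finite_V: "finite V" and card_V: "card V \<ge> 3"
    and hom_perm: "\<tau> permutes V \<Longrightarrow> \<psi> \<tau> permutes V"
    and hom: "\<sigma> permutes V \<Longrightarrow> \<tau> permutes V \<Longrightarrow> \<psi> (\<sigma> \<circ> \<tau>) = \<psi> \<sigma> \<circ> \<psi> \<tau>"
    and hom_inj: "\<sigma> permutes V \<Longrightarrow> \<tau> permutes V \<Longrightarrow> \<psi> \<sigma> = \<psi> \<tau> \<Longrightarrow> \<sigma> = \<tau>"
    and hom_transp: "i \<in> V \<Longrightarrow> j \<in> V \<Longrightarrow> i \<noteq> j \<Longrightarrow> is_transp (\<psi> (transpose i j))"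
begin

lemma third: "\<exists>k\<in>V. k \<noteq> i \<and> k \<noteq> j"
proof (rule ccontr)
  assume "\<not> ?thesis"
  then have "V \<subseteq> {i, j}" by auto
  then have "card V \<le> card {i, j}" by (intro card_mono) auto
  also have "\<dots> \<le> 2" by (simp add: card_insert_if)
  finally show False using card_V by simp
qed

lemma hom_triangle:
  assumes "i \<in> V" "j \<in> V" "k \<in> V" "i \<noteq> j" "j \<noteq> k" "i \<noteq> k"
  obtains p q r where "p \<noteq> q" "p \<noteq> r" "q \<noteq> r" "\<psi> (transpose i j) = transpose p q"
    "\<psi> (transpose i k) = transpose p r" "\<psi> (transpose j k) = transpose q r"
proof -
  have perm: "transpose i j permutes V" "transpose i k permutes V" "transpose j k permutes V"
    using assms by (simp_all add: permutes_swap_id)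
  have "transpose i j \<circ> transpose i k \<noteq> transpose i k \<circ> transpose i j"
    using assms by (subst transpose_comp_commute_iff) (auto simp: doubleton_eq_iff)
  then have nc: "\<psi> (transpose i j) \<circ> \<psi> (transpose i k) \<noteq> \<psi> (transpose i k) \<circ> \<psi> (transpose i j)"
    using hom_inj[OF permutes_compose[OF perm(2,1)] permutes_compose[OF perm(1,2)]] hom perm by metis
  obtain p q r where pqr: "p \<noteq> q" "p \<noteq> r" "q \<noteq> r" "\<psi> (transpose i j) = transpose p q" "\<psi> (transpose i k) = transpose p r"
    using noncommuting_transps[OF hom_transp[OF assms(1,2,4)] hom_transp[OF assms(1,3,6)] nc] .
  have "transpose j k = transpose i j \<circ> transpose i k \<circ> transpose i j"
    using transpose_comp_triple[of j k i] assms by (simp add: transpose_commute)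
  then have "\<psi> (transpose j k) = transpose p q \<circ> transpose p r \<circ> transpose p q"
    using hom perm permutes_compose pqr by metis
  also have "\<dots> = transpose q r"
    using transpose_comp_triple[of q r p] pqr by (simp add: transpose_commute)
  finally show thesis using that pqr by blast
qed

text \<open>For fixed \<open>i\<close>, the images of the transpositions \<open>(i j)\<close> meet pairwise. Three of them cannot form a triangle, because
  the third edge of a triangle is already the image of \<open>(j k)\<close>.\<close>
lemma common_moved_point:
  assumes i: "i \<in> V"
  shows "\<exists>p. \<forall>j\<in>V. j \<noteq> i \<longrightarrow> \<psi> (transpose i j) p \<noteq> p"
proof -
  obtain j where j: "j \<in> V" "j \<noteq> i" using third[of i i] by auto
  obtain k where k: "k \<in> V" "k \<noteq> i" "k \<noteq> j" using third[of i j] by auto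
  obtain p q r where pqr: "p \<noteq> q" "p \<noteq> r" "q \<noteq> r" "\<psi> (transpose i j) = transpose p q"
    "\<psi> (transpose i k) = transpose p r" "\<psi> (transpose j k) = transpose q r"
    using hom_triangle[OF i j(1) k(1)] j k by metis
  have "\<psi> (transpose i l) p \<noteq> p" if l: "l \<in> V" "l \<noteq> i" for l
  proof
    assume fix_p: "\<psi> (transpose i l) p = p"
    have lj: "l \<noteq> j" "l \<noteq> k" using fix_p pqr by auto
    obtain p' q' r' where 1: "p' \<noteq> q'" "p' \<noteq> r'" "\<psi> (transpose i j) = transpose p' q'" "\<psi> (transpose i l) = transpose p' r'"
      using hom_triangle[OF i j(1) l(1)] j l lj by metis
    obtain p2 q2 r2 where 2: "p2 \<noteq> q2" "p2 \<noteq> r2" "\<psi> (transpose i k) = transpose p2 q2" "\<psi> (transpose i l) = transpose p2 r2"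
      using hom_triangle[OF i k(1) l(1)] k l lj by metis
    have "p' \<in> {p, q}" using 1(3) pqr(1,4) by (metis insertCI transpose_eq_transpose_iff)
    then have mq: "\<psi> (transpose i l) q \<noteq> q" using fix_p 1(2,4) by auto
    have "p2 \<in> {p, r}" using 2(3) pqr(2,5) by (metis insertCI transpose_eq_transpose_iff)
    then have mr: "\<psi> (transpose i l) r \<noteq> r" using fix_p 2(2,4) by auto
    have "\<psi> (transpose i l) = \<psi> (transpose j k)"
      using transp_moving_two[OF hom_transp[OF i l(1) l(2)[symmetric]] mq mr pqr(3)] pqr(6) by simp
    then have "transpose i l = transpose j k"
      using hom_inj permutes_swap_id i j k l by metis
    then show False using transpose_eq_transpose_iff[of i l j k] j k l by auto
  qed
  then show ?thesis by blast
qed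

lemma inner: "\<exists>\<phi>. \<phi> permutes V \<and> (\<forall>\<tau>. \<tau> permutes V \<longrightarrow> \<psi> \<tau> \<circ> \<phi> = \<phi> \<circ> \<tau>)"
proof -
  obtain \<phi>0 where \<phi>0: "\<And>i j. i \<in> V \<Longrightarrow> j \<in> V \<Longrightarrow> j \<noteq> i \<Longrightarrow> \<psi> (transpose i j) (\<phi>0 i) \<noteq> \<phi>0 i"
    using common_moved_point by metis
  define \<phi> where "\<phi> i = (if i \<in> V then \<phi>0 i else i)" for i
  have mv: "\<psi> (transpose i j) (\<phi> i) \<noteq> \<phi> i" if "i \<in> V" "j \<in> V" "i \<noteq> j" for i j
    using \<phi>0 that unfolding \<phi>_def by auto
  have inV: "\<phi> i \<in> V" if i: "i \<in> V" for i
  proof -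
    obtain j where j: "j \<in> V" "i \<noteq> j" using third[of i i] by auto
    show ?thesis using mv[OF i j] hom_perm[OF permutes_swap_id[OF i j(1)]] permutes_not_in by metis
  qed
  have inj: "\<phi> i \<noteq> \<phi> j" if ij: "i \<in> V" "j \<in> V" "i \<noteq> j" for i j
  proof
    assume eq: "\<phi> i = \<phi> j"
    obtain k where k: "k \<in> V" "k \<noteq> i" "k \<noteq> j" using third[of i j] by auto
    obtain p q r where pqr: "p \<noteq> q" "p \<noteq> r" "q \<noteq> r" "\<psi> (transpose i j) = transpose p q"
      "\<psi> (transpose i k) = transpose p r" "\<psi> (transpose j k) = transpose q r"
      using hom_triangle[OF ij(1,2) k(1) ij(3)] k by metis
    have "\<phi> i \<in> {p, q}" "\<phi> i \<in> {p, r}" "\<phi> i \<in> {q, r}"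
      using mv[OF ij(1,2,3)] mv[OF ij(1) k(1)] mv[OF ij(2) k(1)] k eq unfolding pqr(4-6)
      by (auto simp: transpose_def split: if_splits)
    then show False using pqr(1-3) by auto
  qed
  have "inj_on \<phi> V" using inj by (auto simp: inj_on_def)
  moreover have "\<phi> ` V \<subseteq> V" using inV by blast
  ultimately have "bij_betw \<phi> V V" using endo_inj_surj[OF finite_V] by (simp add: bij_betw_def)
  then have \<phi>: "\<phi> permutes V" by (rule bij_imp_permutes) (simp add: \<phi>_def)
  have tr: "\<psi> (transpose i j) \<circ> \<phi> = \<phi> \<circ> transpose i j" if ij: "i \<in> V" "j \<in> V" "i \<noteq> j" for i j
  proof -
    have "\<psi> (transpose i j) = transpose (\<phi> i) (\<phi> j)"
      using transp_moving_two[OF hom_transp[OF ij] mv[OF ij] _ inj[OF ij]] mv[OF ij(2,1) ij(3)[symmetric]]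
      by (simp add: transpose_commute)
    then show ?thesis
      using transpose_comp_eq[of \<phi> "\<phi> i" "\<phi> j"] permutes_bij[OF \<phi>] permutes_inverses(2)[OF \<phi>] by simp
  qed
  have hom_id: "\<psi> id = id"
  proof -
    have "\<psi> id \<circ> \<psi> id = \<psi> id \<circ> id" using hom[of id id] by simp
    then show ?thesis using permutes_comp_cancel[OF hom_perm[OF permutes_id]] by blast
  qed
  have "\<psi> \<tau> \<circ> \<phi> = \<phi> \<circ> \<tau>" if "\<tau> permutes V" for \<tau>
    using finite_V that
  proof (induction rule: permutes_rev_induct)
    case id
    show ?case by (simp only: hom_id id_comp comp_id)
  next
    case (swap a b p)
    have "\<psi> (p \<circ> transpose a b) \<circ> \<phi> = \<psi> p \<circ> (\<psi> (transpose a b) \<circ> \<phi>)"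
      by (simp only: hom[OF swap(4) permutes_swap_id[OF swap(1,2)]] comp_assoc)
    also have "\<dots> = (\<psi> p \<circ> \<phi>) \<circ> transpose a b" by (simp only: tr[OF swap(1-3)] comp_assoc)
    also have "\<dots> = \<phi> \<circ> (p \<circ> transpose a b)" using swap(5) by (simp only: comp_assoc[symmetric])
    finally show ?case .
  qed
  then show ?thesis using \<phi> by blast
qed

end

text \<open>Stated as an induction principle; the transposition of two vertices joined by a path is a
  product of conjugates along the path.\<close>
lemma transpositions_generate:
  assumes fin: "finite V" and transp: "\<And>t. t \<in> T \<Longrightarrow> t permutes V"
    and conn: "\<And>u v. u \<in> V \<Longrightarrow> v \<in> V \<Longrightarrow> (u, v) \<in> {(a, b). transpose a b \<in> T}\<^sup>*"
    and base: "P id" and step: "\<And>\<tau> t. \<tau> permutes V \<Longrightarrow> P \<tau> \<Longrightarrow> t \<in> T \<Longrightarrow> P (\<tau> \<circ> t)"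
    and \<tau>: "\<tau> permutes V"
  shows "P \<tau>"
  using fin \<tau>
proof (induction rule: permutes_rev_induct)
  case id then show ?case using base .
next
  case (swap a b p)
  have "\<forall>\<tau>. \<tau> permutes V \<longrightarrow> P \<tau> \<longrightarrow> \<tau> \<circ> transpose a b permutes V \<and> P (\<tau> \<circ> transpose a b)"
    using conn[OF swap(1,2)]
  proof (induction rule: rtrancl_induct)
    case base then show ?case by simp
  next
    case (step b c)
    have t: "transpose b c \<in> T" using step by simp
    note tp = transp[OF t]
    have one: "\<tau> \<circ> transpose b c permutes V \<and> P (\<tau> \<circ> transpose b c)" if "\<tau> permutes V" "P \<tau>" for \<tau>
      using that assms(5) t tp permutes_compose by blast
    consider "a = c" | "a = b" | "a \<noteq> b" "a \<noteq> c" by auto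
    then show ?case
    proof cases
      case 1 then show ?thesis by simp
    next
      case 2 show ?thesis unfolding 2 using one by blast
    next
      case 3
      have eq: "transpose a c = transpose b c \<circ> transpose a b \<circ> transpose b c"
        using transpose_comp_triple[of c a b] 3 by (simp add: transpose_commute)
      show ?thesis
      proof (intro allI impI)
        fix \<tau> assume "\<tau> permutes V" "P \<tau>"
        then have "\<tau> \<circ> transpose b c \<circ> transpose a b \<circ> transpose b c permutes V \<and>
          P (\<tau> \<circ> transpose b c \<circ> transpose a b \<circ> transpose b c)"
          using one step.IH by blast
        then show "\<tau> \<circ> transpose a c permutes V \<and> P (\<tau> \<circ> transpose a c)"
          unfolding eq by (simp add: comp_assoc)
      qed
    qed
  qed
  then show ?case using swap by blast
qed

lemma is_transp_conj:
  assumes t: "is_transp t" and s: "is_transp s"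
  shows "is_transp (t \<circ> s \<circ> t)"
proof -
  obtain i j where ij: "i \<noteq> j" "s = transpose i j" using s unfolding is_transp_def by auto
  obtain k l where kl: "t = transpose k l" using t unfolding is_transp_def by auto
  have "t \<circ> s = transpose (t i) (t j) \<circ> t"
    using transpose_comp_eq[of t "t i" "t j"] by (simp add: ij kl)
  then have "t \<circ> s \<circ> t = transpose (t i) (t j)" using t by (simp add: comp_assoc)
  moreover have "t i \<noteq> t j" using ij(1) kl by (metis transpose_involutory)
  ultimately show ?thesis unfolding is_transp_def by blast
qed

context cayley_aut
begin

text \<open>Constant labels make \<open>\<psi> \<tau> = (\<rho> id)\<inverse> \<rho> \<tau>\<close> multiplicative on words in \<open>T\<close>, hence on the whole group.\<close>
lemma left_right_translation:
  assumes conn: "\<And>u v. u \<in> V \<Longrightarrow> v \<in> V \<Longrightarrow> (u, v) \<in> {(a, b). transpose a b \<in> T}\<^sup>*"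
    and nK: "p \<in> V" "q \<in> V" "p \<noteq> q" "transpose p q \<notin> T"
    and nC4: "\<And>x y z w. distinct [x, y, z, w] \<Longrightarrow> V = {x, y, z, w} \<Longrightarrow>
      T = {transpose x y, transpose y z, transpose z w, transpose w x} \<Longrightarrow> False"
  shows "\<exists>a b. a permutes V \<and> b permutes V \<and> (\<forall>\<tau>. \<tau> permutes V \<longrightarrow> \<rho> \<tau> \<circ> b = a \<circ> \<tau>) \<and>
    (\<forall>i j. transpose (b i) (b j) \<in> T \<longleftrightarrow> transpose i j \<in> T)"
proof -
  note gen = transpositions_generate[OF finite_V perm conn]
  have const: "\<forall>t\<in>T. label \<tau> t = label id t" if "\<tau> permutes V" for \<tau>
  proof (rule gen[where P = "\<lambda>\<tau>. \<forall>t\<in>T. label \<tau> t = label id t", OF _ _ _ _ _ that])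
    fix \<tau> e assume a: "\<tau> permutes V" "\<forall>t\<in>T. label \<tau> t = label id t" "e \<in> T"
    have "\<not> swaps \<tau> e" by (rule no_swaps[OF a(1,3) conn nK nC4])
    then show "\<forall>t\<in>T. label (\<tau> \<circ> e) t = label id t" using a(2) unfolding swaps_def by metis
  qed auto
  define a0 where "a0 = \<rho> id"
  have a0: "a0 permutes V" unfolding a0_def by (simp add: img_perm)
  define \<psi> where "\<psi> \<tau> = inv_into UNIV a0 \<circ> \<rho> \<tau>" for \<tau>
  have \<psi>_perm: "\<psi> \<tau> permutes V" if "\<tau> permutes V" for \<tau>
    unfolding \<psi>_def by (rule permutes_compose[OF img_perm[OF that] permutes_inv[OF a0]])
  have \<rho>_eq: "\<rho> \<tau> = a0 \<circ> \<psi> \<tau>" for \<tau>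
    unfolding \<psi>_def by (simp add: comp_assoc[symmetric] permutes_inv_o(1)[OF a0])
  have \<psi>_step: "\<psi> (\<tau> \<circ> t) = \<psi> \<tau> \<circ> label id t" if "\<tau> permutes V" "t \<in> T" for \<tau> t
    unfolding \<psi>_def img_step[OF that] const[OF that(1), rule_format, OF that(2)] by (simp only: comp_assoc)
  have \<psi>_id: "\<psi> id = id" unfolding \<psi>_def a0_def[symmetric] by (rule permutes_inv_o(2)[OF a0])
  have \<psi>_T: "\<psi> t = label id t" if "t \<in> T" for t using \<psi>_step[of id t] \<psi>_id that by simp
  have hom: "\<psi> (\<sigma> \<circ> \<tau>) = \<psi> \<sigma> \<circ> \<psi> \<tau>" if \<sigma>: "\<sigma> permutes V" and \<tau>: "\<tau> permutes V" for \<sigma> \<tau>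
  proof (rule gen[where P = "\<lambda>\<tau>. \<psi> (\<sigma> \<circ> \<tau>) = \<psi> \<sigma> \<circ> \<psi> \<tau>", OF _ _ _ _ _ \<tau>])
    show "\<psi> (\<sigma> \<circ> id) = \<psi> \<sigma> \<circ> \<psi> id" using \<psi>_id by simp
  next
    fix \<tau> t assume a: "\<tau> permutes V" "\<psi> (\<sigma> \<circ> \<tau>) = \<psi> \<sigma> \<circ> \<psi> \<tau>" "t \<in> T"
    have "\<psi> (\<sigma> \<circ> \<tau> \<circ> t) = \<psi> \<sigma> \<circ> \<psi> \<tau> \<circ> label id t"
      using \<psi>_step[OF permutes_compose[OF a(1) \<sigma>] a(3)] a(2) by simp
    then show "\<psi> (\<sigma> \<circ> (\<tau> \<circ> t)) = \<psi> \<sigma> \<circ> \<psi> (\<tau> \<circ> t)"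
      using \<psi>_step[OF a(1,3)] by (simp add: comp_assoc)
  qed simp_all
  have inj: "\<sigma> = \<tau>" if "\<sigma> permutes V" "\<tau> permutes V" "\<psi> \<sigma> = \<psi> \<tau>" for \<sigma> \<tau>
    using that \<rho>_eq img_inj by metis
  have hom_tr: "is_transp (\<psi> (transpose i j))" if ij: "i \<in> V" "j \<in> V" "i \<noteq> j" for i j
  proof -
    have "i = j \<or> is_transp (\<psi> (transpose i j))"
      using conn[OF ij(1,2)]
    proof (induction rule: rtrancl_induct)
      case base then show ?case by simp
    next
      case (step b c)
      have t: "transpose b c \<in> T" using step by simp
      have tr: "is_transp (\<psi> (transpose b c))" using \<psi>_T[OF t] t transp by simp
      consider "i = c" | "i = b" | "i \<noteq> b" "i \<noteq> c" by auto
      then show ?case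
      proof cases
        case 1 then show ?thesis by simp
      next
        case 2 then show ?thesis using tr by simp
      next
        case 3
        have perm': "transpose i b permutes V" "transpose b c permutes V"
          using ij(1) T_mem[OF t] by (simp_all add: permutes_swap_id)
        have eq: "transpose i c = transpose b c \<circ> transpose i b \<circ> transpose b c"
          using transpose_comp_triple[of c i b] 3 by (simp add: transpose_commute)
        have "\<psi> (transpose i c) = \<psi> (transpose b c) \<circ> \<psi> (transpose i b) \<circ> \<psi> (transpose b c)"
          unfolding eq by (simp only: hom[OF permutes_compose[OF perm'(1,2)] perm'(2)] hom[OF perm'(2,1)])
        then show ?thesis using is_transp_conj[OF tr] step.IH 3(1) by metis
      qed
    qed
    then show ?thesis using ij by simp
  qed
  interpret transp_hom V \<psi>
  proof
    show "3 \<le> card V"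
    proof (rule ccontr)
      assume "\<not> 3 \<le> card V"
      moreover have "card {p, q} = 2" using nK by simp
      ultimately have "card V \<le> card {p, q}" by simp
      then have "V = {p, q}" using card_seteq[OF finite_V, of "{p, q}"] nK by simp
      moreover have "\<exists>s. transpose p s \<in> T" using conn[OF nK(1,2)] nK(3) by (auto elim: converse_rtranclE)
      ultimately show False using T_mem T_ne nK(4) by blast
    qed
  qed (fact finite_V \<psi>_perm hom inj hom_tr)+
  obtain \<phi> where \<phi>: "\<phi> permutes V" and \<psi>\<phi>: "\<And>\<tau>. \<tau> permutes V \<Longrightarrow> \<psi> \<tau> \<circ> \<phi> = \<phi> \<circ> \<tau>"
    using inner by blast
  have \<psi>_transpose: "\<psi> (transpose i j) = transpose (\<phi> i) (\<phi> j)" if "i \<in> V" "j \<in> V" for i j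
  proof -
    have "transpose (\<phi> i) (\<phi> j) \<circ> \<phi> = \<phi> \<circ> transpose i j"
      using transpose_comp_eq[of \<phi> "\<phi> i" "\<phi> j"] permutes_bij[OF \<phi>] permutes_inverses(2)[OF \<phi>] by simp
    also have "\<dots> = \<psi> (transpose i j) \<circ> \<phi>" using \<psi>\<phi> permutes_swap_id that by metis
    finally have "transpose (\<phi> i) (\<phi> j) \<circ> \<phi> \<circ> inv_into UNIV \<phi> = \<psi> (transpose i j) \<circ> \<phi> \<circ> inv_into UNIV \<phi>" by simp
    then show ?thesis by (simp add: comp_assoc permutes_inv_o(1)[OF \<phi>])
  qed
  have edges: "transpose (\<phi> i) (\<phi> j) \<in> T \<longleftrightarrow> transpose i j \<in> T" for i j
  proof
    assume t: "transpose i j \<in> T"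
    then have "transpose (\<phi> i) (\<phi> j) = label id (transpose i j)" using \<psi>_transpose \<psi>_T T_mem by metis
    then show "transpose (\<phi> i) (\<phi> j) \<in> T" using t by simp
  next
    assume t: "transpose (\<phi> i) (\<phi> j) \<in> T"
    then have ij: "i \<in> V" "j \<in> V" using T_mem permutes_in_image[OF \<phi>] by blast+
    obtain s where s: "s \<in> T" "label id s = transpose (\<phi> i) (\<phi> j)"
      using label_surj[OF permutes_id] t by (metis imageE)
    then have "\<psi> s = \<psi> (transpose i j)" using \<psi>_T \<psi>_transpose ij by simp
    then have "s = transpose i j" using inj perm[OF s(1)] permutes_swap_id[OF ij] by blast
    then show "transpose i j \<in> T" using s by simp
  qed
  have "(a0 \<circ> \<phi>) permutes V" by (rule permutes_compose[OF \<phi> a0])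
  moreover have "\<rho> \<tau> \<circ> \<phi> = (a0 \<circ> \<phi>) \<circ> \<tau>" if "\<tau> permutes V" for \<tau>
    unfolding \<rho>_eq using \<psi>\<phi>[OF that] by (simp add: comp_assoc)
  ultimately show ?thesis using \<phi> edges by blast
qed

end


section \<open>Coupling graphs and their Cayley automorphisms\<close>

lemma injection_extends_to_permutation:
  assumes "finite S" "S \<subseteq> V" "inj_on f S" "f ` S \<subseteq> V"
  shows "\<exists>\<pi>. \<pi> permutes V \<and> (\<forall>x\<in>S. \<pi> x = f x)"
  using assms
proof (induction S rule: finite_induct)
  case empty then show ?case using permutes_id by blast
next
  case (insert x S)
  then obtain \<pi> where \<pi>: "\<pi> permutes V" "\<And>y. y \<in> S \<Longrightarrow> \<pi> y = f y" by (auto simp: inj_on_insert)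
  let ?\<pi> = "transpose (\<pi> x) (f x) \<circ> \<pi>"
  have "\<pi> x \<in> V" using \<pi>(1) insert.prems(1) by (simp add: permutes_in_image)
  then have "?\<pi> permutes V" using insert.prems(3) by (intro permutes_compose[OF \<pi>(1)] permutes_swap_id) auto
  moreover have "?\<pi> y = f y" if "y \<in> insert x S" for y
  proof (cases "y = x")
    case False
    then have y: "y \<in> S" using that by simp
    have "f y \<noteq> f x" using insert.prems(2) y insert.hyps(2) by (auto simp: inj_on_def)
    moreover have "\<pi> y \<noteq> \<pi> x" using permutes_inj[OF \<pi>(1)] False by (simp add: inj_eq)
    ultimately show ?thesis using \<pi>(2)[OF y] by simp
  qed simp
  ultimately show ?case by blast
qed

lemma permutation_of_four:
  assumes "distinct [u, v, w, x]" "distinct [u', v', w', x']" "{u, v, w, x} \<subseteq> V" "{u', v', w', x'} \<subseteq> V"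
  obtains \<pi> where "\<pi> permutes V" "\<pi> u = u'" "\<pi> v = v'" "\<pi> w = w'" "\<pi> x = x'"
proof -
  define f where "f = (\<lambda>_. x')(u := u', v := v', w := w')"
  have f: "f u = u'" "f v = v'" "f w = w'" "f x = x'" using assms(1) by (auto simp: f_def)
  have "inj_on f {u, v, w, x}" using assms(1,2) by (simp add: f)
  moreover have "f ` {u, v, w, x} \<subseteq> V" using assms(4) by (simp add: f)
  ultimately obtain \<pi> where "\<pi> permutes V" "\<forall>i\<in>{u, v, w, x}. \<pi> i = f i"
    using injection_extends_to_permutation[OF _ assms(3), of f] by blast
  then show thesis using that f by simp
qed

lemma permutation_of_three:
  assumes "distinct [u, v, w]" "distinct [u', v', w']" "{u, v, w} \<subseteq> V" "{u', v', w'} \<subseteq> V"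
  obtains \<pi> where "\<pi> permutes V" "\<pi> u = u'" "\<pi> v = v'" "\<pi> w = w'"
proof -
  define f where "f = (\<lambda>_. w')(u := u', v := v')"
  have f: "f u = u'" "f v = v'" "f w = w'" using assms(1) by (auto simp: f_def)
  have "inj_on f {u, v, w}" using assms(1,2) by (simp add: f)
  moreover have "f ` {u, v, w} \<subseteq> V" using assms(4) by (simp add: f)
  ultimately obtain \<pi> where "\<pi> permutes V" "\<forall>i\<in>{u, v, w}. \<pi> i = f i"
    using injection_extends_to_permutation[OF _ assms(3), of f] by blast
  then show thesis using that f by simp
qed

lemma rtrancl_crossing:
  assumes "(x, y) \<in> r\<^sup>*" "x \<in> S" "y \<notin> S"
  obtains u v where "u \<in> S" "v \<notin> S" "(u, v) \<in> r"
proof -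
  have "y \<in> S \<or> (\<exists>u v. u \<in> S \<and> v \<notin> S \<and> (u, v) \<in> r)"
    using assms(1)
  proof (induction rule: rtrancl_induct)
    case base then show ?case using assms(2) by blast
  next
    case (step y z) then show ?case by blast
  qed
  then show thesis using that assms(3) by blast
qed

lemma pair_mem_nsets_iff: "{i, j} \<in> nsets A 2 \<longleftrightarrow> i \<in> A \<and> j \<in> A \<and> i \<noteq> j"
  by (cases "i = j") (auto simp: nsets_def)

text \<open>The identity outside the symmetric group, because \<open>digraph_auts\<close> consists of such functions.\<close>
definition two_sided :: "nat \<Rightarrow> (nat \<Rightarrow> nat) \<Rightarrow> (nat \<Rightarrow> nat) \<Rightarrow> (nat \<Rightarrow> nat) \<Rightarrow> (nat \<Rightarrow> nat)" where
  "two_sided n a b \<tau> = (if \<tau> permutes {1..n} then a \<circ> \<tau> \<circ> inv_into UNIV b else \<tau>)"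

locale coupling =
  fixes n :: nat and E :: "nat set set"
  assumes edges: "E \<subseteq> nsets {1..n} 2"
    and connected: "Digraph_Component.connected (with_proj (ugraph n E))"
    and not_C4: "\<not> is_C4 n E"
    and not_complete: "\<not> is_complete n E"
begin

abbreviation "V \<equiv> {1..n}"
abbreviation "T \<equiv> transpositions n E"

lemma edge_mem: "{i, j} \<in> E \<Longrightarrow> i \<in> V \<and> j \<in> V \<and> i \<noteq> j"
  using subsetD[OF edges] by (simp only: pair_mem_nsets_iff[symmetric])

lemma T_iff: "transpose i j \<in> T \<longleftrightarrow> {i, j} \<in> E"
proof
  assume "transpose i j \<in> T"
  then obtain k l where kl: "transpose i j = transpose k l" "{k, l} \<in> E" unfolding transpositions_def by blast
  then have "(k = i \<and> l = j) \<or> (k = j \<and> l = i)" using edge_mem transpose_eq_transpose_iff by metis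
  then show "{i, j} \<in> E" using kl(2) by (auto simp: insert_commute)
next
  assume "{i, j} \<in> E" then show "transpose i j \<in> T" unfolding transpositions_def using edge_mem by blast
qed

lemma T_E: "t \<in> T \<Longrightarrow> \<exists>i j. t = transpose i j \<and> {i, j} \<in> E"
  unfolding transpositions_def by blast

lemma T_perm: "t \<in> T \<Longrightarrow> t permutes V"
  using T_E edge_mem permutes_swap_id by metis

lemma edge_path: 
  assumes "i \<in> V" "j \<in> V"
  shows "(i, j) \<in> {(a, b). {a, b} \<in> E}\<^sup>*"
proof -
  let ?G = "mk_symmetric (with_proj (ugraph n E))"
  have "i \<rightarrow>\<^sup>*\<^bsub>with_proj ?G\<^esub> j"
    using connected assms unfolding connected_def strongly_connected_def by (simp add: ugraph_def)
  then have "(i, j) \<in> (parcs ?G)\<^sup>*" using reachable_rtranclI by fastforce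
  moreover have "parcs ?G \<subseteq> {(a, b). {a, b} \<in> E}"
    by (auto simp: parcs_mk_symmetric ugraph_def insert_commute)
  ultimately show ?thesis using rtrancl_mono by blast
qed

lemma T_path: "i \<in> V \<Longrightarrow> j \<in> V \<Longrightarrow> (i, j) \<in> {(a, b). transpose a b \<in> T}\<^sup>*"
  using edge_path by (simp add: T_iff)

lemma nonedge: obtains p q where "p \<in> V" "q \<in> V" "p \<noteq> q" "{p, q} \<notin> E"
proof -
  obtain e where e: "e \<in> nsets V 2" "e \<notin> E" using not_complete edges unfolding is_complete_def by blast
  then obtain p q where "e = {p, q}" "p \<noteq> q" by (auto simp: nsets_def card_2_iff)
  then show thesis using that e pair_mem_nsets_iff by metis
qed

lemma edge_at: 
  assumes "p \<in> V" "q \<in> V" "p \<noteq> q"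
  obtains r where "{p, r} \<in> E"
  using rtrancl_crossing[OF edge_path[OF assms(1,2)], of "{p}"] assms(3) by auto

lemma edge_nonedge_meeting:
  obtains u v w where "{u, v} \<in> E" "{u, w} \<notin> E" "distinct [u, v, w]" "{u, v, w} \<subseteq> V"
proof -
  obtain p q where pq: "p \<in> V" "q \<in> V" "p \<noteq> q" "{p, q} \<notin> E" by (rule nonedge)
  obtain r where r: "{p, r} \<in> E" using edge_at[OF pq(1-3)] .
  then have "r \<noteq> q" "r \<in> V" "p \<noteq> r" using pq(4) edge_mem by blast+
  then show thesis using that[of p r q] r pq by simp
qed

lemma not_four_cycle: "distinct [x, y, z, w] \<Longrightarrow> V = {x, y, z, w} \<Longrightarrow> E = {{x, y}, {y, z}, {z, w}, {w, x}} \<Longrightarrow> False"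
proof -
  assume d: "distinct [x, y, z, w]" and V: "V = {x, y, z, w}" and E: "E = {{x, y}, {y, z}, {z, w}, {w, x}}"
  define f :: "nat \<Rightarrow> nat" where "f = (\<lambda>_. w)(1 := x, 2 := y, 3 := z)"
  have f: "f 1 = x" "f 2 = y" "f 3 = z" "f 4 = w" by (simp_all add: f_def)
  have four: "{1..4::nat} = {1, 2, 3, 4}" by auto
  have "bij_betw f {1..4} V" unfolding bij_betw_def V four
  proof
    show "inj_on f {1, 2, 3, 4}" using d f by (auto simp: inj_on_def)
    show "f ` {1, 2, 3, 4} = {x, y, z, w}" using f by simp
  qed
  then show False using not_C4 E f unfolding is_C4_def by metis
qed

lemma graph_aut_iff:
  "b \<in> digraph_auts (ugraph n E) \<longleftrightarrow> b permutes V \<and> (\<forall>i j. {b i, b j} \<in> E \<longleftrightarrow> {i, j} \<in> E)"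
proof -
  have arc: "(i, j) \<in> parcs (ugraph n E) \<longleftrightarrow> {i, j} \<in> E" for i j
    using edge_mem[of i j] by (auto simp: ugraph_def)
  have v: "pverts (ugraph n E) = V" by (simp add: ugraph_def)
  have "(\<forall>i j. {b i, b j} \<in> E \<longleftrightarrow> {i, j} \<in> E) \<longleftrightarrow> (\<forall>i\<in>V. \<forall>j\<in>V. {i, j} \<in> E \<longleftrightarrow> {b i, b j} \<in> E)"
    if b: "b permutes V"
  proof -
    have "i \<in> V \<and> j \<in> V" if "{b i, b j} \<in> E" for i j
      using edge_mem[OF that] permutes_in_image[OF b] by blast
    then show ?thesis using edge_mem by blast
  qed
  then show ?thesis unfolding digraph_auts_def mem_Collect_eq arc v by blast
qed

lemma cay_aut_two_sided:
  assumes \<rho>: "\<rho> \<in> digraph_auts (cay n T)"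
  obtains a b where "a \<in> symm n" "b \<in> digraph_auts (ugraph n E)" "\<rho> = two_sided n a b"
proof -
  have rp: "\<rho> permutes symm n" and
    arcs: "\<And>u v. u \<in> symm n \<Longrightarrow> v \<in> symm n \<Longrightarrow> (u, v) \<in> parcs (cay n T) \<longleftrightarrow> (\<rho> u, \<rho> v) \<in> parcs (cay n T)"
    using \<rho> unfolding digraph_auts_def cay_def by auto
  have arc: "(u, v) \<in> parcs (cay n T) \<longleftrightarrow> (\<exists>t\<in>T. v = u \<circ> t)" if "u \<in> symm n" for u v
    using that unfolding cay_def by auto
  interpret cayley_aut V T \<rho>
  proof
    show "is_transp t" if "t \<in> T" for t using T_E[OF that] edge_mem unfolding is_transp_def by blast
    show "bij_betw \<rho> (symm n) (symm n)" using permutes_imp_bij[OF rp] .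
    show "(\<exists>t\<in>T. \<tau> = \<sigma> \<circ> t) \<longleftrightarrow> (\<exists>t\<in>T. \<rho> \<tau> = \<rho> \<sigma> \<circ> t)" if "\<sigma> permutes V" "\<tau> permutes V" for \<sigma> \<tau>
      using arcs[of \<sigma> \<tau>] arc[of \<sigma> \<tau>] arc[of "\<rho> \<sigma>" "\<rho> \<tau>"] that permutes_in_image[OF rp] by auto
  qed (use T_perm in auto)
  obtain p q where pq: "p \<in> V" "q \<in> V" "p \<noteq> q" "{p, q} \<notin> E" by (rule nonedge)
  have c4: False if "distinct [x, y, z, w]" "V = {x, y, z, w}"
    "T = {transpose x y, transpose y z, transpose z w, transpose w x}" for x y z w
  proof -
    have iff: "{i, j} \<in> E \<longleftrightarrow> {i, j} \<in> {{x, y}, {y, z}, {z, w}, {w, x}}" for i j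
    proof -
      have "i \<noteq> j \<Longrightarrow> transpose i j = transpose k l \<longleftrightarrow> {i, j} = {k, l}" for k l :: nat
        by (subst transpose_eq_transpose_iff) (auto simp: doubleton_eq_iff)
      moreover have "i = j \<Longrightarrow> {i, j} \<notin> {{x, y}, {y, z}, {z, w}, {w, x}}"
        using that(1) by (auto simp: doubleton_eq_iff)
      ultimately show ?thesis using T_iff[of i j] edge_mem[of i j] unfolding that(3) insert_iff empty_iff by metis
    qed
    have "e \<in> {{x, y}, {y, z}, {z, w}, {w, x}}" if e: "e \<in> E" for e
    proof -
      obtain i j where "e = {i, j}" using subsetD[OF edges e] by (auto simp: nsets_def card_2_iff)
      then show ?thesis using iff[of i j] e by simp
    qed
    then have "E \<subseteq> {{x, y}, {y, z}, {z, w}, {w, x}}" by (rule subsetI)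
    moreover have "{{x, y}, {y, z}, {z, w}, {w, x}} \<subseteq> E" by (simp add: iff)
    ultimately have "E = {{x, y}, {y, z}, {z, w}, {w, x}}" by (rule equalityI)
    then show False by (rule not_four_cycle[OF that(1,2)])
  qed
  have "\<exists>a b. a permutes V \<and> b permutes V \<and> (\<forall>\<tau>. \<tau> permutes V \<longrightarrow> \<rho> \<tau> \<circ> b = a \<circ> \<tau>) \<and>
    (\<forall>i j. transpose (b i) (b j) \<in> T \<longleftrightarrow> transpose i j \<in> T)"
  proof (rule left_right_translation[OF T_path pq(1-3)])
    show "transpose p q \<notin> T" using pq(4) T_iff by simp
  qed (assumption | erule (2) c4)+
  then obtain a b where ab: "a permutes V" "b permutes V" "\<And>\<tau>. \<tau> permutes V \<Longrightarrow> \<rho> \<tau> \<circ> b = a \<circ> \<tau>"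
    "\<And>i j. transpose (b i) (b j) \<in> T \<longleftrightarrow> transpose i j \<in> T"
    by blast
  have "\<rho> \<tau> = two_sided n a b \<tau>" for \<tau>
  proof (cases "\<tau> permutes V")
    case True
    have "\<rho> \<tau> \<circ> b \<circ> inv_into UNIV b = a \<circ> \<tau> \<circ> inv_into UNIV b" using ab(3)[OF True] by simp
    then show ?thesis using True unfolding two_sided_def by (simp add: comp_assoc permutes_inv_o(1)[OF ab(2)])
  next
    case False
    then show ?thesis using permutes_not_in[OF rp] unfolding two_sided_def by simp
  qed
  then have "\<rho> = two_sided n a b" by (rule ext)
  moreover have "b \<in> digraph_auts (ugraph n E)"
    using ab(2,4) T_iff graph_aut_iff by simp
  ultimately show thesis using that ab(1) by blast
qed

end


section \<open>Two-sided translations and feasible sets\<close>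

lemma two_sided_apply: "\<tau> permutes {1..n} \<Longrightarrow> two_sided n a b \<tau> = a \<circ> \<tau> \<circ> inv_into UNIV b"
  unfolding two_sided_def by (simp only: if_True)

lemma two_sided_perm:
  assumes "a permutes {1..n}" "b permutes {1..n}" "\<tau> permutes {1..n}"
  shows "two_sided n a b \<tau> permutes {1..n}"
  unfolding two_sided_apply[OF assms(3)]
  by (rule permutes_compose[OF permutes_inv[OF assms(2)] permutes_compose[OF assms(3,1)]])

lemma two_sided_comp:
  assumes "a permutes {1..n}" "b permutes {1..n}" "a' permutes {1..n}" "b' permutes {1..n}"
  shows "two_sided n a b \<circ> two_sided n a' b' = two_sided n (a \<circ> a') (b \<circ> b')"
proof
  fix \<tau>
  show "(two_sided n a b \<circ> two_sided n a' b') \<tau> = two_sided n (a \<circ> a') (b \<circ> b') \<tau>"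
  proof (cases "\<tau> permutes {1..n}")
    case True
    have i: "inv_into UNIV (b \<circ> b') = inv_into UNIV b' \<circ> inv_into UNIV b"
      by (rule o_inv_distrib[OF permutes_bij[OF assms(2)] permutes_bij[OF assms(4)]])
    show ?thesis
      unfolding comp_apply[of "two_sided n a b"] two_sided_apply[OF two_sided_perm[OF assms(3,4) True]]
      unfolding two_sided_apply[OF True] i by (simp only: comp_assoc)
  next
    case False then show ?thesis by (simp add: two_sided_def)
  qed
qed

lemma two_sided_id: "two_sided n id id = id"
proof
  fix \<tau> :: "nat \<Rightarrow> nat"
  show "two_sided n id id \<tau> = id \<tau>" unfolding two_sided_def inv_id id_comp comp_id by simp
qed

lemma two_sided_permutes:
  assumes "a permutes {1..n}" "b permutes {1..n}"
  shows "two_sided n a b permutes symm n"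
proof -
  have ia: "inv_into UNIV a permutes {1..n}" and ib: "inv_into UNIV b permutes {1..n}"
    using assms permutes_inv by blast+
  have "two_sided n a b \<circ> two_sided n (inv_into UNIV a) (inv_into UNIV b) = id"
    unfolding two_sided_comp[OF assms ia ib] permutes_inv_o(1)[OF assms(1)] permutes_inv_o(1)[OF assms(2)]
    by (rule two_sided_id)
  moreover have "two_sided n (inv_into UNIV a) (inv_into UNIV b) \<circ> two_sided n a b = id"
    unfolding two_sided_comp[OF ia ib assms] permutes_inv_o(2)[OF assms(1)] permutes_inv_o(2)[OF assms(2)]
    by (rule two_sided_id)
  ultimately have "bij (two_sided n a b)" using o_bij by blast
  then have "\<forall>\<sigma>. \<exists>!\<tau>. two_sided n a b \<tau> = \<sigma>" unfolding bij_iff .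
  moreover have "\<forall>\<tau>. \<tau> \<notin> symm n \<longrightarrow> two_sided n a b \<tau> = \<tau>" by (simp add: two_sided_def)
  ultimately show ?thesis unfolding permutes_def[of _ "symm n"] by blast
qed

context coupling
begin

lemma edge_pair: "e \<in> E \<Longrightarrow> \<exists>i j. e = {i, j}"
  by (drule subsetD[OF edges]) (auto simp: nsets_def card_2_iff)

lemma third_vertex: "\<exists>k\<in>V. k \<noteq> i \<and> k \<noteq> j"
proof -
  obtain u v w where d: "distinct [u, v, w]" and sub: "{u, v, w} \<subseteq> V" using edge_nonedge_meeting by metis
  have "(u \<noteq> i \<and> u \<noteq> j) \<or> (v \<noteq> i \<and> v \<noteq> j) \<or> (w \<noteq> i \<and> w \<noteq> j)" using d by auto
  then show ?thesis using sub by blast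
qed

lemma two_sided_cay_aut:
  assumes a: "a \<in> symm n" and b: "b \<in> digraph_auts (ugraph n E)"
  shows "two_sided n a b \<in> digraph_auts (cay n T)"
proof -
  have ap: "a permutes V" and bp: "b permutes V" and bE: "\<And>i j. {b i, b j} \<in> E \<longleftrightarrow> {i, j} \<in> E"
    using a b graph_aut_iff by auto
  let ?b = "inv_into UNIV b"
  have conj: "b \<circ> transpose i j \<circ> ?b = transpose (b i) (b j)" for i j
  proof -
    have "b \<circ> transpose i j = transpose (b i) (b j) \<circ> b"
      using transpose_comp_eq[OF permutes_bij[OF bp], of "b i" "b j"] permutes_inverses(2)[OF bp] by simp
    then show ?thesis by (simp add: comp_assoc permutes_inv_o(1)[OF bp])
  qed
  have fwd: "\<exists>t'\<in>T. two_sided n a b (\<sigma> \<circ> t) = two_sided n a b \<sigma> \<circ> t'" if \<sigma>: "\<sigma> permutes V" and t: "t \<in> T" for \<sigma> t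
  proof -
    obtain i j where ij: "t = transpose i j" "{i, j} \<in> E" using T_E[OF t] by blast
    have "\<sigma> \<circ> t permutes V" by (rule permutes_compose[OF T_perm[OF t] \<sigma>])
    then have "two_sided n a b (\<sigma> \<circ> t) = a \<circ> \<sigma> \<circ> (?b \<circ> b) \<circ> t \<circ> ?b"
      unfolding permutes_inv_o(2)[OF bp] by (simp only: two_sided_apply comp_assoc comp_id id_comp)
    also have "\<dots> = two_sided n a b \<sigma> \<circ> (b \<circ> t \<circ> ?b)"
      unfolding two_sided_apply[OF \<sigma>] by (simp only: comp_assoc)
    finally show ?thesis unfolding ij conj using bE T_iff ij(2) by blast
  qed
  have bwd: "\<exists>t\<in>T. \<tau> = \<sigma> \<circ> t" if \<sigma>: "\<sigma> permutes V" and \<tau>: "\<tau> permutes V" and t: "t' \<in> T"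
    and eq: "two_sided n a b \<tau> = two_sided n a b \<sigma> \<circ> t'" for \<sigma> \<tau> t'
  proof -
    obtain i' j' where ij': "t' = transpose i' j'" "{i', j'} \<in> E" using T_E[OF t] by blast
    define i j where "i = ?b i'" and "j = ?b j'"
    have bij: "b i = i'" "b j = j'" unfolding i_def j_def using permutes_inverses(1)[OF bp] by blast+
    have t: "transpose i j \<in> T" using bE[of i j] ij'(2) bij T_iff by simp
    have "a \<circ> (\<tau> \<circ> ?b) = a \<circ> (\<sigma> \<circ> ?b \<circ> t')"
      using eq unfolding two_sided_apply[OF \<sigma>] two_sided_apply[OF \<tau>] by (simp only: comp_assoc)
    then have "\<tau> \<circ> ?b = \<sigma> \<circ> ?b \<circ> t'" unfolding permutes_comp_cancel[OF ap] .
    then have "\<tau> \<circ> ?b \<circ> b = \<sigma> \<circ> ?b \<circ> (b \<circ> transpose i j \<circ> ?b) \<circ> b" unfolding conj bij ij' by simp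
    also have "\<dots> = \<sigma> \<circ> (?b \<circ> b) \<circ> transpose i j \<circ> (?b \<circ> b)" by (simp only: comp_assoc)
    finally have "\<tau> = \<sigma> \<circ> transpose i j"
      unfolding permutes_inv_o(2)[OF bp] comp_assoc comp_id id_comp by (simp only: permutes_inv_o(2)[OF bp] comp_id)
    then show ?thesis using t by blast
  qed
  have arc: "(u, v) \<in> parcs (cay n T) \<longleftrightarrow> (\<exists>t\<in>T. v = u \<circ> t)" if "u \<in> symm n" for u v
    using that unfolding cay_def by auto
  have v: "pverts (cay n T) = symm n" by (simp add: cay_def)
  have "(u, w) \<in> parcs (cay n T) \<longleftrightarrow> (two_sided n a b u, two_sided n a b w) \<in> parcs (cay n T)"
    if u: "u \<in> symm n" and w: "w \<in> symm n" for u w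
  proof -
    have "two_sided n a b u \<in> symm n" using two_sided_perm[OF ap bp] u by blast
    then show ?thesis unfolding arc[OF u] using arc[of "two_sided n a b u"] fwd[of u] bwd[of u w] u w by blast
  qed
  then show ?thesis unfolding digraph_auts_def v using two_sided_permutes[OF ap bp] by blast
qed

text \<open>Indexed by a gate instead of its position in the circuit, in order to cover also the images \<open>a g\<close>,
  which need not be gates of the circuit.\<close>
definition feas :: "nat set \<Rightarrow> (nat \<Rightarrow> nat) set" where
  "feas g = {\<tau> \<in> symm n. inv_into UNIV \<tau> ` g \<in> E}"

lemma feasible_eq: "feasible n E C k = feas (C ! (k - 1))"
  unfolding feasible_def feas_def ..

lemma feasI:
  assumes "\<tau> permutes V" "{u, v} \<in> E" 
  shows "\<tau> \<in> feas {\<tau> u, \<tau> v}"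
  unfolding feas_def using assms permutes_inverses(2)[OF assms(1)] by simp

lemma feas_iff:
  assumes "\<tau> permutes V"
  shows "\<tau> \<in> feas {\<tau> u, \<tau> v} \<longleftrightarrow> {u, v} \<in> E"
  unfolding feas_def using assms permutes_inverses(2)[OF assms(1)] by simp

text \<open>If every pair disjoint from an edge were an edge, all edges would meet a given non-edge \<open>{p, q}\<close>. This
  leaves room for a single vertex \<open>t\<close> besides the non-edge and a neighbour \<open>r\<close> of \<open>p\<close>, and then the
  graph is the 4-cycle \<open>p r q t\<close>.\<close>
lemma edge_nonedge_disjoint:
  assumes "card V \<ge> 4"
  obtains u v w x where "{u, v} \<in> E" "{w, x} \<notin> E" "distinct [u, v, w, x]" "{u, v, w, x} \<subseteq> V"
proof (rule ccontr)
  assume "\<not> thesis"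
  note none = this and witness = that
  have all: "{w, x} \<in> E" if h: "{u, v} \<in> E" "distinct [u, v, w, x]" "w \<in> V" "x \<in> V" for u v w x
  proof (rule ccontr)
    assume "{w, x} \<notin> E"
    moreover have "{u, v, w, x} \<subseteq> V" using edge_mem[OF h(1)] h(3,4) by blast
    ultimately show False using witness[OF h(1) _ h(2)] none by blast
  qed
  obtain p q where pq: "p \<in> V" "q \<in> V" "p \<noteq> q" "{p, q} \<notin> E" by (rule nonedge)
  obtain r where r: "{p, r} \<in> E" using edge_at[OF pq(1-3)] .
  have r': "r \<noteq> q" "r \<noteq> p" "r \<in> V" using r pq(4) edge_mem[OF r] by auto
  have meets: "u \<in> {p, q} \<or> v \<in> {p, q}" if "{u, v} \<in> E" for u v
    using all[OF that, of p q] edge_mem[OF that] pq by auto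
  have "V \<noteq> {p, q, r}"
  proof
    assume eq: "V = {p, q, r}"
    have "card V = 3" unfolding eq using pq r' by simp
    then show False using assms by simp
  qed
  then obtain t where t: "t \<in> V" "t \<notin> {p, q, r}" using pq r' by blast
  have qt: "{q, t} \<in> E" using all[OF r, of q t] t pq r' by auto
  have V: "V = {p, q, r, t}"
  proof
    show "V \<subseteq> {p, q, r, t}"
    proof
      fix s assume s: "s \<in> V"
      show "s \<in> {p, q, r, t}"
      proof (rule ccontr)
        assume n: "s \<notin> {p, q, r, t}"
        have "{s, t} \<in> E" using all[OF r, of s t] s t n r' by auto
        then show False using meets[of s t] n t by auto
      qed
    qed
  qed (use pq r' t in simp)
  have rt: "{r, t} \<notin> E" using meets[of r t] r' t by auto
  have iff: "{p, t} \<in> E \<longleftrightarrow> {q, r} \<in> E"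
    using all[of p t q r] all[of q r p t] pq r' t by auto
  obtain u v where uv: "u \<in> {p, r}" "v \<notin> {p, r}" "{u, v} \<in> E"
    using rtrancl_crossing[OF edge_path[OF pq(1,2)], of "{p, r}"] r' pq by auto
  have "v \<in> {p, q, r, t}" using edge_mem[OF uv(3)] unfolding V[symmetric] by blast
  then have "v = q \<or> v = t" using uv(2) by blast
  moreover have "u = p \<or> u = r" using uv(1) by blast
  moreover have "{r, q} = {q, r}" by (rule insert_commute)
  ultimately have "{p, t} \<in> E" using uv(3) pq(4) rt iff by metis
  then have qr: "{q, r} \<in> E" and pt: "{p, t} \<in> E" using iff by auto
  have "e \<in> {{p, r}, {r, q}, {q, t}, {t, p}}" if e: "e \<in> E" for e
  proof -
    obtain i j where ij: "e = {i, j}" using edge_pair[OF e] by blast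
    have "i \<noteq> j" "i \<in> {p, q, r, t}" "j \<in> {p, q, r, t}"
      using edge_mem[of i j] e unfolding ij V[symmetric] by blast+
    moreover have "{i, j} \<noteq> {p, q}" "{i, j} \<noteq> {r, t}" using e ij pq(4) rt by metis+
    ultimately show ?thesis unfolding ij by (elim insertE emptyE) (simp_all add: insert_commute)
  qed
  then have "E \<subseteq> {{p, r}, {r, q}, {q, t}, {t, p}}" by blast
  moreover have "{{p, r}, {r, q}, {q, t}, {t, p}} \<subseteq> E" using r qr qt pt by (simp add: insert_commute)
  ultimately have "E = {{p, r}, {r, q}, {q, t}, {t, p}}" by (rule equalityI)
  then show False using not_four_cycle[of p r q t] V pq r' t by auto
qed

text \<open>A permutation carrying an edge to \<open>g\<close> and a non-edge to \<open>h\<close> separates the two sets. Whether \<open>g\<close> and \<open>h\<close>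
  share a point decides which kind of edge and non-edge is needed; only the disjoint kind uses that
  the graph is not a 4-cycle.\<close>
lemma feas_inj:
  assumes g: "g \<in> nsets V 2" and h: "h \<in> nsets V 2" and eq: "feas g = feas h"
  shows "g = h"
proof (rule ccontr)
  assume ne: "g \<noteq> h"
  obtain p q where pq: "g = {p, q}" "p \<noteq> q" using g by (auto simp: nsets_def card_2_iff)
  obtain r s where rs: "h = {r, s}" "r \<noteq> s" using h by (auto simp: nsets_def card_2_iff)
  have V4: "p \<in> V" "q \<in> V" "r \<in> V" "s \<in> V" using g h pq rs by (auto simp: nsets_def)
  have meet: False if xyz: "{p, q} = {x, y}" "{r, s} = {x, z}" "distinct [x, y, z]" for x y z
  proof -
    obtain u v w where uvw: "{u, v} \<in> E" "{u, w} \<notin> E" "distinct [u, v, w]" "{u, v, w} \<subseteq> V"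
      by (rule edge_nonedge_meeting)
    have "{x, y, z} \<subseteq> V" using xyz V4 by (auto simp: doubleton_eq_iff)
    then obtain \<pi> where \<pi>: "\<pi> permutes V" "\<pi> u = x" "\<pi> v = y" "\<pi> w = z"
      using permutation_of_three[OF uvw(3) xyz(3) uvw(4)] by blast
    have "\<pi> \<in> feas g" using feas_iff[OF \<pi>(1), of u v] uvw \<pi> pq xyz by simp
    moreover have "\<pi> \<notin> feas h" using feas_iff[OF \<pi>(1), of u w] uvw \<pi> rs xyz by simp
    ultimately show False using eq by simp
  qed
  consider "p = r" | "p = s" | "q = r" | "q = s" | "distinct [p, q, r, s]" using pq rs by auto
  then show False
  proof cases
    case 1 then show ?thesis using meet[of p q s] pq rs ne by auto
  next
    case 2 then show ?thesis using meet[of p q r] pq rs ne by (auto simp: insert_commute)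
  next
    case 3 then show ?thesis using meet[of q p s] pq rs ne by (auto simp: insert_commute)
  next
    case 4 then show ?thesis using meet[of q p r] pq rs ne by (auto simp: insert_commute)
  next
    case 5
    have sub: "{p, q, r, s} \<subseteq> V" using V4 by simp
    have "card {p, q, r, s} = 4" using 5 by simp
    then have "card V \<ge> 4" using card_mono[OF _ sub] by simp
    then obtain u v w x where uvw: "{u, v} \<in> E" "{w, x} \<notin> E" "distinct [u, v, w, x]" "{u, v, w, x} \<subseteq> V"
      by (rule edge_nonedge_disjoint)
    obtain \<pi> where \<pi>: "\<pi> permutes V" "\<pi> u = p" "\<pi> v = q" "\<pi> w = r" "\<pi> x = s"
      using permutation_of_four[OF uvw(3) 5 uvw(4) sub] by blast
    have "\<pi> \<in> feas g" using feas_iff[OF \<pi>(1), of u v] uvw \<pi> pq by simp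
    moreover have "\<pi> \<notin> feas h" using feas_iff[OF \<pi>(1), of w x] uvw \<pi> rs by simp
    ultimately show False using eq by simp
  qed
qed

lemma two_sided_feas_iff:
  assumes a: "a permutes V" and b: "b \<in> digraph_auts (ugraph n E)" and \<tau>: "\<tau> permutes V"
  shows "two_sided n a b \<tau> \<in> feas (a ` g) \<longleftrightarrow> \<tau> \<in> feas g"
proof -
  have bp: "b permutes V" and bE: "\<And>i j. {b i, b j} \<in> E \<longleftrightarrow> {i, j} \<in> E" using b graph_aut_iff by auto
  let ?\<tau> = "two_sided n a b \<tau>"
  have "inv_into UNIV ?\<tau> = b \<circ> inv_into UNIV \<tau> \<circ> inv_into UNIV a"
    unfolding two_sided_apply[OF \<tau>]
    by (simp only: o_inv_distrib permutes_bij a bp \<tau> permutes_inv permutes_inv_inv[OF bp] comp_assoc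
      bij_comp permutes_bij[OF a] permutes_bij[OF \<tau>] permutes_bij[OF permutes_inv[OF bp]])
  then have "inv_into UNIV ?\<tau> ` a ` g = b ` inv_into UNIV \<tau> ` g"
    by (simp add: image_comp[symmetric] permutes_inverses(2)[OF a] image_image)
  moreover have "b ` X \<in> E \<longleftrightarrow> X \<in> E" for X
  proof
    assume "X \<in> E"
    then obtain i j where "X = {i, j}" using edge_pair by blast
    then show "b ` X \<in> E" using \<open>X \<in> E\<close> bE by simp
  next
    assume bX: "b ` X \<in> E"
    then obtain i j where "b ` X = {i, j}" using edge_pair by blast
    then have "inv_into UNIV b ` b ` X = {inv_into UNIV b i, inv_into UNIV b j}" by simp
    then obtain i j where X: "X = {i, j}" by (simp add: image_image permutes_inverses(2)[OF bp])
    have "{b i, b j} \<in> E" using bX unfolding X by simp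
    then show "X \<in> E" using bE unfolding X by blast
  qed
  ultimately show ?thesis using two_sided_perm[OF a bp \<tau>] \<tau> unfolding feas_def by simp
qed

lemma two_sided_fixes_feas_iff:
  assumes a: "a permutes V" and b: "b \<in> digraph_auts (ugraph n E)" and g: "g \<in> nsets V 2"
  shows "two_sided n a b ` feas g = feas g \<longleftrightarrow> a ` g = g"
proof -
  have bp: "b permutes V" using b graph_aut_iff by auto
  have sub: "feas g \<subseteq> symm n" for g unfolding feas_def by blast
  have perm: "two_sided n a b permutes symm n" by (rule two_sided_permutes[OF a bp])
  have "two_sided n a b ` feas g = feas (a ` g)"
  proof
    show "two_sided n a b ` feas g \<subseteq> feas (a ` g)" using two_sided_feas_iff[OF a b] sub by blast
    show "feas (a ` g) \<subseteq> two_sided n a b ` feas g"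
    proof
      fix \<sigma> assume \<sigma>: "\<sigma> \<in> feas (a ` g)"
      then have "\<sigma> \<in> two_sided n a b ` symm n" using sub permutes_image[OF perm] by blast
      then show "\<sigma> \<in> two_sided n a b ` feas g" using \<sigma> two_sided_feas_iff[OF a b] by blast
    qed
  qed
  moreover have "a ` g \<in> nsets V 2"
    using g permutes_image[OF a] card_image[OF permutes_inj_on[OF a]] by (auto simp: nsets_def)
  ultimately show ?thesis using feas_inj[of "a ` g" g] g by auto
qed

end


section \<open>The fixing pattern\<close>

lemma gate_reachable_iff:
  assumes U: "U \<subseteq> nsets {1..n} 2"
  shows "u \<rightarrow>\<^sup>*\<^bsub>with_proj (ugraph n U)\<^esub> v \<longleftrightarrow> u \<in> {1..n} \<and> (u, v) \<in> {(i, j). {i, j} \<in> U}\<^sup>*"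
proof -
  interpret pair_wf_digraph "ugraph n U" by unfold_locales (auto simp: ugraph_def)
  have arc: "(i, j) \<in> parcs (ugraph n U) \<longleftrightarrow> {i, j} \<in> U" for i j
    using subsetD[OF U, of "{i, j}"] pair_mem_nsets_iff[of i j "{1..n}"] by (auto simp: ugraph_def)
  have parcs: "parcs (ugraph n U) = {(i, j). {i, j} \<in> U}" using arc by auto
  show ?thesis
  proof
    assume r: "u \<rightarrow>\<^sup>*\<^bsub>with_proj (ugraph n U)\<^esub> v"
    then show "u \<in> {1..n} \<and> (u, v) \<in> {(i, j). {i, j} \<in> U}\<^sup>*"
      using reachable_rtranclI[OF r] reachable_in_verts(1)[OF r] unfolding with_proj_simps parcs
      by (simp add: ugraph_def)
  next
    assume a: "u \<in> {1..n} \<and> (u, v) \<in> {(i, j). {i, j} \<in> U}\<^sup>*"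
    from a have "(u, v) \<in> {(i, j). {i, j} \<in> U}\<^sup>*" by simp
    then show "u \<rightarrow>\<^sup>*\<^bsub>with_proj (ugraph n U)\<^esub> v"
    proof (induction rule: rtrancl_induct)
      case base then show ?case using a by (intro reachable_refl) (simp add: ugraph_def)
    next
      case (step v w)
      have "(v, w) \<in> parcs (ugraph n U)" using step.hyps(2) unfolding parcs .
      with step.IH show ?case by (rule reachable_adj_trans)
    qed
  qed
qed

lemma gate_components_eq:
  assumes U: "set C \<subseteq> nsets {1..n} 2"
  shows "gate_components n C = {{v. (u, v) \<in> {(i, j). {i, j} \<in> set C}\<^sup>*} | u. u \<in> {1..n}}"
proof -
  let ?R = "{(i, j). {i, j} \<in> set C}"
  have sym: "(v, u) \<in> ?R\<^sup>*" if "(u, v) \<in> ?R\<^sup>*" for u v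
  proof -
    have "sym ?R" by (auto simp: sym_def insert_commute)
    then show ?thesis using that sym_rtrancl unfolding sym_def by blast
  qed
  have closed: "v \<in> {1..n}" if "(u, v) \<in> ?R\<^sup>*" "u \<in> {1..n}" for u v
    using that
  proof (induction rule: rtrancl_induct)
    case (step v w)
    then have "{v, w} \<in> nsets {1..n} 2" using U by blast
    then show ?case by (simp only: pair_mem_nsets_iff)
  qed
  have "S \<in> gate_components n C \<longleftrightarrow> (\<exists>u\<in>{1..n}. S = {v. (u, v) \<in> ?R\<^sup>*})" for S
  proof
    assume "S \<in> gate_components n C"
    then have S: "S \<noteq> {}" "\<And>u v. u \<in> S \<Longrightarrow> v \<in> S \<Longrightarrow> u \<in> {1..n} \<and> (u, v) \<in> ?R\<^sup>*"
      "\<And>u v. u \<in> S \<Longrightarrow> v \<notin> S \<Longrightarrow> \<not> (u \<in> {1..n} \<and> (u, v) \<in> ?R\<^sup>*) \<or> \<not> (v \<in> {1..n} \<and> (v, u) \<in> ?R\<^sup>*)"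
      unfolding gate_components_def pre_digraph.sccs_verts_def gate_reachable_iff[OF U] by blast+
    obtain u where u: "u \<in> S" using S(1) by blast
    then have u': "u \<in> {1..n}" using S(2) by blast
    have "S = {v. (u, v) \<in> ?R\<^sup>*}"
    proof (intro equalityI subsetI)
      fix v assume "v \<in> S" then show "v \<in> {v. (u, v) \<in> ?R\<^sup>*}" using S(2)[OF u] by blast
    next
      fix v assume "v \<in> {v. (u, v) \<in> ?R\<^sup>*}"
      then have uv: "(u, v) \<in> ?R\<^sup>*" by (rule CollectD)
      then show "v \<in> S" using S(3)[OF u, of v] u' closed[OF uv u'] sym[OF uv] by blast
    qed
    then show "\<exists>u\<in>{1..n}. S = {v. (u, v) \<in> ?R\<^sup>*}" using u' by blast
  next
    assume "\<exists>u\<in>{1..n}. S = {v. (u, v) \<in> ?R\<^sup>*}"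
    then obtain u where u: "u \<in> {1..n}" and S: "S = {v. (u, v) \<in> ?R\<^sup>*}" by blast
    have "S \<noteq> {}" unfolding S by blast
    moreover have "v \<in> {1..n} \<and> (v, w) \<in> ?R\<^sup>*" if "v \<in> S" "w \<in> S" for v w
    proof -
      have uv: "(u, v) \<in> ?R\<^sup>*" and uw: "(u, w) \<in> ?R\<^sup>*" using that unfolding S by simp_all
      show ?thesis using closed[OF uv u] rtrancl_trans[OF sym[OF uv] uw] by blast
    qed
    moreover have "\<not> (v, w) \<in> ?R\<^sup>*" if v: "v \<in> S" and w: "w \<notin> S" for v w
    proof
      assume vw: "(v, w) \<in> ?R\<^sup>*"
      have uv: "(u, v) \<in> ?R\<^sup>*" using v unfolding S by (rule CollectD)
      show False using w rtrancl_trans[OF uv vw] unfolding S by blast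
    qed
    ultimately show "S \<in> gate_components n C"
      unfolding gate_components_def pre_digraph.sccs_verts_def gate_reachable_iff[OF U] by blast
  qed
  then show ?thesis by blast
qed

text \<open>In a component with at least three vertices, every vertex is the intersection of two edges or
  the other end of an edge at such a vertex, so stabilizing the edges fixes all vertices.\<close>
lemma pattern_perms_eq:
  assumes U: "set C \<subseteq> nsets {1..n} 2"
  shows "pattern_perms n (fixing_pattern n C) = {a \<in> symm n. \<forall>g\<in>set C. a ` g = g}"
proof -
  let ?R = "{(i, j). {i, j} \<in> set C}"
  define K where "K u = {v. (u, v) \<in> ?R\<^sup>*}" for u
  have comps: "gate_components n C = {K u | u. u \<in> {1..n}}" unfolding K_def by (rule gate_components_eq[OF U])
  have gate: "i \<in> {1..n} \<and> j \<in> {1..n} \<and> i \<noteq> j" if "{i, j} \<in> set C" for i j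
    using subsetD[OF U that] unfolding pair_mem_nsets_iff .
  have gate_pair: "\<exists>i j. g = {i, j}" if "g \<in> set C" for g
    using subsetD[OF U that] by (auto simp: nsets_def card_2_iff)
  have K_refl: "u \<in> K u" for u unfolding K_def by blast
  have K_sub: "K u \<subseteq> {1..n}" if "u \<in> {1..n}" for u
  proof
    fix v assume "v \<in> K u"
    then have "(u, v) \<in> ?R\<^sup>*" unfolding K_def by (rule CollectD)
    then show "v \<in> {1..n}" using that
      by (induction rule: rtrancl_induct) (use gate in auto)
  qed
  have K_fin: "finite (K u)" if "u \<in> {1..n}" for u using K_sub[OF that] finite_subset by blast
  have Kr: "\<exists>x y. x \<in> S \<and> y \<notin> S \<and> {x, y} \<in> set C" if "u \<in> S" "v \<in> K u" "v \<notin> S" for u v S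
  proof -
    have "(u, v) \<in> ?R\<^sup>*" using that(2) unfolding K_def by (rule CollectD)
    then show ?thesis by (rule rtrancl_crossing[OF _ that(1,3)]) blast
  qed
  have K_sym: "K v = K u" if "v \<in> K u" for u v
  proof -
    have uv: "(u, v) \<in> ?R\<^sup>*" using that unfolding K_def by (rule CollectD)
    have "sym ?R" by (auto simp: sym_def insert_commute)
    then have vu: "(v, u) \<in> ?R\<^sup>*" using uv sym_rtrancl unfolding sym_def by blast
    show ?thesis unfolding K_def
      by (intro Collect_cong iffI) (erule rtrancl_trans[OF uv], erule rtrancl_trans[OF vu])
  qed
  have comp_K: "K u \<in> gate_components n C" if "u \<in> {1..n}" for u unfolding comps using that by blast
  have fp_single: "{q} \<in> fixing_pattern n C" if "u \<in> {1..n}" "q \<in> K u" "card (K u) \<ge> 3" for u q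
    using comp_K[OF that(1)] that(2,3) unfolding fixing_pattern_def by blast
  have fp_pair: "K u \<in> fixing_pattern n C" if "u \<in> {1..n}" "card (K u) = 2" for u
    using comp_K[OF that(1)] that(2) unfolding fixing_pattern_def by blast
  have fp_cases: "(\<exists>q u. S = {q} \<and> u \<in> {1..n} \<and> q \<in> K u \<and> card (K u) \<ge> 3) \<or>
    (\<exists>u. S = K u \<and> u \<in> {1..n} \<and> card (K u) = 2) \<or> S = isolated_qubits n C" 
    if S: "S \<in> fixing_pattern n C" for S
  proof -
    have "(\<exists>q L. S = {q} \<and> L \<in> gate_components n C \<and> q \<in> L \<and> card L \<ge> 3) \<or>
      (S \<in> gate_components n C \<and> card S = 2) \<or> S = isolated_qubits n C"
      using S unfolding fixing_pattern_def by blast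
    moreover have "\<exists>u. u \<in> {1..n} \<and> L = K u" if "L \<in> gate_components n C" for L
      using that unfolding comps by blast
    ultimately show ?thesis by metis
  qed
  have key: "(\<forall>S\<in>fixing_pattern n C. a ` S = S) \<longleftrightarrow> (\<forall>g\<in>set C. a ` g = g)" if a: "a permutes {1..n}" for a
  proof
    assume fix_S: "\<forall>S\<in>fixing_pattern n C. a ` S = S"
    show "\<forall>g\<in>set C. a ` g = g"
    proof
      fix g assume g: "g \<in> set C"
      then obtain p q where pq: "g = {p, q}" using gate_pair by blast
      then have V: "p \<in> {1..n}" "q \<in> {1..n}" "p \<noteq> q" using gate g by blast+
      have q: "q \<in> K p" unfolding K_def using g pq by blast
      have sub: "{p, q} \<subseteq> K p" using q K_refl by blast
      show "a ` g = g"
      proof (cases "card (K p) = 2")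
        case True
        have "{p, q} = K p" by (rule card_subset_eq[OF K_fin[OF V(1)] sub]) (use True V in simp)
        moreover have "K p \<in> fixing_pattern n C" by (rule fp_pair[OF V(1) True])
        ultimately show ?thesis using fix_S pq by simp
      next
        case False
        have "card {p, q} \<le> card (K p)" by (rule card_mono[OF K_fin[OF V(1)] sub])
        then have c: "card (K p) \<ge> 3" using False V(3) by simp
        have "{p} \<in> fixing_pattern n C" "{q} \<in> fixing_pattern n C" using fp_single[OF V(1) _ c] q K_refl by blast+
        then have "a ` {p} = {p}" "a ` {q} = {q}" using fix_S by blast+
        then show ?thesis unfolding pq by simp
      qed
    qed
  next
    assume fix_g: "\<forall>g\<in>set C. a ` g = g"
    have two: "a r = r" if "{r, s} \<in> set C" "{r, t} \<in> set C" "s \<noteq> t" for r s t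
    proof -
      have "a r \<in> {r, s}" using bspec[OF fix_g that(1)] by blast
      moreover have "a r \<in> {r, t}" using bspec[OF fix_g that(2)] by blast
      ultimately show ?thesis using that(3) by blast
    qed
    show "\<forall>S\<in>fixing_pattern n C. a ` S = S"
    proof
      fix S assume "S \<in> fixing_pattern n C"
      then consider q u where "S = {q}" "u \<in> {1..n}" "q \<in> K u" "card (K u) \<ge> 3"
        | u where "S = K u" "u \<in> {1..n}" "card (K u) = 2" | "S = isolated_qubits n C"
        using fp_cases by blast
      then show "a ` S = S"
      proof cases
        case (1 q u)
        have Kq: "K q = K u" by (rule K_sym[OF 1(3)])
        have q: "q \<in> {1..n}" using K_sub[OF 1(2)] 1(3) by blast
        have third: "\<exists>v. v \<in> K q \<and> v \<notin> {q, x}" for x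
        proof (rule ccontr)
          assume "\<not> ?thesis"
          then have "K q \<subseteq> {q, x}" by blast
          then have "card (K q) \<le> card {q, x}" by (intro card_mono) auto
          also have "\<dots> \<le> 2" by (simp add: card_insert_if)
          finally show False using 1(4) Kq by simp
        qed
        obtain v where "v \<in> K q" "v \<notin> {q}" using third[of q] by blast
        then obtain r where r: "r \<noteq> q" "{q, r} \<in> set C" using Kr[of q "{q}" v] by blast
        obtain v where v: "v \<in> K q" "v \<notin> {q, r}" using third by blast
        obtain x s where xs: "x \<in> {q, r}" "s \<notin> {q, r}" "{x, s} \<in> set C" using Kr[OF _ v] by blast
        have rq: "{r, q} \<in> set C" using r(2) by (simp add: insert_commute)
        have "a q = q"
        proof (cases "x = q")
          case True
          show ?thesis by (rule two[OF r(2), of s]) (use xs True in auto)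
        next
          case False
          then have "{r, s} \<in> set C" using xs by simp
          then have "a r = r" by (rule two[OF rq]) (use xs in auto)
          moreover have "a q \<in> {q, r}" using bspec[OF fix_g r(2)] by blast
          moreover have "a q \<noteq> a r" using permutes_inj[OF a] r(1) by (simp add: inj_eq)
          ultimately show ?thesis by auto
        qed
        then show ?thesis using 1(1) by simp
      next
        case (2 u)
        have "\<exists>v. v \<in> K u \<and> v \<noteq> u"
        proof (rule ccontr)
          assume "\<not> ?thesis"
          then have "K u = {u}" using K_refl by blast
          then show False using 2(3) by simp
        qed
        then obtain r where r: "r \<noteq> u" "{u, r} \<in> set C" using Kr[of u "{u}"] by blast
        have "r \<in> K u" unfolding K_def using r(2) by blast
        then have "{u, r} \<subseteq> K u" using K_refl by blast
        then have "{u, r} = K u" using card_subset_eq[OF K_fin[OF 2(2)]] 2(3) r(1) by simp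
        then show ?thesis using fix_g r(2) 2(1) by metis
      next
        case 3
        have "a ` (\<Union> (set C)) = \<Union> (set C)"
        proof -
          have "a ` (\<Union> (set C)) = (\<Union>g\<in>set C. a ` g)" by blast
          also have "\<dots> = \<Union> (set C)" using fix_g by simp
          finally show ?thesis .
        qed
        moreover have "isolated_qubits n C = {1..n} - \<Union> (set C)" unfolding isolated_qubits_def by blast
        ultimately show ?thesis using 3 image_set_diff[OF permutes_inj[OF a]] permutes_image[OF a] by simp
      qed
    qed
  qed
  show ?thesis unfolding pattern_perms_def
    by (intro Collect_cong conj_cong refl) (simp only: key mem_Collect_eq)
qed


section \<open>The group acting on every layer\<close>

lemma layerwise_comp: "layerwise m (\<rho> \<circ> \<rho>') = layerwise m \<rho> \<circ> layerwise m \<rho>'"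
proof
  fix x show "layerwise m (\<rho> \<circ> \<rho>') x = (layerwise m \<rho> \<circ> layerwise m \<rho>') x" by (cases x) simp_all
qed

lemma layerwise_id: "layerwise m id = id"
proof
  fix x show "layerwise m id x = id x" by (cases x) simp_all
qed

lemma finite_endo_image:
  assumes "finite A" "inj_on f A" "f ` A \<subseteq> A"
  shows "f ` A = A"
  using endo_inj_surj assms by blast

locale circuit = coupling +
  fixes C :: "nat set list"
  assumes gates: "set C \<subseteq> nsets {1..n} 2" and gates_ne: "length C \<ge> 1"
begin

abbreviation "m \<equiv> length C"
abbreviation "X \<equiv> circuit_digraph n E C"
abbreviation "F k \<equiv> feasible n E C k"

lemma gate_mem: "k \<in> {1..m} \<Longrightarrow> C ! (k - 1) \<in> set C"
  by (rule nth_mem) auto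

lemma gate_nsets: "k \<in> {1..m} \<Longrightarrow> C ! (k - 1) \<in> nsets V 2"
  using gate_mem gates by blast

lemma set_C: "set C = {C ! (k - 1) | k. k \<in> {1..m}}"
proof (intro equalityI subsetI)
  fix g assume "g \<in> set C"
  then obtain i where "i < m" "g = C ! i" by (auto simp: in_set_conv_nth)
  then have "g = C ! (Suc i - 1)" "Suc i \<in> {1..m}" by simp_all
  then show "g \<in> {C ! (k - 1) | k. k \<in> {1..m}}" by blast
qed (use gate_mem in blast)

lemma feasible_sub: "F k \<subseteq> symm n"
  unfolding feasible_def by blast

lemma feas_ne:
  assumes "g \<in> nsets V 2"
  shows "feas g \<noteq> {}"
proof -
  obtain p q where pq: "g = {p, q}" "p \<noteq> q" using assms by (auto simp: nsets_def card_2_iff)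
  then have V: "p \<in> V" "q \<in> V" using assms pair_mem_nsets_iff by metis+
  obtain u v w where uv: "{u, v} \<in> E" by (rule edge_nonedge_meeting)
  have d: "u \<in> V" "v \<in> V" "u \<noteq> v" using edge_mem[OF uv] by blast+
  obtain w where w: "w \<in> V" "w \<noteq> u" "w \<noteq> v" using third_vertex[of u v] by blast
  obtain r where r: "r \<in> V" "r \<noteq> p" "r \<noteq> q" using third_vertex[of p q] by blast
  obtain \<pi> where \<pi>: "\<pi> permutes V" "\<pi> u = p" "\<pi> v = q"
  proof -
    have d1: "distinct [u, v, w]" and d2: "distinct [p, q, r]" using d(3) w(2,3) r(2,3) pq(2) by auto
    have s1: "{u, v, w} \<subseteq> V" and s2: "{p, q, r} \<subseteq> V" using d w V r by blast+
    show thesis by (rule permutation_of_three[OF d1 d2 s1 s2]) (rule that)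
  qed
  then have "\<pi> \<in> feas g" using feasI[OF \<pi>(1) uv] pq by simp
  then show ?thesis by blast
qed

lemma feasible_ne: "k \<in> {1..m} \<Longrightarrow> F k \<noteq> {}"
  unfolding feasible_eq by (rule feas_ne[OF gate_nsets])

text \<open>If \<open>d\<close> moves \<open>i\<close> to \<open>j\<close>, connectedness gives an edge containing exactly one of the two. Two
  permutations that carry this edge to the gate in opposite orientations and agree on the other one
  of \<open>i\<close>, \<open>j\<close> are both feasible and yield contradictory values of \<open>c\<close>.\<close>
lemma commuting_on_feas_trivial:
  assumes g: "g \<in> nsets V 2" and d: "d permutes V" and eq: "\<And>\<tau>. \<tau> \<in> feas g \<Longrightarrow> c \<circ> \<tau> = \<tau> \<circ> d" and c: "c permutes V"
  shows "d = id"
proof (rule ccontr)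
  assume "d \<noteq> id"
  then obtain i where i: "d i \<noteq> i" by (auto simp: fun_eq_iff)
  define j where "j = d i"
  have iV: "i \<in> V" using i permutes_not_in[OF d] by blast
  have jV: "j \<in> V" unfolding j_def using iV permutes_in_image[OF d] by blast
  have ij: "i \<noteq> j" using i j_def by simp
  obtain k where k: "k \<in> V" "k \<noteq> i" "k \<noteq> j" using third_vertex[of i j] by blast
  have ks: "k \<notin> {i, j}" using k by blast
  obtain u v where u: "u \<in> {i, j}" and v: "v \<notin> {i, j}" and uvE: "(u, v) \<in> {(a, b). {a, b} \<in> E}"
    using rtrancl_crossing[OF edge_path[OF iV k(1)] insertI1 ks] .
  have uv: "{u, v} \<in> E" using uvE by simp
  obtain p q where pq: "g = {p, q}" "p \<noteq> q" using g by (auto simp: nsets_def card_2_iff)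
  then have pqV: "p \<in> V" "q \<in> V" using g pair_mem_nsets_iff by metis+
  obtain u' where u': "{u, u'} = {i, j}" "u' \<noteq> u" using u ij by blast
  have V: "u \<in> V" "v \<in> V" "u' \<in> V" "u \<noteq> v" "u' \<noteq> v" using edge_mem[OF uv] u' v iV jV by (auto simp: doubleton_eq_iff)
  obtain r where r: "r \<in> V" "r \<noteq> p" "r \<noteq> q" using third_vertex[of p q] by blast
  have d1: "distinct [u, v, u']" and d2: "distinct [p, q, r]" "distinct [q, p, r]"
    using V(4,5) u'(2) r(2,3) pq(2) by auto
  have s1: "{u, v, u'} \<subseteq> V" and s2: "{p, q, r} \<subseteq> V" "{q, p, r} \<subseteq> V" using V pqV r by blast+
  obtain \<tau> where \<tau>: "\<tau> permutes V" "\<tau> u = p" "\<tau> v = q" "\<tau> u' = r"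
    by (rule permutation_of_three[OF d1 d2(1) s1 s2(1)])
  obtain \<tau>' where \<tau>': "\<tau>' permutes V" "\<tau>' u = q" "\<tau>' v = p" "\<tau>' u' = r"
    by (rule permutation_of_three[OF d1 d2(2) s1 s2(2)])
  have "\<tau> \<in> feas g" using feasI[OF \<tau>(1) uv] \<tau> pq by simp
  moreover have "\<tau>' \<in> feas g" using feasI[OF \<tau>'(1) uv] \<tau>' pq by (simp add: insert_commute)
  ultimately have at_i: "c (\<tau> i) = \<tau> j" "c (\<tau>' i) = \<tau>' j"
    using fun_cong[OF eq, of \<tau> i] fun_cong[OF eq, of \<tau>' i] unfolding j_def by simp_all
  consider "u = i" "u' = j" | "u = j" "u' = i" using u' ij by (auto simp: doubleton_eq_iff)
  then show False
  proof cases
    case 1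
    then have "c p = r" "c q = r" using at_i \<tau> \<tau>' by simp_all
    then show False using permutes_inj[OF c] pq(2) by (metis injD)
  next
    case 2
    then have "c r = p" "c r = q" using at_i \<tau> \<tau>' by simp_all
    then show False using pq(2) by simp
  qed
qed

lemma two_sided_determined:
  assumes g: "g \<in> nsets V 2" and p: "a permutes V" "b permutes V" "a' permutes V" "b' permutes V"
    and eq: "\<And>\<tau>. \<tau> \<in> feas g \<Longrightarrow> two_sided n a b \<tau> = two_sided n a' b' \<tau>"
  shows "a = a'" "b = b'"
proof -
  let ?i = "inv_into UNIV"
  have comm: "?i a' \<circ> a \<circ> \<tau> = \<tau> \<circ> (?i b' \<circ> b)" if \<tau>: "\<tau> \<in> feas g" for \<tau>
  proof -
    have \<tau>p: "\<tau> permutes V" using \<tau> unfolding feas_def by blast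
    have "?i a' \<circ> (a \<circ> \<tau> \<circ> ?i b) \<circ> b = ?i a' \<circ> (a' \<circ> \<tau> \<circ> ?i b') \<circ> b"
      using eq[OF \<tau>] unfolding two_sided_apply[OF \<tau>p] by (rule arg_cong)
    moreover have "?i a' \<circ> (a \<circ> \<tau> \<circ> ?i b) \<circ> b = ?i a' \<circ> a \<circ> \<tau> \<circ> (?i b \<circ> b)" by (simp only: comp_assoc)
    moreover have "?i a' \<circ> (a' \<circ> \<tau> \<circ> ?i b') \<circ> b = (?i a' \<circ> a') \<circ> \<tau> \<circ> (?i b' \<circ> b)" by (simp only: comp_assoc)
    ultimately show ?thesis unfolding permutes_inv_o(2)[OF p(3)] permutes_inv_o(2)[OF p(2)] by (simp only: comp_id id_comp)
  qed
  have pc: "(?i a' \<circ> a) permutes V" by (rule permutes_compose[OF p(1) permutes_inv[OF p(3)]])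
  have pd: "(?i b' \<circ> b) permutes V" by (rule permutes_compose[OF p(2) permutes_inv[OF p(4)]])
  have d: "?i b' \<circ> b = id" by (rule commuting_on_feas_trivial[OF g pd comm pc])
  then have "b' \<circ> (?i b' \<circ> b) = b'" by simp
  then show "b = b'" unfolding comp_assoc[symmetric] permutes_inv_o(1)[OF p(4)] id_comp .
  obtain \<tau> where \<tau>: "\<tau> \<in> feas g" using feas_ne[OF g] by blast
  then have \<tau>p: "\<tau> permutes V" unfolding feas_def by blast
  have "?i a' \<circ> a \<circ> \<tau> \<circ> ?i \<tau> = \<tau> \<circ> ?i \<tau>" using comm[OF \<tau>] unfolding d by simp
  then have "?i a' \<circ> a = id" unfolding comp_assoc permutes_inv_o(1)[OF \<tau>p] comp_id .
  then have "a' \<circ> (?i a' \<circ> a) = a'" by simp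
  then show "a = a'" unfolding comp_assoc[symmetric] permutes_inv_o(1)[OF p(3)] id_comp .
qed

lemma G_sub_eq:
  "G_sub n E C = {two_sided n a b | a b. a \<in> pattern_perms n (fixing_pattern n C) \<and> b \<in> digraph_auts (ugraph n E)}"
proof (intro equalityI subsetI)
  fix \<rho> assume \<rho>: "\<rho> \<in> G_sub n E C"
  have one: "1 \<in> {1..m}" using gates_ne by simp
  have "\<rho> \<in> digraph_auts (cay n T)" using \<rho> one unfolding G_sub_def cay_auts_fixing_def by blast
  then obtain a b where ab: "a \<in> symm n" "b \<in> digraph_auts (ugraph n E)" "\<rho> = two_sided n a b"
    by (rule cay_aut_two_sided)
  have ap: "a permutes V" using ab(1) by blast
  have "a ` g = g" if g: "g \<in> set C" for g
  proof -
    obtain k where k: "k \<in> {1..m}" "g = C ! (k - 1)" using g unfolding set_C by blast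
    have "\<rho> ` F k = F k" using \<rho> k(1) unfolding G_sub_def cay_auts_fixing_def by blast
    then have "two_sided n a b ` feas g = feas g" unfolding ab(3) feasible_eq k(2) .
    then show ?thesis unfolding k(2) by (rule two_sided_fixes_feas_iff[OF ap ab(2) gate_nsets[OF k(1)], THEN iffD1])
  qed
  then have "a \<in> pattern_perms n (fixing_pattern n C)" unfolding pattern_perms_eq[OF gates] using ab(1) by blast
  then show "\<rho> \<in> {two_sided n a b | a b. a \<in> pattern_perms n (fixing_pattern n C) \<and> b \<in> digraph_auts (ugraph n E)}"
    using ab by blast
next
  fix \<rho> assume "\<rho> \<in> {two_sided n a b | a b. a \<in> pattern_perms n (fixing_pattern n C) \<and> b \<in> digraph_auts (ugraph n E)}"
  then obtain a b where a: "a \<in> symm n" "\<forall>g\<in>set C. a ` g = g" and b: "b \<in> digraph_auts (ugraph n E)" and \<rho>: "\<rho> = two_sided n a b"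
    unfolding pattern_perms_eq[OF gates] by blast
  have ap: "a permutes V" using a(1) by blast
  have "\<rho> \<in> cay_auts_fixing n T (F k)" if k: "k \<in> {1..m}" for k
  proof -
    have "two_sided n a b ` feas (C ! (k - 1)) = feas (C ! (k - 1))"
      by (rule two_sided_fixes_feas_iff[OF ap b gate_nsets[OF k], THEN iffD2]) (rule bspec[OF a(2) gate_mem[OF k]])
    then show ?thesis unfolding cay_auts_fixing_def feasible_eq \<rho>
      by (intro CollectI conjI two_sided_cay_aut[OF a(1) b])
  qed
  then show "\<rho> \<in> G_sub n E C" unfolding G_sub_def by blast
qed

end


section \<open>Automorphisms of the circuit digraph\<close>

context circuit
begin

lemma vert_Copy [simp]: "Copy k \<tau> \<in> pverts X \<longleftrightarrow> k \<in> {1..m} \<and> \<tau> \<in> symm n"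
  and vert_Src [simp]: "Src \<in> pverts X" and vert_Snk [simp]: "Snk \<in> pverts X"
  unfolding circuit_digraph_def Let_def by auto

lemma arc_Copy:
  "(Copy k \<sigma>, Copy l \<tau>) \<in> parcs X \<longleftrightarrow> k \<in> {1..m} \<and> \<sigma> \<in> symm n \<and>
     (l = k \<and> (\<exists>t\<in>T. \<tau> = \<sigma> \<circ> t) \<or> l = k + 1 \<and> k + 1 \<le> m \<and> \<tau> = \<sigma> \<and> \<sigma> \<in> F k)"
  unfolding circuit_digraph_def Let_def using feasible_sub[of k] by auto

lemma arc_Src: "(Src, y) \<in> parcs X \<longleftrightarrow> (\<exists>\<tau>\<in>symm n. y = Copy 1 \<tau>)"
  unfolding circuit_digraph_def Let_def by auto

lemma no_arc_to_Src: "(x, Src) \<notin> parcs X"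
  unfolding circuit_digraph_def Let_def by auto

lemma arc_Snk: "(x, Snk) \<in> parcs X \<longleftrightarrow> (\<exists>\<tau>\<in>F m. x = Copy m \<tau>)"
  unfolding circuit_digraph_def Let_def by auto

lemma no_arc_from_Snk: "(Snk, y) \<notin> parcs X"
  unfolding circuit_digraph_def Let_def by auto

text \<open>Only the arcs inside layers come in opposite pairs, which makes layers visible to automorphisms.\<close>
lemma two_way_arc:
  assumes "(x, y) \<in> parcs X" "(y, x) \<in> parcs X"
  shows "\<exists>k \<sigma> \<tau>. x = Copy k \<sigma> \<and> y = Copy k \<tau>"
proof -
  have "x \<noteq> Src" "y \<noteq> Src" "x \<noteq> Snk" "y \<noteq> Snk"
    using assms no_arc_to_Src no_arc_from_Snk by blast+
  then obtain k \<sigma> l \<tau> where xy: "x = Copy k \<sigma>" "y = Copy l \<tau>" by (cases x; cases y) auto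
  have "l = k \<or> l = k + 1" "k = l \<or> k = l + 1" using assms unfolding xy arc_Copy by blast+
  then show ?thesis using xy by auto
qed

lemma T_nonempty: "T \<noteq> {}"
proof -
  obtain u v w where "{u, v} \<in> E" by (rule edge_nonedge_meeting)
  then show ?thesis using T_iff by blast
qed

lemma T_comp_perm: "\<tau> permutes V \<Longrightarrow> t \<in> T \<Longrightarrow> \<tau> \<circ> t permutes V"
  using permutes_compose[OF T_perm] by blast

lemma T_invol: "t \<in> T \<Longrightarrow> \<tau> \<circ> t \<circ> t = \<tau>"
  using T_E by (fastforce simp: comp_assoc)

lemma layer_two_way:
  assumes "k \<in> {1..m}" "\<tau> permutes V" "t \<in> T"
  shows "(Copy k \<tau>, Copy k (\<tau> \<circ> t)) \<in> parcs X" "(Copy k (\<tau> \<circ> t), Copy k \<tau>) \<in> parcs X"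
proof -
  show "(Copy k \<tau>, Copy k (\<tau> \<circ> t)) \<in> parcs X" unfolding arc_Copy using assms by blast
  have "\<tau> = \<tau> \<circ> t \<circ> t" by (rule T_invol[OF assms(3), symmetric])
  then show "(Copy k (\<tau> \<circ> t), Copy k \<tau>) \<in> parcs X"
    unfolding arc_Copy using assms T_comp_perm[OF assms(2,3)] by blast
qed

lemma G_X_sub_auts: "G_X n E C \<subseteq> digraph_auts X"
proof
  fix \<xi> assume "\<xi> \<in> G_X n E C"
  then obtain \<rho> where \<rho>: "\<rho> \<in> G_sub n E C" and \<xi>: "\<xi> = layerwise m \<rho>" unfolding G_X_def by blast
  have one: "1 \<in> {1..m}" using gates_ne by simp
  have "\<rho> \<in> digraph_auts (cay n T)" using \<rho> one unfolding G_sub_def cay_auts_fixing_def by blast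
  then have perm: "\<rho> permutes symm n"
    and cay: "\<And>u v. u \<in> symm n \<Longrightarrow> v \<in> symm n \<Longrightarrow> (\<exists>t\<in>T. v = u \<circ> t) \<longleftrightarrow> (\<exists>t\<in>T. \<rho> v = \<rho> u \<circ> t)"
  proof -
    assume aut: "\<rho> \<in> digraph_auts (cay n T)"
    have v: "pverts (cay n T) = symm n" by (simp add: cay_def)
    show p: "\<rho> permutes symm n" using aut unfolding digraph_auts_def v by blast
    have arc: "(u, v) \<in> parcs (cay n T) \<longleftrightarrow> (\<exists>t\<in>T. v = u \<circ> t)" if "u \<in> symm n" for u v
      using that unfolding cay_def by auto
    show "(\<exists>t\<in>T. v = u \<circ> t) \<longleftrightarrow> (\<exists>t\<in>T. \<rho> v = \<rho> u \<circ> t)" if "u \<in> symm n" "v \<in> symm n" for u v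
    proof -
      have "(u, v) \<in> parcs (cay n T) \<longleftrightarrow> (\<rho> u, \<rho> v) \<in> parcs (cay n T)"
        using aut that unfolding digraph_auts_def v by blast
      moreover have "\<rho> u \<in> symm n" using permutes_in_image[OF p] that(1) by blast
      ultimately show ?thesis using arc[OF that(1)] arc[of "\<rho> u" "\<rho> v"] by blast
    qed
  qed
  have sym: "\<rho> \<tau> \<in> symm n \<longleftrightarrow> \<tau> \<in> symm n" for \<tau> using permutes_in_image[OF perm] .
  have inj: "\<rho> \<sigma> = \<rho> \<tau> \<longleftrightarrow> \<sigma> = \<tau>" for \<sigma> \<tau> using permutes_inj[OF perm] by (simp add: inj_eq)
  have F: "\<rho> \<tau> \<in> F k \<longleftrightarrow> \<tau> \<in> F k" if k: "k \<in> {1..m}" for k \<tau>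
  proof -
    have "\<rho> ` F k = F k" using \<rho> k unfolding G_sub_def cay_auts_fixing_def by blast
    then show ?thesis using inj_image_mem_iff[OF permutes_inj[OF perm], of \<tau> "F k"] by simp
  qed
  have perm_X: "\<xi> permutes pverts X"
  proof -
    have "\<xi> \<circ> layerwise m (inv_into UNIV \<rho>) = id" "layerwise m (inv_into UNIV \<rho>) \<circ> \<xi> = id"
      unfolding \<xi> layerwise_comp[symmetric] permutes_inv_o[OF perm] by (rule layerwise_id)+
    then have "bij \<xi>" using o_bij by blast
    then have "\<forall>y. \<exists>!x. \<xi> x = y" unfolding bij_iff .
    moreover have "\<xi> x = x" if "x \<notin> pverts X" for x
      using that permutes_not_in[OF perm] unfolding \<xi> by (cases x) auto
    ultimately show ?thesis unfolding permutes_def[of \<xi>] by blast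
  qed
  have "(u, v) \<in> parcs X \<longleftrightarrow> (\<xi> u, \<xi> v) \<in> parcs X" if u: "u \<in> pverts X" and v: "v \<in> pverts X" for u v
  proof (cases u)
    case Src
    then show ?thesis using v sym unfolding \<xi> by (cases v) (auto simp: arc_Src)
  next
    case Snk
    then show ?thesis unfolding \<xi> by (simp add: no_arc_from_Snk)
  next
    case (Copy k \<sigma>)
    then have k: "k \<in> {1..m}" and \<sigma>: "\<sigma> \<in> symm n" using u by simp_all
    have \<xi>u: "\<xi> u = Copy k (\<rho> \<sigma>)" unfolding Copy \<xi> using k by simp
    show ?thesis
    proof (cases v)
      case Src
      then show ?thesis unfolding \<xi> by (simp add: no_arc_to_Src)
    next
      case Snk
      have "(Copy k \<sigma>, Snk) \<in> parcs X \<longleftrightarrow> k = m \<and> \<sigma> \<in> F m" for \<sigma> unfolding arc_Snk by blast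
      moreover have "\<rho> \<sigma> \<in> F m \<longleftrightarrow> \<sigma> \<in> F m" using F gates_ne by simp
      moreover have \<xi>v: "\<xi> v = Snk" unfolding Snk \<xi> by simp
      ultimately show ?thesis unfolding \<xi>u \<xi>v unfolding Snk Copy by simp
    next
      case (Copy l \<tau>)
      then have l: "l \<in> {1..m}" and \<tau>: "\<tau> \<in> symm n" using v by simp_all
      have \<xi>v: "\<xi> v = Copy l (\<rho> \<tau>)" unfolding Copy \<xi> using l by simp
      show ?thesis
        unfolding \<xi>u \<xi>v unfolding \<open>u = Copy k \<sigma>\<close> Copy arc_Copy sym inj F[OF k] cay[OF \<sigma> \<tau>] ..
    qed
  qed
  then show "\<xi> \<in> digraph_auts X" unfolding digraph_auts_def using perm_X by blast
qed

end

locale circuit_aut = circuit +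
  fixes \<xi> :: "(nat \<Rightarrow> nat) layered \<Rightarrow> (nat \<Rightarrow> nat) layered"
  assumes aut: "\<xi> \<in> digraph_auts X"
begin

lemma aut_perm: "\<xi> permutes pverts X"
  using aut unfolding digraph_auts_def by blast

lemma aut_arc: "u \<in> pverts X \<Longrightarrow> v \<in> pverts X \<Longrightarrow> (u, v) \<in> parcs X \<longleftrightarrow> (\<xi> u, \<xi> v) \<in> parcs X"
  using aut unfolding digraph_auts_def by blast

lemma aut_inj: "\<xi> u = \<xi> v \<longleftrightarrow> u = v"
  using permutes_inj[OF aut_perm] by (simp add: inj_eq)

lemma aut_vert: "\<xi> u \<in> pverts X \<longleftrightarrow> u \<in> pverts X"
  using permutes_in_image[OF aut_perm] .

lemma aut_preimage: "y \<in> pverts X \<Longrightarrow> \<exists>x\<in>pverts X. \<xi> x = y"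
  using permutes_image[OF aut_perm] by (metis imageE)

lemma obtain_T: obtains t where "t \<in> T"
  using T_nonempty by blast

lemma aut_Src: "\<xi> Src = Src"
proof (rule ccontr)
  assume n: "\<xi> Src \<noteq> Src"
  have v: "\<xi> Src \<in> pverts X" unfolding aut_vert by simp
  have "\<exists>y\<in>pverts X. (y, \<xi> Src) \<in> parcs X"
  proof (cases "\<xi> Src")
    case Src then show ?thesis using n by simp
  next
    case Snk
    obtain \<tau> where \<tau>: "\<tau> \<in> F m" using feasible_ne[of m] gates_ne by auto
    then have "\<tau> \<in> symm n" using feasible_sub by blast
    then show ?thesis using \<tau> gates_ne unfolding Snk arc_Snk by (intro bexI[of _ "Copy m \<tau>"]) auto
  next
    case (Copy k \<tau>)
    then have k: "k \<in> {1..m}" and \<tau>: "\<tau> permutes V" using v by simp_all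
    obtain t where t: "t \<in> T" by (rule obtain_T)
    have "Copy k (\<tau> \<circ> t) \<in> pverts X" using k T_comp_perm[OF \<tau> t] by simp
    then show ?thesis unfolding Copy using layer_two_way(2)[OF k \<tau> t] by blast
  qed
  then obtain y where y: "y \<in> pverts X" "(y, \<xi> Src) \<in> parcs X" by blast
  obtain x where "x \<in> pverts X" "\<xi> x = y" using aut_preimage[OF y(1)] by blast
  then have "(x, Src) \<in> parcs X" using aut_arc[of x Src] y(2) by simp
  then show False using no_arc_to_Src by blast
qed

lemma aut_Snk: "\<xi> Snk = Snk"
proof (rule ccontr)
  assume n: "\<xi> Snk \<noteq> Snk"
  have v: "\<xi> Snk \<in> pverts X" unfolding aut_vert by simp
  have "\<exists>y\<in>pverts X. (\<xi> Snk, y) \<in> parcs X"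
  proof (cases "\<xi> Snk")
    case Snk then show ?thesis using n by simp
  next
    case Src
    have "Copy 1 id \<in> pverts X" using gates_ne permutes_id by simp
    moreover have "id \<in> symm n" using permutes_id by blast
    ultimately show ?thesis unfolding Src arc_Src by blast
  next
    case (Copy k \<tau>)
    then have k: "k \<in> {1..m}" and \<tau>: "\<tau> permutes V" using v by simp_all
    obtain t where t: "t \<in> T" by (rule obtain_T)
    have "Copy k (\<tau> \<circ> t) \<in> pverts X" using k T_comp_perm[OF \<tau> t] by simp
    then show ?thesis unfolding Copy using layer_two_way(1)[OF k \<tau> t] by blast
  qed
  then obtain y where y: "y \<in> pverts X" "(\<xi> Snk, y) \<in> parcs X" by blast
  obtain x where "x \<in> pverts X" "\<xi> x = y" using aut_preimage[OF y(1)] by blast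
  then have "(Snk, x) \<in> parcs X" using aut_arc[of Snk x] y(2) by simp
  then show False using no_arc_from_Snk by blast
qed

text \<open>Each layer is connected by two-way arcs.\<close>
lemma spread_in_layer:
  assumes k: "k \<in> {1..m}" and \<sigma>: "\<sigma> permutes V" and \<xi>\<sigma>: "\<exists>\<sigma>'. \<xi> (Copy k \<sigma>) = Copy k \<sigma>'" and \<tau>: "\<tau> permutes V"
  shows "\<exists>\<tau>'. \<xi> (Copy k \<tau>) = Copy k \<tau>'"
proof -
  let ?P = "\<lambda>\<pi>. \<exists>\<tau>'. \<xi> (Copy k (\<sigma> \<circ> \<pi>)) = Copy k \<tau>'"
  have p: "inv_into UNIV \<sigma> \<circ> \<tau> permutes V" by (rule permutes_compose[OF \<tau> permutes_inv[OF \<sigma>]])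
  have "?P (inv_into UNIV \<sigma> \<circ> \<tau>)"
  proof (rule transpositions_generate[where P = ?P, OF _ _ T_path _ _ p])
    show "?P id" using \<xi>\<sigma> unfolding comp_id .
  next
    fix \<pi> t assume a: "\<pi> permutes V" "?P \<pi>" "t \<in> T"
    have \<sigma>\<pi>: "\<sigma> \<circ> \<pi> permutes V" by (rule permutes_compose[OF a(1) \<sigma>])
    have v: "Copy k (\<sigma> \<circ> \<pi>) \<in> pverts X" "Copy k (\<sigma> \<circ> \<pi> \<circ> t) \<in> pverts X"
      using k \<sigma>\<pi> T_comp_perm[OF \<sigma>\<pi> a(3)] by simp_all
    have "(\<xi> (Copy k (\<sigma> \<circ> \<pi>)), \<xi> (Copy k (\<sigma> \<circ> \<pi> \<circ> t))) \<in> parcs X"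
      "(\<xi> (Copy k (\<sigma> \<circ> \<pi> \<circ> t)), \<xi> (Copy k (\<sigma> \<circ> \<pi>))) \<in> parcs X"
      using aut_arc[OF v] aut_arc[OF v(2,1)] layer_two_way[OF k \<sigma>\<pi> a(3)] by blast+
    then obtain l \<alpha> \<beta> where "\<xi> (Copy k (\<sigma> \<circ> \<pi>)) = Copy l \<alpha>" "\<xi> (Copy k (\<sigma> \<circ> \<pi> \<circ> t)) = Copy l \<beta>"
      using two_way_arc by blast
    then show "?P (\<pi> \<circ> t)" using a(2) unfolding comp_assoc by auto
  qed (use T_perm in auto)
  then show ?thesis unfolding comp_assoc[symmetric] permutes_inv_o(1)[OF \<sigma>] id_comp .
qed

lemma finite_symm: "finite (symm n)"
  by (rule finite_permutations) simp

text \<open>The first layer is the out-neighbourhood of \<open>Src\<close>. An arc leaving layer \<open>k\<close> cannot be mapped to an arc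
  inside layer \<open>k\<close>, because that layer is already filled by its own image; so its target goes to
  layer \<open>k + 1\<close>.\<close>
lemma layer_preserved:
  assumes k: "k \<in> {1..m}" and \<tau>: "\<tau> permutes V"
  shows "\<exists>\<tau>'. \<xi> (Copy k \<tau>) = Copy k \<tau>'"
  using k \<tau>
proof (induction k arbitrary: \<tau>)
  case 0 then show ?case by simp
next
  case (Suc k)
  have id: "id permutes V" by (rule permutes_id)
  show ?case
  proof (cases "k = 0")
    case True
    have "(Src, Copy 1 id) \<in> parcs X" unfolding arc_Src using id by blast
    then have "(Src, \<xi> (Copy 1 id)) \<in> parcs X"
      using aut_arc[of Src "Copy 1 id"] id gates_ne aut_Src by simp
    then have "\<exists>\<sigma>'. \<xi> (Copy (Suc k) id) = Copy (Suc k) \<sigma>'" unfolding arc_Src True by auto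
    then show ?thesis by (rule spread_in_layer[OF Suc.prems(1) id _ Suc.prems(2)])
  next
    case False
    then have k: "k \<in> {1..m}" and k1: "k + 1 \<le> m" using Suc.prems(1) by simp_all
    obtain \<sigma> where \<sigma>F: "\<sigma> \<in> F k" using feasible_ne[OF k] by blast
    then have \<sigma>: "\<sigma> permutes V" using feasible_sub by blast
    obtain \<sigma>' where \<sigma>': "\<xi> (Copy k \<sigma>) = Copy k \<sigma>'" using Suc.IH[OF k \<sigma>] by blast
    have "(Copy k \<sigma>, Copy (k + 1) \<sigma>) \<in> parcs X" unfolding arc_Copy using k k1 \<sigma> \<sigma>F by simp
    then have arc: "(Copy k \<sigma>', \<xi> (Copy (k + 1) \<sigma>)) \<in> parcs X"
      using aut_arc[of "Copy k \<sigma>" "Copy (k + 1) \<sigma>"] k k1 \<sigma> \<sigma>' by simp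
    have "\<exists>\<tau>'. \<xi> (Copy (k + 1) \<sigma>) = Copy (k + 1) \<tau>'"
    proof (cases "\<xi> (Copy (k + 1) \<sigma>)")
      case Src then show ?thesis using arc no_arc_to_Src by metis
    next
      case Snk then show ?thesis using aut_inj[of "Copy (k + 1) \<sigma>" Snk] aut_Snk by simp
    next
      case (Copy l \<tau>')
      then have "l = k \<or> l = k + 1" using arc unfolding Copy arc_Copy by blast
      moreover have "l \<noteq> k"
      proof
        assume lk: "l = k"
        let ?L = "Copy k ` symm n"
        have sub: "\<xi> ` ?L \<subseteq> ?L"
        proof
          fix y assume "y \<in> \<xi> ` ?L"
          then obtain \<pi> where \<pi>: "\<pi> permutes V" "y = \<xi> (Copy k \<pi>)" by blast
          obtain \<pi>' where \<pi>': "\<xi> (Copy k \<pi>) = Copy k \<pi>'" using Suc.IH[OF k \<pi>(1)] by blast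
          have "Copy k \<pi>' \<in> pverts X" unfolding \<pi>'[symmetric] aut_vert using k \<pi>(1) by simp
          then show "y \<in> ?L" unfolding \<pi>(2) \<pi>' by simp
        qed
        have "\<xi> ` ?L = ?L"
          by (rule finite_endo_image[OF finite_imageI[OF finite_symm] _ sub]) (simp add: inj_on_def aut_inj)
        moreover have "Copy k \<tau>' \<in> ?L"
        proof -
          have "Copy l \<tau>' \<in> pverts X" unfolding Copy[symmetric] aut_vert using k1 \<sigma> by simp
          then show ?thesis using lk by simp
        qed
        ultimately have "Copy k \<tau>' \<in> \<xi> ` ?L" by (simp only:)
        then obtain \<pi> where "\<xi> (Copy k \<pi>) = Copy k \<tau>'" by auto
        then have "\<xi> (Copy k \<pi>) = \<xi> (Copy (k + 1) \<sigma>)" using Copy lk by simp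
        then have "Copy k \<pi> = Copy (k + 1) \<sigma>" unfolding aut_inj .
        then show False by simp
      qed
      ultimately show ?thesis using Copy by blast
    qed
    then have "\<exists>\<tau>'. \<xi> (Copy (Suc k) \<sigma>) = Copy (Suc k) \<tau>'" by simp
    then show ?thesis by (rule spread_in_layer[OF Suc.prems(1) \<sigma> _ Suc.prems(2)])
  qed
qed

definition on_layer :: "nat \<Rightarrow> (nat \<Rightarrow> nat) \<Rightarrow> (nat \<Rightarrow> nat)" where
  "on_layer k \<tau> = (if \<tau> \<in> symm n then (THE \<tau>'. \<xi> (Copy k \<tau>) = Copy k \<tau>') else \<tau>)"

lemma on_layer: "k \<in> {1..m} \<Longrightarrow> \<tau> \<in> symm n \<Longrightarrow> \<xi> (Copy k \<tau>) = Copy k (on_layer k \<tau>)"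
proof -
  assume k: "k \<in> {1..m}" and \<tau>: "\<tau> \<in> symm n"
  then obtain \<tau>' where \<tau>': "\<xi> (Copy k \<tau>) = Copy k \<tau>'" using layer_preserved by blast
  then have "(THE \<tau>'. \<xi> (Copy k \<tau>) = Copy k \<tau>') = \<tau>'" by (intro the_equality) auto
  then show ?thesis unfolding on_layer_def using \<tau> \<tau>' by simp
qed

lemma on_layer_symm:
  assumes "k \<in> {1..m}" "\<tau> \<in> symm n" shows "on_layer k \<tau> \<in> symm n"
proof -
  have "Copy k (on_layer k \<tau>) \<in> pverts X"
    unfolding on_layer[OF assms, symmetric] aut_vert using assms by simp
  then show ?thesis by simp
qed

lemma on_layer_inj: "k \<in> {1..m} \<Longrightarrow> inj_on (on_layer k) (symm n)"
proof (rule inj_onI)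
  fix \<sigma> \<tau> assume "k \<in> {1..m}" "\<sigma> \<in> symm n" "\<tau> \<in> symm n" "on_layer k \<sigma> = on_layer k \<tau>"
  then have "\<xi> (Copy k \<sigma>) = \<xi> (Copy k \<tau>)" using on_layer by metis
  then show "\<sigma> = \<tau>" unfolding aut_inj by simp
qed

lemma on_layer_cay_aut:
  assumes k: "k \<in> {1..m}"
  shows "on_layer k \<in> digraph_auts (cay n T)"
proof -
  have "on_layer k ` symm n = symm n"
    by (rule finite_endo_image[OF finite_symm on_layer_inj[OF k]]) (use on_layer_symm[OF k] in blast)
  then have "bij_betw (on_layer k) (symm n) (symm n)" using on_layer_inj[OF k] by (simp add: bij_betw_def)
  then have perm: "on_layer k permutes symm n"
    by (rule bij_imp_permutes) (simp add: on_layer_def)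
  have v: "pverts (cay n T) = symm n" by (simp add: cay_def)
  have arc: "(u, w) \<in> parcs (cay n T) \<longleftrightarrow> (Copy k u, Copy k w) \<in> parcs X" if "u \<in> symm n" for u w
  proof -
    have "(u, w) \<in> parcs (cay n T) \<longleftrightarrow> (\<exists>t\<in>T. w = u \<circ> t)" using that unfolding cay_def by auto
    moreover have "k \<noteq> k + 1" by simp
    ultimately show ?thesis unfolding arc_Copy using k that by blast
  qed
  have "(u, w) \<in> parcs (cay n T) \<longleftrightarrow> (on_layer k u, on_layer k w) \<in> parcs (cay n T)"
    if u: "u \<in> symm n" and w: "w \<in> symm n" for u w
    unfolding arc[OF u] arc[OF on_layer_symm[OF k u]] on_layer[OF k u, symmetric] on_layer[OF k w, symmetric]
    by (rule aut_arc) (use u w k in simp_all)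
  then show ?thesis unfolding digraph_auts_def v using perm by blast
qed

lemma on_layer_feasible:
  assumes k: "k \<in> {1..m}" and \<tau>: "\<tau> \<in> F k"
  shows "on_layer k \<tau> \<in> F k" "k + 1 \<le> m \<Longrightarrow> on_layer (k + 1) \<tau> = on_layer k \<tau>"
proof -
  have \<tau>s: "\<tau> \<in> symm n" using \<tau> feasible_sub by blast
  have vk: "Copy k \<tau> \<in> pverts X" using k \<tau>s by simp
  have succ: "on_layer (k + 1) \<tau> = on_layer k \<tau> \<and> on_layer k \<tau> \<in> F k" if k1: "k + 1 \<le> m"
  proof -
    have k1': "k + 1 \<in> {1..m}" using k1 by simp
    have v1: "Copy (k + 1) \<tau> \<in> pverts X" using k1' \<tau>s by simp
    have "(Copy k \<tau>, Copy (k + 1) \<tau>) \<in> parcs X" unfolding arc_Copy using k k1 \<tau> \<tau>s by simp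
    then have "(\<xi> (Copy k \<tau>), \<xi> (Copy (k + 1) \<tau>)) \<in> parcs X" unfolding aut_arc[OF vk v1] .
    then show ?thesis unfolding on_layer[OF k \<tau>s] on_layer[OF k1' \<tau>s] arc_Copy by simp
  qed
  show "k + 1 \<le> m \<Longrightarrow> on_layer (k + 1) \<tau> = on_layer k \<tau>" using succ by blast
  show "on_layer k \<tau> \<in> F k"
  proof (cases "k = m")
    case True
    have "(Copy k \<tau>, Snk) \<in> parcs X" unfolding arc_Snk using True \<tau> by blast
    then have "(\<xi> (Copy k \<tau>), \<xi> Snk) \<in> parcs X" unfolding aut_arc[OF vk vert_Snk] .
    then show ?thesis unfolding on_layer[OF k \<tau>s] aut_Snk arc_Snk using True by auto
  next
    case False
    then show ?thesis using succ k by simp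
  qed
qed

lemma on_layer_image: "k \<in> {1..m} \<Longrightarrow> on_layer k ` F k = F k"
  by (rule finite_endo_image[OF finite_subset[OF feasible_sub finite_symm] inj_on_subset[OF on_layer_inj feasible_sub]])
    (use on_layer_feasible(1) in blast)+

text \<open>Consecutive layers agree on a feasible set, which determines a two-sided translation.\<close>
lemma on_layer_const:
  assumes "k \<in> {1..m}"
  shows "on_layer k = on_layer 1"
  using assms
proof (induction k)
  case 0 then show ?case by simp
next
  case (Suc k)
  show ?case
  proof (cases "k = 0")
    case True then show ?thesis by simp
  next
    case False
    then have k: "k \<in> {1..m}" and k1: "k + 1 \<le> m" using Suc.prems by simp_all
    then have k1': "k + 1 \<in> {1..m}" by simp
    obtain a b where ab: "a \<in> symm n" "b \<in> digraph_auts (ugraph n E)" "on_layer k = two_sided n a b"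
      by (rule cay_aut_two_sided[OF on_layer_cay_aut[OF k]])
    obtain a' b' where ab': "a' \<in> symm n" "b' \<in> digraph_auts (ugraph n E)" "on_layer (k + 1) = two_sided n a' b'"
      by (rule cay_aut_two_sided[OF on_layer_cay_aut[OF k1']])
    have p: "a permutes V" "b permutes V" "a' permutes V" "b' permutes V"
      using ab ab' graph_aut_iff by blast+
    have eq: "two_sided n a b \<tau> = two_sided n a' b' \<tau>" if "\<tau> \<in> feas (C ! (k - 1))" for \<tau>
      using on_layer_feasible(2)[OF k _ k1, of \<tau>] that unfolding ab(3) ab'(3) feasible_eq by simp
    have "a = a'" "b = b'" using two_sided_determined[OF gate_nsets[OF k] p eq] by blast+
    then have "on_layer (k + 1) = on_layer k" unfolding ab(3) ab'(3) by simp
    then show ?thesis using Suc.IH[OF k] by simp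
  qed
qed

lemma aut_in_G_X: "\<xi> \<in> G_X n E C"
proof -
  have "on_layer 1 \<in> cay_auts_fixing n T (F k)" if k: "k \<in> {1..m}" for k
    unfolding cay_auts_fixing_def on_layer_const[OF k, symmetric]
    using on_layer_cay_aut[OF k] on_layer_image[OF k] by blast
  then have G: "on_layer 1 \<in> G_sub n E C" unfolding G_sub_def by blast
  have "\<xi> x = layerwise m (on_layer 1) x" for x
  proof (cases x)
    case Src then show ?thesis using aut_Src by simp
  next
    case Snk then show ?thesis using aut_Snk by simp
  next
    case (Copy k \<tau>)
    show ?thesis
    proof (cases "k \<in> {1..m} \<and> \<tau> \<in> symm n")
      case True
      then show ?thesis unfolding Copy using on_layer[of k \<tau>] on_layer_const[of k] by simp
    next
      case False
      then have "x \<notin> pverts X" unfolding Copy by simp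
      then have "\<xi> x = x" using permutes_not_in[OF aut_perm] by blast
      moreover have "layerwise m (on_layer 1) x = x" unfolding Copy using False by (auto simp: on_layer_def)
      ultimately show ?thesis by simp
    qed
  qed
  then have "\<xi> = layerwise m (on_layer 1)" by (rule ext)
  then show ?thesis unfolding G_X_def using G by blast
qed

end


section \<open>The group structure\<close>

lemma group_perm_group:
  assumes "id \<in> H" "\<And>f g. f \<in> H \<Longrightarrow> g \<in> H \<Longrightarrow> f \<circ> g \<in> H" "\<And>f. f \<in> H \<Longrightarrow> \<exists>g\<in>H. g \<circ> f = id"
  shows "group (perm_group H)"
  by (rule groupI) (use assms in \<open>simp_all add: perm_group_def comp_assoc\<close>)

context circuit
begin

abbreviation "A \<equiv> pattern_perms n (fixing_pattern n C)"
abbreviation "B \<equiv> digraph_auts (ugraph n E)"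

lemma A_perm: "a \<in> A \<Longrightarrow> a permutes V"
  unfolding pattern_perms_def by blast

lemma B_perm: "b \<in> B \<Longrightarrow> b permutes V"
  unfolding graph_aut_iff by blast

lemma group_A: "group (perm_group A)"
proof (rule group_perm_group)
  show "id \<in> A" unfolding pattern_perms_def using permutes_id by simp
  show "f \<circ> g \<in> A" if f: "f \<in> A" and g: "g \<in> A" for f g
  proof -
    have "(f \<circ> g) ` S = S" if "S \<in> fixing_pattern n C" for S
    proof -
      have "f ` S = S" "g ` S = S" using f g that unfolding pattern_perms_def by blast+
      then show ?thesis by (simp only: image_comp[symmetric])
    qed
    then show ?thesis
      using permutes_compose[OF A_perm[OF g] A_perm[OF f]] unfolding pattern_perms_def by blast
  qed
  show "\<exists>g\<in>A. g \<circ> f = id" if f: "f \<in> A" for f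
  proof
    have p: "f permutes V" by (rule A_perm[OF f])
    show "inv_into UNIV f \<circ> f = id" by (rule permutes_inv_o(2)[OF p])
    have "inv_into UNIV f ` S = S" if S: "f ` S = S" for S
    proof -
      have "inv_into UNIV f ` f ` S = S" by (simp add: image_image permutes_inverses(2)[OF p])
      then show ?thesis unfolding S .
    qed
    then show "inv_into UNIV f \<in> A"
      using f permutes_inv[OF p] unfolding pattern_perms_def by simp
  qed
qed

lemma group_B: "group (perm_group B)"
proof (rule group_perm_group)
  show "id \<in> B" unfolding graph_aut_iff using permutes_id by simp
  show "f \<circ> g \<in> B" if "f \<in> B" "g \<in> B" for f g
    using that permutes_compose unfolding graph_aut_iff by auto
  show "\<exists>g\<in>B. g \<circ> f = id" if f: "f \<in> B" for f
  proof
    have p: "f permutes V" by (rule B_perm[OF f])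
    show "inv_into UNIV f \<circ> f = id" by (rule permutes_inv_o(2)[OF p])
    have e: "{f i, f j} \<in> E \<longleftrightarrow> {i, j} \<in> E" for i j using f unfolding graph_aut_iff by blast
    have "{inv_into UNIV f i, inv_into UNIV f j} \<in> E \<longleftrightarrow> {i, j} \<in> E" for i j
      using e[of "inv_into UNIV f i" "inv_into UNIV f j"] permutes_inverses(1)[OF p] by simp
    then show "inv_into UNIV f \<in> B" unfolding graph_aut_iff using permutes_inv[OF p] by blast
  qed
qed

lemma G_X_iso: "perm_group (G_X n E C) \<cong> perm_group A \<times>\<times> perm_group B"
proof -
  define \<Phi> where "\<Phi> = (\<lambda>(a, b). layerwise m (two_sided n a b))"
  have one: "1 \<in> {1..m}" using gates_ne by simp
  have "\<Phi> \<in> iso (perm_group A \<times>\<times> perm_group B) (perm_group (G_X n E C))"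
    unfolding iso_iff
  proof (intro conjI)
    have img: "\<Phi> ` (A \<times> B) = G_X n E C"
      unfolding G_X_def G_sub_eq \<Phi>_def by (auto simp: image_iff)
    show "\<Phi> ` carrier (perm_group A \<times>\<times> perm_group B) = carrier (perm_group (G_X n E C))"
      using img by (simp add: perm_group_def)
    have "\<Phi> (a \<circ> a', b \<circ> b') = \<Phi> (a, b) \<circ> \<Phi> (a', b')" if "a \<in> A" "b \<in> B" "a' \<in> A" "b' \<in> B" for a b a' b'
      unfolding \<Phi>_def split
      using that by (simp only: layerwise_comp[symmetric] two_sided_comp A_perm B_perm)
    then show "\<Phi> \<in> hom (perm_group A \<times>\<times> perm_group B) (perm_group (G_X n E C))"
      using img by (intro homI) (auto simp: perm_group_def DirProd_def)
    show "inj_on \<Phi> (carrier (perm_group A \<times>\<times> perm_group B))"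
    proof (rule inj_onI)
      fix x y assume "x \<in> carrier (perm_group A \<times>\<times> perm_group B)" "y \<in> carrier (perm_group A \<times>\<times> perm_group B)"
        and eq: "\<Phi> x = \<Phi> y"
      then obtain a b a' b' where xy: "x = (a, b)" "y = (a', b')" "a \<in> A" "b \<in> B" "a' \<in> A" "b' \<in> B"
        by (auto simp: perm_group_def)
      have "two_sided n a b \<tau> = two_sided n a' b' \<tau>" for \<tau>
        using fun_cong[OF eq, of "Copy 1 \<tau>"] one unfolding xy \<Phi>_def by simp
      then have "a = a'" "b = b'"
        using two_sided_determined[OF gate_nsets[OF one] A_perm B_perm A_perm B_perm] xy by blast+
      then show "x = y" unfolding xy by simp
    qed
  qed
  then have "perm_group A \<times>\<times> perm_group B \<cong> perm_group (G_X n E C)" by (rule is_isoI)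
  then show ?thesis by (rule group.iso_sym[OF DirProd_group[OF group_A group_B]])
qed

end

theorem mainTheorem3:
  fixes n :: nat and E :: "nat set set" and C :: "nat set list"
  assumes coupling_graph: "E \<subseteq> nsets {1..n} 2"
    and connected: "Digraph_Component.connected (with_proj (ugraph n E))"
    and not_C4: "\<not> is_C4 n E"
    and not_complete: "\<not> is_complete n E"
    and circuit: "set C \<subseteq> nsets {1..n} 2"
    and gates: "length C \<ge> 1"
  shows "digraph_auts (circuit_digraph n E C) = G_X n E C \<and>
    perm_group (G_X n E C) \<cong>
      perm_group (pattern_perms n (fixing_pattern n C)) \<times>\<times> perm_group (digraph_auts (ugraph n E))"
proof -
  interpret circuit n E C by unfold_locales (fact assms)+
  have "\<xi> \<in> G_X n E C" if \<xi>: "\<xi> \<in> digraph_auts X" for \<xi>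
  proof -
    interpret circuit_aut n E C \<xi> by unfold_locales (rule \<xi>)
    show ?thesis by (rule aut_in_G_X)
  qed
  then have "digraph_auts X = G_X n E C" using G_X_sub_auts by blast
  then show ?thesis using G_X_iso by blast
qed

end
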